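(* Let $R$ be a plain function-passing higher-order rewrite system (HRS). If there exists no infinite static dependency chain in $R$, then $R$ is terminating, i.e. there is no infinite sequence $t_0 \to_R t_1 \to_R t_2 \to_R \cdots$ of terms.
   Context: Simple types are generated from a set $\mathcal{B}$ of basic types by $\to$. There are disjoint sets of typed variables and typed function symbols $\Sigma$. Terms are simply-typed $\lambda$-terms over variables and $\Sigma$ taken in $\eta$-long $\beta$-normal form; $t{\downarrow}$ denotes the $\eta$-long $\beta$-normal form of a simply-typed $\lambda$-term $t$, and terms are identified up to $\alpha$-equivalence ($\equiv$). Every term has the form $\lambda x_1\cdots x_m.\,a(t_1,\ldots,t_n)$ with $a$ a variable or function symbol; write $top(t)=a$ and $\mathit{args}(t)=\{t_1,\ldots,t_n\}$. $FV(t)$ is the set of free variables; bound variables are assumed pairwise distinct and distinct from free variables. A substitution $\theta$ is a type-preserving map from variables to terms. A rewrite rule is a pair $l\to r$ of terms with $top(l)\in\Sigma$, $type(l)=type(r)\in\mathcal{B}$ and $FV(l)\supseteq FV(r)$; an HRS is a set of rules. $s\to_R t$ iff $s\equiv C[l\theta{\downarrow}]$ and $t\equiv C[r\theta{\downarrow}]$ for some rule $l\to r\in R$, context $C[\,]$ and substitution $\theta$; $\to_R^*$ is its reflexive–transitive closure. $SN(R,t)$ means there is no infinite $\to_R$-sequence from $t$. Strong computability $SC(R,t)$ is defined by induction on types: if $type(t)\in\mathcal{B}$, $SC(R,t)$ iff $SN(R,t)$; if $type(t)=\alpha\to\beta$, $SC(R,t)$ iff for every term $u$ of type $\alpha$ with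 $SC(R,u)$ we have $SC(R,(t\,u){\downarrow})$. $\mathcal{T}^{\mathit{args}}_{SC}(R)=\{t\mid \forall u\in\mathit{args}(t).\,SC(R,u)\}$. Defined symbols $\mathcal{D}_R$ are the top symbols of left-hand sides of rules of $R$. For a term $t\equiv a(t_1,\ldots,t_n)$ with $a\in\mathcal{D}_R$, the marked term is $t^\sharp\equiv a^\sharp(t_1,\ldots,t_n)$ where $a^\sharp$ is a fresh (marked) function symbol; otherwise $t^\sharp\equiv t$. Safe subterms: for a rule $l\to r$, $\mathit{safe}(l)=\mathit{args}(l)\cup\bigcup_{l'\in\mathit{args}(l)}\{u\in \mathit{safe}_{\mathcal{B}}(l',FV(l))\mid FV(l)\supseteq FV(u)\}$, where $\mathit{safe}_{\mathcal{B}}(\lambda x_1\cdots x_m.\,a(t_1,\ldots,t_n),X)=\{a(t_1,\ldots,t_n)\}$ if $a\in X$, and $=\{a(t_1,\ldots,t_n)\}\cup\bigcup_{i=1}^n\mathit{safe}_{\mathcal{B}}(t_i,X)$ otherwise. $R$ is plain function-passing (PFP) if for every $l\to r\in R$ and every subterm $Z(r_1,\ldots,r_n)$ of $r$ with $Z\in FV(r)$ there is $k\le n$ with $Z(r_1,\ldots,r_k){\downarrow}\in\mathit{safe}(l)$. (Subterms: $Sub(\lambda x.s)=\{\lambda x.s\}\cup Sub(s)$, $Sub(a(t_1,\ldots,t_n))=\{a(t_1,\ldots,t_n)\}\cup\bigcup_i Sub(t_i)$.) Candidate terms: $Cand(\lambda x_1\cdots x_m.\,a(t_1,\ldots,t_n))=\{\lambda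 x_1\cdots x_m.\,a(t_1,\ldots,t_n)\}\cup\bigcup_{i=1}^n Cand(\lambda x_1\cdots x_m.\,t_i)$. A static dependency pair of $R$ is a pair $l^\sharp\to a^\sharp(r_1,\ldots,r_n)$ such that there is a rule $l\to r\in R$ with $\lambda x_1\cdots x_m.\,a(r_1,\ldots,r_n)\in Cand(r)$, $a\in\mathcal{D}_R$, and $a(r_1,\ldots,r_k){\downarrow}\notin\mathit{safe}(l)$ for all $k\le n$; $SDP(R)$ is the set of these. A (finite or infinite) sequence $u_0^\sharp\to v_0^\sharp,\,u_1^\sharp\to v_1^\sharp,\ldots$ of static dependency pairs is a static dependency chain if there exist substitutions $\theta_0,\theta_1,\ldots$ with $v_i^\sharp\theta_i{\downarrow}\to_R^* u_{i+1}^\sharp\theta_{i+1}{\downarrow}$ and $u_i\theta_i{\downarrow},v_i\theta_i{\downarrow}\in\mathcal{T}^{\mathit{args}}_{SC}(R)$ for all $i$. *)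

theory Defs
  imports Main "HOL-Library.Infinite_Typeclass" "HOL-Library.Extended_Nat"
begin

datatype 'b ty = Base 'b | Fun "'b ty" "'b ty"

text \<open>\<^term>\<open>Mark f\<close> is the fresh marked copy of the function symbol \<^term>\<open>f\<close>.\<close>

datatype 'f sym = Sym 'f | Mark 'f

text \<open>
  A variable is a name paired with its type; as names range over an infinite type, there are
  infinitely many variables of every type.  The types of the function symbols are given by a
  signature \<open>S :: 'f \<Rightarrow> 'b ty\<close>, so the set of function symbols is the whole type \<open>'f\<close>.
\<close>

type_synonym ('b, 'v) var = "'v \<times> 'b ty"

text \<open>
  Lambda-terms up to alpha-equivalence, in locally nameless form: bound variables are de Bruijn
  indices, free variables are named.  Only locally closed terms (no dangling index) represent
  lambda-terms.  Binders are handled through the named abstraction \<open>lam x t\<close>, so that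
  \<open>t = lam x s\<close> with \<open>s\<close> locally closed says that \<open>\<lambda>x. s\<close> is one of the
  alpha-representatives of \<open>t\<close>.
\<close>

datatype ('b, 'f, 'v) tm =
    Bd nat
  | Fr "('b, 'v) var"
  | Con "'f sym"
  | App "('b, 'f, 'v) tm" "('b, 'f, 'v) tm"
  | Abs "'b ty" "('b, 'f, 'v) tm"

primrec FV :: "('b, 'f, 'v) tm \<Rightarrow> ('b, 'v) var set" where
  "FV (Bd i) = {}"
| "FV (Fr x) = {x}"
| "FV (Con c) = {}"
| "FV (App s t) = FV s \<union> FV t"
| "FV (Abs \<sigma> t) = FV t"

primrec lc_at :: "nat \<Rightarrow> ('b, 'f, 'v) tm \<Rightarrow> bool" where
  "lc_at k (Bd i) \<longleftrightarrow> i < k"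
| "lc_at k (Fr x) \<longleftrightarrow> True"
| "lc_at k (Con c) \<longleftrightarrow> True"
| "lc_at k (App s t) \<longleftrightarrow> lc_at k s \<and> lc_at k t"
| "lc_at k (Abs \<sigma> t) \<longleftrightarrow> lc_at (Suc k) t"

abbreviation lc :: "('b, 'f, 'v) tm \<Rightarrow> bool" where
  "lc \<equiv> lc_at 0"

primrec bind_at :: "nat \<Rightarrow> ('b, 'v) var \<Rightarrow> ('b, 'f, 'v) tm \<Rightarrow> ('b, 'f, 'v) tm" where
  "bind_at k x (Bd i) = Bd i"
| "bind_at k x (Fr y) = (if y = x then Bd k else Fr y)"
| "bind_at k x (Con c) = Con c"
| "bind_at k x (App s t) = App (bind_at k x s) (bind_at k x t)"
| "bind_at k x (Abs \<sigma> t) = Abs \<sigma> (bind_at (Suc k) x t)"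

definition lam :: "('b, 'v) var \<Rightarrow> ('b, 'f, 'v) tm \<Rightarrow> ('b, 'f, 'v) tm" where
  "lam x t = Abs (snd x) (bind_at 0 x t)"

definition lams :: "('b, 'v) var list \<Rightarrow> ('b, 'f, 'v) tm \<Rightarrow> ('b, 'f, 'v) tm" where
  "lams xs t = foldr lam xs t"

definition apps :: "('b, 'f, 'v) tm \<Rightarrow> ('b, 'f, 'v) tm list \<Rightarrow> ('b, 'f, 'v) tm" where
  "apps t ts = foldl App t ts"

definition atom :: "('b, 'f, 'v) tm \<Rightarrow> bool" where
  "atom a \<longleftrightarrow> (\<exists>x. a = Fr x) \<or> (\<exists>c. a = Con c)"

text \<open>
  Simultaneous substitution; it does not shift indices because it is only used with locally
  closed \<open>\<theta> x\<close>.
\<close>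

primrec subst :: "(('b, 'v) var \<Rightarrow> ('b, 'f, 'v) tm) \<Rightarrow> ('b, 'f, 'v) tm \<Rightarrow> ('b, 'f, 'v) tm" where
  "subst \<theta> (Bd i) = Bd i"
| "subst \<theta> (Fr x) = \<theta> x"
| "subst \<theta> (Con c) = Con c"
| "subst \<theta> (App s t) = App (subst \<theta> s) (subst \<theta> t)"
| "subst \<theta> (Abs \<sigma> t) = Abs \<sigma> (subst \<theta> t)"

text \<open>Contexts; \<open>CLam x C\<close> captures the variable \<open>x\<close> of whatever is put into the hole.\<close>

datatype ('b, 'f, 'v) ctx =
    Hole
  | CAppL "('b, 'f, 'v) ctx" "('b, 'f, 'v) tm"
  | CAppR "('b, 'f, 'v) tm" "('b, 'f, 'v) ctx"
  | CLam "('b, 'v) var" "('b, 'f, 'v) ctx"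

primrec fill :: "('b, 'f, 'v) ctx \<Rightarrow> ('b, 'f, 'v) tm \<Rightarrow> ('b, 'f, 'v) tm" where
  "fill Hole u = u"
| "fill (CAppL C t) u = App (fill C u) t"
| "fill (CAppR t C) u = App t (fill C u)"
| "fill (CLam x C) u = lam x (fill C u)"

primrec sym_ty :: "('f \<Rightarrow> 'b ty) \<Rightarrow> 'f sym \<Rightarrow> 'b ty" where
  "sym_ty S (Sym f) = S f"
| "sym_ty S (Mark f) = S f"

text \<open>In \<open>has_ty S \<Gamma> t \<tau>\<close>, the list \<open>\<Gamma>\<close> gives the types of the dangling indices.\<close>

inductive has_ty :: "('f \<Rightarrow> 'b ty) \<Rightarrow> 'b ty list \<Rightarrow> ('b, 'f, 'v) tm \<Rightarrow> 'b ty \<Rightarrow> bool"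
  for S where
  "i < length \<Gamma> \<Longrightarrow> has_ty S \<Gamma> (Bd i) (\<Gamma> ! i)"
| "has_ty S \<Gamma> (Fr x) (snd x)"
| "has_ty S \<Gamma> (Con c) (sym_ty S c)"
| "has_ty S \<Gamma> s (Fun \<sigma> \<tau>) \<Longrightarrow> has_ty S \<Gamma> t \<sigma> \<Longrightarrow> has_ty S \<Gamma> (App s t) \<tau>"
| "has_ty S (\<sigma> # \<Gamma>) t \<tau> \<Longrightarrow> has_ty S \<Gamma> (Abs \<sigma> t) (Fun \<sigma> \<tau>)"

inductive contract :: "('f \<Rightarrow> 'b ty) \<Rightarrow> ('b, 'f, 'v) tm \<Rightarrow> ('b, 'f, 'v) tm \<Rightarrow> bool"
  for S where
  beta: "has_ty S [] s \<tau> \<Longrightarrow> has_ty S [] t (snd x) \<Longrightarrow>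
    contract S (App (lam x s) t) (subst (Fr(x := t)) s)"
| eta: "has_ty S [] s (Fun (snd x) \<tau>) \<Longrightarrow> x \<notin> FV s \<Longrightarrow>
    contract S (lam x (App s (Fr x))) s"

definition beta_eta_step :: "('f \<Rightarrow> 'b ty) \<Rightarrow> ('b, 'f, 'v) tm \<Rightarrow> ('b, 'f, 'v) tm \<Rightarrow> bool" where
  "beta_eta_step S s t \<longleftrightarrow> (\<exists>\<tau>. has_ty S [] s \<tau>) \<and>
     (\<exists>C u v. contract S u v \<and> s = fill C u \<and> t = fill C v)"

text \<open>
  Convertibility runs through well-typed terms only: with type-annotated binders, beta-eta
  conversion is not confluent on ill-typed terms, and normal forms would not be unique.
\<close>

definition conv :: "('f \<Rightarrow> 'b ty) \<Rightarrow> ('b, 'f, 'v) tm \<Rightarrow> ('b, 'f, 'v) tm \<Rightarrow> bool" where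
  "conv S = equivclp (beta_eta_step S)"

text \<open>\<open>lnf S t \<tau>\<close>: \<open>t\<close> is an eta-long beta-normal term of type \<open>\<tau>\<close>.\<close>

inductive lnf :: "('f \<Rightarrow> 'b ty) \<Rightarrow> ('b, 'f, 'v) tm \<Rightarrow> 'b ty \<Rightarrow> bool"
  for S where
  "atom a \<Longrightarrow> has_ty S [] a (foldr Fun \<tau>s (Base b)) \<Longrightarrow> list_all2 (lnf S) ts \<tau>s \<Longrightarrow>
    lnf S (apps a ts) (Base b)"
| "lnf S t \<tau> \<Longrightarrow> lnf S (lam x t) (Fun (snd x) \<tau>)"

definition nf :: "('f \<Rightarrow> 'b ty) \<Rightarrow> ('b, 'f, 'v) tm \<Rightarrow> ('b, 'f, 'v) tm" where
  "nf S t = (THE u. conv S t u \<and> (\<exists>\<tau>. lnf S u \<tau>))"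

primrec unmarked :: "('b, 'f, 'v) tm \<Rightarrow> bool" where
  "unmarked (Bd i) \<longleftrightarrow> True"
| "unmarked (Fr x) \<longleftrightarrow> True"
| "unmarked (Con c) \<longleftrightarrow> (\<exists>f. c = Sym f)"
| "unmarked (App s t) \<longleftrightarrow> unmarked s \<and> unmarked t"
| "unmarked (Abs \<sigma> t) \<longleftrightarrow> unmarked t"

definition terms_of :: "('f \<Rightarrow> 'b ty) \<Rightarrow> 'b ty \<Rightarrow> ('b, 'f, 'v) tm set" where
  "terms_of S \<tau> = {t. lnf S t \<tau> \<and> unmarked t}"

definition terms :: "('f \<Rightarrow> 'b ty) \<Rightarrow> ('b, 'f, 'v) tm set" where
  "terms S = (\<Union>\<tau>. terms_of S \<tau>)"

definition is_subst :: "('f \<Rightarrow> 'b ty) \<Rightarrow> (('b, 'v) var \<Rightarrow> ('b, 'f, 'v) tm) \<Rightarrow> bool" where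
  "is_subst S \<theta> \<longleftrightarrow> (\<forall>x. \<theta> x \<in> terms_of S (snd x))"

primrec top_of :: "('b, 'f, 'v) tm \<Rightarrow> ('b, 'f, 'v) tm" where
  "top_of (Bd i) = Bd i"
| "top_of (Fr x) = Fr x"
| "top_of (Con c) = Con c"
| "top_of (App s t) = top_of s"
| "top_of (Abs \<sigma> t) = top_of t"

definition args :: "('b, 'f, 'v) tm \<Rightarrow> ('b, 'f, 'v) tm set" where
  "args t = {u. \<exists>xs a ts. t = lams xs (apps a ts) \<and> atom a \<and> (\<forall>s\<in>set ts. lc s) \<and> u \<in> set ts}"

type_synonym ('b, 'f, 'v) rules = "(('b, 'f, 'v) tm \<times> ('b, 'f, 'v) tm) set"

definition HRS :: "('f \<Rightarrow> 'b ty) \<Rightarrow> ('b, 'f, 'v) rules \<Rightarrow> bool" where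
  "HRS S R \<longleftrightarrow> (\<forall>(l, r)\<in>R.
     (\<exists>f. top_of l = Con (Sym f)) \<and>
     (\<exists>b. l \<in> terms_of S (Base b) \<and> r \<in> terms_of S (Base b)) \<and>
     FV r \<subseteq> FV l)"

text \<open>
  The terms being rewritten may contain marked symbols (as in dependency chains), but rules and
  substitutions do not.
\<close>

definition rstep ::
  "('f \<Rightarrow> 'b ty) \<Rightarrow> ('b, 'f, 'v) rules \<Rightarrow> ('b, 'f, 'v) tm \<Rightarrow> ('b, 'f, 'v) tm \<Rightarrow> bool" where
  "rstep S R s t \<longleftrightarrow> (\<exists>\<tau>. lnf S s \<tau>) \<and>
     (\<exists>(l, r)\<in>R. \<exists>C \<theta>. is_subst S \<theta> \<and>
        s = fill C (nf S (subst \<theta> l)) \<and> t = fill C (nf S (subst \<theta> r)))"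

definition SN :: "('f \<Rightarrow> 'b ty) \<Rightarrow> ('b, 'f, 'v) rules \<Rightarrow> ('b, 'f, 'v) tm \<Rightarrow> bool" where
  "SN S R t \<longleftrightarrow> \<not> (\<exists>s :: nat \<Rightarrow> _. s 0 = t \<and> (\<forall>i. rstep S R (s i) (s (Suc i))))"

primrec sc_at ::
  "('f \<Rightarrow> 'b ty) \<Rightarrow> ('b, 'f, 'v) rules \<Rightarrow> 'b ty \<Rightarrow> ('b, 'f, 'v) tm \<Rightarrow> bool" where
  "sc_at S R (Base b) = (\<lambda>t. SN S R t)"
| "sc_at S R (Fun \<alpha> \<beta>) =
     (\<lambda>t. \<forall>u\<in>terms_of S \<alpha>. sc_at S R \<alpha> u \<longrightarrow> sc_at S R \<beta> (nf S (App t u)))"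

definition SC :: "('f \<Rightarrow> 'b ty) \<Rightarrow> ('b, 'f, 'v) rules \<Rightarrow> ('b, 'f, 'v) tm \<Rightarrow> bool" where
  "SC S R t \<longleftrightarrow> (\<exists>\<tau>. t \<in> terms_of S \<tau> \<and> sc_at S R \<tau> t)"

definition T_args_SC :: "('f \<Rightarrow> 'b ty) \<Rightarrow> ('b, 'f, 'v) rules \<Rightarrow> ('b, 'f, 'v) tm set" where
  "T_args_SC S R = {t \<in> terms S. \<forall>u\<in>args t. SC S R u}"

definition defined_syms :: "('b, 'f, 'v) rules \<Rightarrow> 'f set" where
  "defined_syms R = {f. \<exists>(l, r)\<in>R. top_of l = Con (Sym f)}"

primrec sharp :: "('b, 'f, 'v) rules \<Rightarrow> ('b, 'f, 'v) tm \<Rightarrow> ('b, 'f, 'v) tm" where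
  "sharp R (Bd i) = Bd i"
| "sharp R (Fr x) = Fr x"
| "sharp R (Con c) =
     Con (case c of Sym f \<Rightarrow> if f \<in> defined_syms R then Mark f else Sym f | Mark f \<Rightarrow> Mark f)"
| "sharp R (App s t) = App (sharp R s) t"
| "sharp R (Abs \<sigma> t) = Abs \<sigma> t"

text \<open>
  The following two predicates read \<open>u \<in> safe\<^sub>B(t, X)\<close> and \<open>u \<in> Sub(t)\<close>.  They descend below
  binders, choosing the names of the bound variables outside \<open>X\<close>, which is always the set of
  variables of a left-hand side; this is the convention that bound variables differ from the
  free ones.
\<close>

inductive in_safe_B :: "('b, 'v) var set \<Rightarrow> ('b, 'f, 'v) tm \<Rightarrow> ('b, 'f, 'v) tm \<Rightarrow> bool"
  for X where
  "atom a \<Longrightarrow> in_safe_B X (apps a ts) (apps a ts)"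
| "atom a \<Longrightarrow> a \<notin> Fr ` X \<Longrightarrow> t \<in> set ts \<Longrightarrow> in_safe_B X t u \<Longrightarrow> in_safe_B X (apps a ts) u"
| "x \<notin> X \<Longrightarrow> lc t \<Longrightarrow> in_safe_B X t u \<Longrightarrow> in_safe_B X (lam x t) u"

definition safe :: "('b, 'f, 'v) tm \<Rightarrow> ('b, 'f, 'v) tm set" where
  "safe l = args l \<union> (\<Union>l'\<in>args l. {u. in_safe_B (FV l) l' u \<and> FV u \<subseteq> FV l})"

inductive in_Sub :: "('b, 'v) var set \<Rightarrow> ('b, 'f, 'v) tm \<Rightarrow> ('b, 'f, 'v) tm \<Rightarrow> bool"
  for X where
  "in_Sub X t t"
| "atom a \<Longrightarrow> t \<in> set ts \<Longrightarrow> in_Sub X t u \<Longrightarrow> in_Sub X (apps a ts) u"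
| "x \<notin> X \<Longrightarrow> lc t \<Longrightarrow> in_Sub X t u \<Longrightarrow> in_Sub X (lam x t) u"

definition PFP :: "('f \<Rightarrow> 'b ty) \<Rightarrow> ('b, 'f, 'v) rules \<Rightarrow> bool" where
  "PFP S R \<longleftrightarrow> (\<forall>(l, r)\<in>R. \<forall>Z\<in>FV r. \<forall>rs. in_Sub (FV l) r (apps (Fr Z) rs) \<longrightarrow>
     (\<exists>k\<le>length rs. nf S (apps (Fr Z) (take k rs)) \<in> safe l))"

text \<open>\<open>in_Cand t u\<close> reads \<open>u \<in> Cand(t)\<close>.\<close>

inductive in_Cand :: "('b, 'f, 'v) tm \<Rightarrow> ('b, 'f, 'v) tm \<Rightarrow> bool" where
  "in_Cand t t"
| "atom a \<Longrightarrow> \<forall>s\<in>set ts. lc s \<Longrightarrow> t \<in> set ts \<Longrightarrow> in_Cand (lams xs t) u \<Longrightarrow>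
    in_Cand (lams xs (apps a ts)) u"

text \<open>
  In a static dependency pair the binders \<open>xs\<close> of the candidate are dropped and become free
  variables; their names are arbitrary, up to being distinct and different from the variables
  of the rule.
\<close>

definition SDP :: "('f \<Rightarrow> 'b ty) \<Rightarrow> ('b, 'f, 'v) rules \<Rightarrow> ('b, 'f, 'v) rules" where
  "SDP S R = {(sharp R l, sharp R (apps (Con (Sym a)) rs)) | l r xs a rs.
     (l, r) \<in> R \<and> a \<in> defined_syms R \<and>
     distinct xs \<and> set xs \<inter> FV l = {} \<and> (\<forall>u\<in>set rs. lc u) \<and>
     in_Cand r (lams xs (apps (Con (Sym a)) rs)) \<and>
     (\<forall>k\<le>length rs. nf S (apps (Con (Sym a)) (take k rs)) \<notin> safe l)}"

text \<open>
  \<open>sd_chain S R N u v\<close>: the sequence of the pairs \<open>(u\<^sub>i\<^sup>\<sharp>, v\<^sub>i\<^sup>\<sharp>)\<close> for \<open>i < N\<close> is a static dependency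
  chain; it is infinite iff \<open>N = \<infinity>\<close>.
\<close>

definition sd_chain ::
  "('f \<Rightarrow> 'b ty) \<Rightarrow> ('b, 'f, 'v) rules \<Rightarrow> enat \<Rightarrow>
   (nat \<Rightarrow> ('b, 'f, 'v) tm) \<Rightarrow> (nat \<Rightarrow> ('b, 'f, 'v) tm) \<Rightarrow> bool" where
  "sd_chain S R N u v \<longleftrightarrow>
     (\<forall>i. enat i < N \<longrightarrow>
        u i \<in> terms S \<and> v i \<in> terms S \<and> (sharp R (u i), sharp R (v i)) \<in> SDP S R) \<and>
     (\<exists>\<theta> :: nat \<Rightarrow> ('b, 'v) var \<Rightarrow> ('b, 'f, 'v) tm.
        (\<forall>i. enat i < N \<longrightarrow> is_subst S (\<theta> i) \<and>
           nf S (subst (\<theta> i) (u i)) \<in> T_args_SC S R \<and>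
           nf S (subst (\<theta> i) (v i)) \<in> T_args_SC S R) \<and>
        (\<forall>i. enat (Suc i) < N \<longrightarrow>
           (rstep S R)\<^sup>*\<^sup>* (nf S (subst (\<theta> i) (sharp R (v i))))
                        (nf S (subst (\<theta> (Suc i)) (sharp R (u (Suc i)))))))"

end

theory Submission
  imports Defs
begin

text \<open>
  If a term is not strongly computable, a minimal subterm witnessing this has the form
  \<open>f(s\<^sub>1,\<dots>,s\<^sub>n)\<close> with \<open>f\<close> defined, all \<open>s\<^sub>i\<close> strongly computable, and is not terminating.  An infinite
  reduction from it reduces the arguments to an instance \<open>l\<theta>\<close> of a left-hand side and continues from
  \<open>r\<theta>\<close>.  Safe subterms of \<open>l\<close> are strongly computable under \<open>\<theta>\<close>, which by plain function-passing takes
  care of the free variables of \<open>r\<close>; so a minimal failure among the candidate terms of \<open>r\<close> yields a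
  static dependency pair and another term of the same kind.

  Normal forms are handled by binary logical relations.  Taking ``has a common normal form'' as the
  base relation shows that long normal forms exist and are unique; taking ``rewrites to'' shows that
  rewriting, and hence strong computability, is compatible with application and substitution.
\<close>

text \<open>A rule is applied to normalised instances, so rewriting interferes with normalisation:
  after a step in \<open>s\<close>, the normal form of \<open>App s u\<close> may have that redex
  copied, erased or instantiated further. Following this through hereditary substitution is avoided
  by relations defined by recursion on types, whose base case compares normal forms up to many
  steps.

  A second obstacle is safe subterms below binders. Such a subterm of a computable argument need not
  be computable at a function type, but it terminates as long as the substitution cannot remove it.
  Hence \<open>safe\<close> takes inner subterms in basic form, where computability and termination
  coincide, and stops at applied variables of the left-hand side.

  Binders passed during the search become free variables with arbitrary computable values. This is
  why a dependency pair may drop them, and why the substitution of the pair extends the original one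
  only outside the variables of the left-hand side.\<close>

declare split_paired_All [simp del] split_paired_Ex [simp del]

section \<open>Locally nameless terms\<close>

text \<open>
  No index is shifted, so \<open>esub\<close> makes sense only when \<open>e\<close> and \<open>\<theta>\<close> have locally closed values.
  Dangling indices have to be treated because the context \<open>CLam x C\<close> binds both \<open>x\<close> and the
  index 0 of whatever is put into the hole.
\<close>

primrec esub ::
  "nat \<Rightarrow> (nat \<Rightarrow> ('b, 'f, 'v) tm) \<Rightarrow> (('b, 'v) var \<Rightarrow> ('b, 'f, 'v) tm) \<Rightarrow>
   ('b, 'f, 'v) tm \<Rightarrow> ('b, 'f, 'v) tm" where
  "esub k e \<theta> (Bd i) = (if i < k then Bd i else e (i - k))"
| "esub k e \<theta> (Fr x) = \<theta> x"
| "esub k e \<theta> (Con c) = Con c"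
| "esub k e \<theta> (App s t) = App (esub k e \<theta> s) (esub k e \<theta> t)"
| "esub k e \<theta> (Abs \<sigma> t) = Abs \<sigma> (esub (Suc k) e \<theta> t)"

text \<open>Sending every dangling index to \<open>u\<close> is harmless: in the body of a locally
  closed abstraction only index 0 dangles.\<close>

definition opn :: "('b, 'f, 'v) tm \<Rightarrow> ('b, 'f, 'v) tm \<Rightarrow> ('b, 'f, 'v) tm" where
  "opn u b = esub 0 (\<lambda>_. u) Fr b"

primrec syms :: "('b, 'f, 'v) tm \<Rightarrow> 'f sym set" where
  "syms (Bd i) = {}"
| "syms (Fr x) = {}"
| "syms (Con c) = {c}"
| "syms (App s t) = syms s \<union> syms t"
| "syms (Abs \<sigma> t) = syms t"

primrec tm_size :: "('b, 'f, 'v) tm \<Rightarrow> nat" where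
  "tm_size (Bd i) = 1"
| "tm_size (Fr x) = 1"
| "tm_size (Con c) = 1"
| "tm_size (App s t) = Suc (tm_size s + tm_size t)"
| "tm_size (Abs \<sigma> t) = Suc (tm_size t)"

lemma unmarked_syms: "unmarked t \<longleftrightarrow> syms t \<subseteq> range Sym"
  by (induction t) auto

lemma finite_FV [simp]: "finite (FV t)"
  by (induction t) auto

lemma ex_fresh:
  assumes "finite (A :: ('b, 'v :: infinite) var set)"
  obtains x where "x \<notin> A" "snd x = \<sigma>"
proof -
  have "finite (fst ` A)" using assms by simp
  then obtain v where "v \<notin> fst ` A" using ex_new_if_finite[OF infinite_UNIV] by blast
  then have "(v, \<sigma>) \<notin> A" by force
  then show thesis using that[of "(v, \<sigma>)"] by simp
qed

lemma lc_at_mono: "lc_at k t \<Longrightarrow> k \<le> k' \<Longrightarrow> lc_at k' t"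
  by (induction t arbitrary: k k') auto

lemma lc_imp_lc_at: "lc t \<Longrightarrow> lc_at k t"
  using lc_at_mono by blast

lemma esub_subst: "lc_at k t \<Longrightarrow> esub k e \<theta> t = subst \<theta> t"
  by (induction t arbitrary: k) auto

lemma esub_lc: "lc t \<Longrightarrow> esub k e \<theta> t = subst \<theta> t"
  by (simp add: esub_subst lc_imp_lc_at)

lemma subst_Fr [simp]: "subst Fr t = t"
  by (induction t) auto

lemma lc_esub: "(\<And>i. lc (e i)) \<Longrightarrow> (\<And>x. lc (\<theta> x)) \<Longrightarrow> lc_at k (esub k e \<theta> t)"
  by (induction t arbitrary: k) (auto intro: lc_imp_lc_at)

lemma lc_subst: "(\<And>x. lc (\<theta> x)) \<Longrightarrow> lc_at k t \<Longrightarrow> lc_at k (subst \<theta> t)"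
  by (induction t arbitrary: k) (auto intro: lc_imp_lc_at)

lemma subst_subst: "subst \<theta> (subst \<sigma> t) = subst (\<lambda>x. subst \<theta> (\<sigma> x)) t"
  by (induction t) auto

lemma esub_bind: "esub k e \<theta> (bind_at k x t) = esub k e (\<theta>(x := e 0)) t"
  by (induction t arbitrary: k) auto

text \<open>This identity carries the beta rule: pushing an environment under a binder and then
  opening the binder with \<open>u\<close> extends the environment by \<open>u\<close>. Local
  closedness keeps the opening from touching indices inside the substituted values.\<close>

lemma esub_comp:
  assumes "\<And>i. lc (e i)" "\<And>x. lc (\<theta> x)"
  shows "esub k (\<lambda>_. u) Fr (esub (Suc k) e \<theta> t) = esub k (case_nat u e) \<theta> t"
proof (induction t arbitrary: k)
  case (Bd i)
  consider "i < k" | "i = k" | j where "i = Suc (k + j)"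
    by (metis less_iff_Suc_add linorder_neqE_nat)
  then show ?case by cases (auto simp: esub_lc assms)
qed (auto simp: esub_lc assms)

lemma opn_esub:
  assumes "\<And>i. lc (e i)" "\<And>x. lc (\<theta> x)"
  shows "opn u (esub (Suc 0) e \<theta> t) = esub 0 (case_nat u e) \<theta> t"
  unfolding opn_def using assms by (rule esub_comp)

lemma opn_bind: "lc t \<Longrightarrow> opn u (bind_at 0 x t) = subst (Fr(x := u)) t"
  by (simp add: opn_def esub_bind esub_lc)

lemma bind_opn:
  "lc_at (Suc k) b \<Longrightarrow> x \<notin> FV b \<Longrightarrow> bind_at k x (esub k (\<lambda>_. Fr x) Fr b) = b"
  by (induction b arbitrary: k) auto

text \<open>Lets any raw binder be displayed under a chosen fresh name, as the notions of
  contraction, context and long normal form require.\<close>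

lemma Abs_eq_lam: "lc_at (Suc 0) b \<Longrightarrow> x \<notin> FV b \<Longrightarrow> Abs (snd x) b = lam x (opn (Fr x) b)"
  by (simp add: lam_def opn_def bind_opn)

lemma FV_bind [simp]: "FV (bind_at k x t) = FV t - {x}"
  by (induction t arbitrary: k) auto

lemma FV_lam [simp]: "FV (lam x t) = FV t - {x}"
  by (simp add: lam_def)

lemma syms_bind [simp]: "syms (bind_at k x t) = syms t"
  by (induction t arbitrary: k) auto

lemma syms_lam [simp]: "syms (lam x t) = syms t"
  by (simp add: lam_def)

lemma tm_size_bind [simp]: "tm_size (bind_at k x t) = tm_size t"
  by (induction t arbitrary: k) auto

lemma tm_size_lam [simp]: "tm_size (lam x t) = Suc (tm_size t)"
  by (simp add: lam_def)

lemma lc_bind: "lc_at (Suc k) (bind_at k x t) \<longleftrightarrow> lc_at (Suc k) t"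
  by (induction t arbitrary: k) auto

lemma lc_lam: "lc t \<Longrightarrow> lc (lam x t)"
  by (simp add: lam_def lc_bind lc_imp_lc_at)

lemma FV_esub: "FV (esub k e \<theta> t) \<subseteq> (\<Union>x\<in>FV t. FV (\<theta> x)) \<union> (\<Union>i. FV (e i))"
proof (induction t arbitrary: k)
  case (App s t)
  show ?case using App.IH[of k] unfolding esub.simps FV.simps FV.simps by blast
qed auto

lemma FV_subst: "FV (subst \<theta> t) = (\<Union>x\<in>FV t. FV (\<theta> x))"
  by (induction t) auto

lemma FV_opn: "FV (opn u b) \<subseteq> FV u \<union> FV b"
  unfolding opn_def using FV_esub[of 0 "\<lambda>_. u" Fr b] by auto

lemma syms_esub: "syms (esub k e \<theta> t) \<subseteq> syms t \<union> (\<Union>x\<in>FV t. syms (\<theta> x)) \<union> (\<Union>i. syms (e i))"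
proof (induction t arbitrary: k)
  case (App s t)
  show ?case using App.IH[of k] unfolding esub.simps syms.simps FV.simps by blast
qed auto

lemma syms_subst: "syms (subst \<theta> t) = syms t \<union> (\<Union>x\<in>FV t. syms (\<theta> x))"
  by (induction t) auto

lemma syms_opn: "syms (opn u b) \<subseteq> syms u \<union> syms b"
  unfolding opn_def using syms_esub[of 0 "\<lambda>_. u" Fr b] by auto

lemma subst_cong: "(\<And>x. x \<in> FV t \<Longrightarrow> \<theta> x = \<theta>' x) \<Longrightarrow> subst \<theta> t = subst \<theta>' t"
  by (induction t) auto

text \<open>As \<open>w\<close> may have dangling indices, \<open>lam x w\<close> binds two things
  at once, the name \<open>x\<close> and index 0; both have to be sent to the new name
  \<open>z\<close>.\<close>

lemma esub_lam:
  fixes w :: "('b, 'f, 'v) tm"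
  assumes lc: "\<And>i. lc (e i)" "\<And>x. lc (\<theta> x)"
    and z: "z \<notin> FV (esub 0 e \<theta> (lam x w))" "snd z = snd x"
  shows "esub 0 e \<theta> (lam x w) = lam z (esub 0 (case_nat (Fr z) e) (\<theta>(x := Fr z)) w)"
proof -
  let ?b = "esub (Suc 0) e \<theta> (bind_at 0 x w)"
  have "esub 0 e \<theta> (lam x w) = Abs (snd z) ?b" using z by (simp add: lam_def)
  also have "\<dots> = lam z (opn (Fr z) ?b)"
    by (rule Abs_eq_lam) (use z lc in \<open>auto simp: lam_def intro!: lc_esub\<close>)
  also have "opn (Fr z) ?b = esub 0 (case_nat (Fr z) e) \<theta> (bind_at 0 x w)"
    by (rule opn_esub[OF lc])
  also have "\<dots> = esub 0 (case_nat (Fr z) e) (\<theta>(x := Fr z)) w"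
    by (simp add: esub_bind)
  finally show ?thesis .
qed

lemma subst_lam:
  assumes lc: "\<And>x. lc (\<theta> x)" and w: "lc w"
    and z: "z \<notin> FV (subst \<theta> (lam x w))" "snd z = snd x"
  shows "subst \<theta> (lam x w) = lam z (subst (\<theta>(x := Fr z)) w)"
proof -
  have "esub 0 (\<lambda>_. Fr z) \<theta> (lam x w)
      = lam z (esub 0 (case_nat (Fr z) (\<lambda>_. Fr z)) (\<theta>(x := Fr z)) w)"
    by (rule esub_lam) (use lc z w in \<open>auto simp: esub_lc lc_lam\<close>)
  then show ?thesis by (simp add: esub_lc lc_lam w)
qed

lemma lam_rename:
  assumes "lc w" "z \<notin> FV w - {x}" "snd z = snd x"
  shows "lam x w = lam z (subst (Fr(x := Fr z)) w)"
  using subst_lam[of Fr w z x] assms by simp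

lemma lam_eqD:
  assumes "lam x s = lam y t" "lc s" "lc t"
  shows "snd x = snd y" "t = subst (Fr(x := Fr y)) s"
proof -
  show "snd x = snd y" using assms(1) by (simp add: lam_def)
  have "opn (Fr y) (bind_at 0 x s) = opn (Fr y) (bind_at 0 y t)"
    using assms(1) by (simp add: lam_def)
  then show "t = subst (Fr(x := Fr y)) s" using assms(2,3) by (simp add: opn_bind)
qed

lemma lam_inject [simp]: "lc s \<Longrightarrow> lc t \<Longrightarrow> lam x s = lam x t \<longleftrightarrow> s = t"
  using lam_eqD[of x s x t] by auto

lemma lam_neq [simp]: "lam x s \<noteq> App t u" "App t u \<noteq> lam x s" "lam x s \<noteq> Fr y" "lam x s \<noteq> Con c"
  "Fr y \<noteq> lam x s" "Con c \<noteq> lam x s"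
  by (auto simp: lam_def)

lemma apps_Nil [simp]: "apps a [] = a"
  and apps_snoc [simp]: "apps a (ts @ [t]) = App (apps a ts) t"
  and apps_append: "apps a (ts @ us) = apps (apps a ts) us"
  by (simp_all add: apps_def)

lemma FV_apps [simp]: "FV (apps a ts) = FV a \<union> (\<Union>t\<in>set ts. FV t)"
  by (induction ts rule: rev_induct) auto

lemma syms_apps [simp]: "syms (apps a ts) = syms a \<union> (\<Union>t\<in>set ts. syms t)"
  by (induction ts rule: rev_induct) auto

lemma lc_apps [simp]: "lc_at k (apps a ts) \<longleftrightarrow> lc_at k a \<and> (\<forall>t\<in>set ts. lc_at k t)"
  by (induction ts rule: rev_induct) auto

lemma subst_apps [simp]: "subst \<theta> (apps a ts) = apps (subst \<theta> a) (map (subst \<theta>) ts)"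
  by (induction ts rule: rev_induct) auto

lemma tm_size_apps: "t \<in> set ts \<Longrightarrow> tm_size t < tm_size (apps a ts)"
  by (induction ts rule: rev_induct) auto

lemma atom_cases:
  assumes "atom a" obtains x where "a = Fr x" | c where "a = Con c"
  using assms by (auto simp: atom_def)

lemma atom_simps [simp]: "atom (Fr x)" "atom (Con c)" "\<not> atom (App s t)" "\<not> atom (Abs \<sigma> t)"
  "\<not> atom (lam x t)" "\<not> atom (Bd i)"
  by (auto simp: atom_def lam_def)

lemma apps_neq_Abs [simp]: "atom a \<Longrightarrow> apps a ts \<noteq> Abs \<sigma> b"
  "atom a \<Longrightarrow> Abs \<sigma> b \<noteq> apps a ts" "atom a \<Longrightarrow> apps a ts \<noteq> lam x w"
  "atom a \<Longrightarrow> lam x w \<noteq> apps a ts"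
  by (cases ts rule: rev_cases; auto simp: lam_def)+

lemma apps_inject: "atom a \<Longrightarrow> atom b \<Longrightarrow> apps a ts = apps b us \<longleftrightarrow> a = b \<and> ts = us"
proof (induction ts arbitrary: us rule: rev_induct)
  case Nil
  then show ?case by (cases us rule: rev_cases) auto
next
  case (snoc t ts)
  then show ?case by (cases us rule: rev_cases) auto
qed

lemma top_of_apps [simp]: "atom a \<Longrightarrow> top_of (apps a ts) = a"
  by (induction ts rule: rev_induct) (auto elim: atom_cases)

section \<open>Typing\<close>

inductive_cases has_ty_BdE: "has_ty S \<Gamma> (Bd i) \<tau>"
inductive_cases has_ty_FrE: "has_ty S \<Gamma> (Fr x) \<tau>"
inductive_cases has_ty_ConE: "has_ty S \<Gamma> (Con c) \<tau>"
inductive_cases has_ty_AppE: "has_ty S \<Gamma> (App s t) \<tau>"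
inductive_cases has_ty_AbsE: "has_ty S \<Gamma> (Abs \<sigma> t) \<tau>"

lemma has_ty_Bd [simp]: "has_ty S \<Gamma> (Bd i) \<tau> \<longleftrightarrow> i < length \<Gamma> \<and> \<tau> = \<Gamma> ! i"
  by (auto elim: has_ty_BdE intro: has_ty.intros)
lemma has_ty_Fr [simp]: "has_ty S \<Gamma> (Fr x) \<tau> \<longleftrightarrow> \<tau> = snd x"
  by (auto elim: has_ty_FrE intro: has_ty.intros)
lemma has_ty_Con [simp]: "has_ty S \<Gamma> (Con c) \<tau> \<longleftrightarrow> \<tau> = sym_ty S c"
  by (auto elim: has_ty_ConE intro: has_ty.intros)
lemma has_ty_App: "has_ty S \<Gamma> (App s t) \<tau> \<longleftrightarrow> (\<exists>\<sigma>. has_ty S \<Gamma> s (Fun \<sigma> \<tau>) \<and> has_ty S \<Gamma> t \<sigma>)"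
  by (auto elim: has_ty_AppE intro: has_ty.intros)
lemma has_ty_Abs: "has_ty S \<Gamma> (Abs \<sigma> t) \<tau> \<longleftrightarrow> (\<exists>\<tau>'. \<tau> = Fun \<sigma> \<tau>' \<and> has_ty S (\<sigma> # \<Gamma>) t \<tau>')"
  by (auto elim: has_ty_AbsE intro: has_ty.intros)

lemma has_ty_unique: "has_ty S \<Gamma> t \<tau> \<Longrightarrow> has_ty S \<Gamma> t \<tau>' \<Longrightarrow> \<tau> = \<tau>'"
proof (induction arbitrary: \<tau>' rule: has_ty.induct)
  case (4 \<Gamma> s \<sigma> \<tau> t)
  from 4(5) obtain \<sigma>' where "has_ty S \<Gamma> s (Fun \<sigma>' \<tau>')" unfolding has_ty_App by blast
  from 4(3)[OF this] show ?case by simp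
next
  case (5 \<sigma> \<Gamma> t \<tau>)
  from 5(3) obtain \<tau>'' where "\<tau>' = Fun \<sigma> \<tau>''" "has_ty S (\<sigma> # \<Gamma>) t \<tau>''"
    unfolding has_ty_Abs by blast
  with 5(2) show ?case by simp
qed auto

lemma has_ty_append: "has_ty S \<Gamma> t \<tau> \<Longrightarrow> has_ty S (\<Gamma> @ \<Delta>) t \<tau>"
  by (induction rule: has_ty.induct) (auto simp: nth_append intro: has_ty.intros)

lemma has_ty_weaken: "has_ty S [] t \<tau> \<Longrightarrow> has_ty S \<Gamma> t \<tau>"
  using has_ty_append[of S "[]" t \<tau> \<Gamma>] by simp

lemma has_ty_lc: "has_ty S \<Gamma> t \<tau> \<Longrightarrow> lc_at (length \<Gamma>) t"
  by (induction rule: has_ty.induct) auto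

lemma has_ty_Nil_lc: "has_ty S [] t \<tau> \<Longrightarrow> lc t"
  using has_ty_lc by fastforce

lemma has_ty_esub:
  assumes "has_ty S (\<Xi> @ \<Gamma>) t \<tau>"
    and "\<And>i. i < length \<Gamma> \<Longrightarrow> has_ty S [] (e i) (\<Gamma> ! i)" "\<And>x. has_ty S [] (\<theta> x) (snd x)"
  shows "has_ty S \<Xi> (esub (length \<Xi>) e \<theta> t) \<tau>"
  using assms(1)
proof (induction t arbitrary: \<Xi> \<tau>)
  case (Bd i)
  then show ?case using assms(2)[of "i - length \<Xi>"] by (auto simp: nth_append intro: has_ty_weaken)
next
  case (Fr x)
  then show ?case using has_ty_weaken[OF assms(3)] by simp
next
  case (App s t)
  then show ?case by (force simp: has_ty_App)
next
  case (Abs \<sigma> t)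
  from Abs.prems obtain \<tau>' where \<tau>: "\<tau> = Fun \<sigma> \<tau>'" "has_ty S ((\<sigma> # \<Xi>) @ \<Gamma>) t \<tau>'"
    by (auto simp: has_ty_Abs)
  show ?case using Abs.IH[OF \<tau>(2)] by (simp add: has_ty_Abs \<tau>(1))
qed simp

lemma has_ty_esub0:
  assumes "has_ty S \<Gamma> t \<tau>"
    and "\<And>i. i < length \<Gamma> \<Longrightarrow> has_ty S [] (e i) (\<Gamma> ! i)" "\<And>x. has_ty S [] (\<theta> x) (snd x)"
  shows "has_ty S [] (esub 0 e \<theta> t) \<tau>"
  using has_ty_esub[of S "[]" \<Gamma> t \<tau> e \<theta>] assms by simp

lemma has_ty_subst:
  assumes "has_ty S [] t \<tau>" "\<And>x. has_ty S [] (\<theta> x) (snd x)"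
  shows "has_ty S [] (subst \<theta> t) \<tau>"
proof -
  have "has_ty S [] (esub 0 (\<lambda>_. t) \<theta> t) \<tau>" using assms by (intro has_ty_esub0[of S "[]"]) auto
  then show ?thesis using assms(1) by (simp add: esub_lc has_ty_Nil_lc)
qed

lemma has_ty_opn:
  assumes "has_ty S [\<sigma>] b \<tau>" "has_ty S [] u \<sigma>" shows "has_ty S [] (opn u b) \<tau>"
  unfolding opn_def using has_ty_esub0[of S "[\<sigma>]" b \<tau>] assms by simp

lemma has_ty_bind:
  "k < length \<Gamma> \<Longrightarrow> \<Gamma> ! k = snd x \<Longrightarrow> has_ty S \<Gamma> (bind_at k x t) \<tau> \<longleftrightarrow> has_ty S \<Gamma> t \<tau>"
  by (induction t arbitrary: k \<Gamma> \<tau>) (auto simp: has_ty_App has_ty_Abs)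

lemma has_ty_lam:
  "has_ty S \<Gamma> (lam x t) \<tau> \<longleftrightarrow> (\<exists>\<tau>'. \<tau> = Fun (snd x) \<tau>' \<and> has_ty S (snd x # \<Gamma>) t \<tau>')"
  by (simp add: lam_def has_ty_Abs has_ty_bind)

lemma has_ty_apps:
  "has_ty S \<Gamma> (apps a ts) \<tau> \<longleftrightarrow>
   (\<exists>\<sigma>s. has_ty S \<Gamma> a (foldr Fun \<sigma>s \<tau>) \<and> list_all2 (has_ty S \<Gamma>) ts \<sigma>s)"
proof (induction ts arbitrary: \<tau> rule: rev_induct)
  case Nil
  then show ?case by simp
next
  case (snoc t ts)
  show ?case
  proof
    assume "has_ty S \<Gamma> (apps a (ts @ [t])) \<tau>"
    then obtain \<sigma> \<sigma>s where "has_ty S \<Gamma> t \<sigma>" "has_ty S \<Gamma> a (foldr Fun \<sigma>s (Fun \<sigma> \<tau>))"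
      "list_all2 (has_ty S \<Gamma>) ts \<sigma>s"
      using snoc by (auto simp: has_ty_App)
    then show "\<exists>\<sigma>s. has_ty S \<Gamma> a (foldr Fun \<sigma>s \<tau>) \<and> list_all2 (has_ty S \<Gamma>) (ts @ [t]) \<sigma>s"
      by (intro exI[of _ "\<sigma>s @ [\<sigma>]"]) (auto intro: list_all2_appendI)
  next
    assume "\<exists>\<sigma>s. has_ty S \<Gamma> a (foldr Fun \<sigma>s \<tau>) \<and> list_all2 (has_ty S \<Gamma>) (ts @ [t]) \<sigma>s"
    then show "has_ty S \<Gamma> (apps a (ts @ [t])) \<tau>"
      using snoc by (fastforce simp: has_ty_App list_all2_append1 list_all2_Cons1)
  qed
qed

lemma foldr_Fun_inject:
  "foldr Fun \<sigma>s (Base b) = foldr Fun \<tau>s (Base c) \<longleftrightarrow> \<sigma>s = \<tau>s \<and> b = c"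
proof (induction \<sigma>s arbitrary: \<tau>s)
  case Nil
  then show ?case by (cases \<tau>s) auto
next
  case (Cons a \<sigma>s)
  then show ?case by (cases \<tau>s) auto
qed

section \<open>Weak head reduction and logical relations\<close>

text \<open>Only the head redex is contracted and arguments are left alone. This keeps the relation
  deterministic and closed under application, the two properties on which evaluation and the logical
  relations rest.\<close>

inductive whr :: "('b, 'f, 'v) tm \<Rightarrow> ('b, 'f, 'v) tm \<Rightarrow> bool" where
  beta: "whr (App (Abs \<sigma> b) t) (opn t b)"
| app: "whr s s' \<Longrightarrow> whr (App s t) (App s' t)"

inductive_cases whr_AppE: "whr (App s t) w"

lemma not_whr [simp]: "\<not> whr (Abs \<sigma> b) w" "\<not> whr (Fr x) w" "\<not> whr (Con c) w"
  by (auto elim: whr.cases)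

lemma whr_det: "whr s t \<Longrightarrow> whr s u \<Longrightarrow> t = u"
proof (induction arbitrary: u rule: whr.induct)
  case (beta \<sigma> b t)
  then show ?case by (auto elim: whr_AppE)
next
  case (app s s' t)
  from app.prems app.hyps obtain s'' where "u = App s'' t" "whr s s''"
    by (auto elim: whr_AppE)
  with app.IH show ?case by simp
qed

lemma whr_FV: "whr s t \<Longrightarrow> FV t \<subseteq> FV s"
  by (induction rule: whr.induct) (use FV_opn in fastforce)+

lemma whr_syms: "whr s t \<Longrightarrow> syms t \<subseteq> syms s"
  by (induction rule: whr.induct) (use syms_opn in fastforce)+

lemma whr_ty: "whr s t \<Longrightarrow> has_ty S [] s \<tau> \<Longrightarrow> has_ty S [] t \<tau>"
  by (induction arbitrary: \<tau> rule: whr.induct) (auto simp: has_ty_App has_ty_Abs intro: has_ty_opn)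

lemma not_whr_apps: "atom a \<Longrightarrow> \<not> whr (apps a ts) w"
proof (induction ts arbitrary: w rule: rev_induct)
  case Nil
  then show ?case by (auto elim: atom_cases)
next
  case (snoc t ts)
  then show ?case by (auto elim!: whr_AppE)
qed

text \<open>The assumptions are what a base relation must supply: closure under weak head expansion
  on either side, comparison of functions at a single fresh variable, and congruence for applied
  atoms. \<open>K\<close> bounds the symbols that may occur, so that one instance can be restricted
  to unmarked terms.\<close>

locale log_rel =
  fixes S :: "'f \<Rightarrow> 'b ty" and K :: "'f sym set"
    and Q :: "'b ty \<Rightarrow> ('b, 'f, 'v :: infinite) tm \<Rightarrow> ('b, 'f, 'v) tm \<Rightarrow> bool"
  assumes Q_ok: "Q \<tau> s t \<Longrightarrow> has_ty S [] s \<tau> \<and> has_ty S [] t \<tau> \<and> syms s \<subseteq> K \<and> syms t \<subseteq> K"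
    and Q_expl: "whr s s' \<Longrightarrow> has_ty S [] s (Base b) \<Longrightarrow> syms s \<subseteq> K \<Longrightarrow>
      Q (Base b) s' t \<Longrightarrow> Q (Base b) s t"
    and Q_expr: "whr t t' \<Longrightarrow> has_ty S [] t (Base b) \<Longrightarrow> syms t \<subseteq> K \<Longrightarrow>
      Q (Base b) s t' \<Longrightarrow> Q (Base b) s t"
    and Q_ext: "x \<notin> FV s \<Longrightarrow> x \<notin> FV t \<Longrightarrow> Q \<tau> (App s (Fr x)) (App t (Fr x)) \<Longrightarrow>
      Q (Fun (snd x) \<tau>) s t"
    and Q_neu: "atom a \<Longrightarrow> syms a \<subseteq> K \<Longrightarrow> has_ty S [] a (foldr Fun \<tau>s (Base b)) \<Longrightarrow>
      length ss = length \<tau>s \<Longrightarrow> length ts = length \<tau>s \<Longrightarrow>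
      (\<And>i. i < length \<tau>s \<Longrightarrow> Q (\<tau>s ! i) (ss ! i) (ts ! i)) \<Longrightarrow>
      Q (Base b) (apps a ss) (apps a ts)"
begin

text \<open>At function types \<open>Q\<close> is not consulted, so typing and the bound on symbols
  are stated explicitly; at basic types they come from \<open>Q_ok\<close>.\<close>

primrec lr :: "'b ty \<Rightarrow> ('b, 'f, 'v) tm \<Rightarrow> ('b, 'f, 'v) tm \<Rightarrow> bool" where
  "lr (Base b) = Q (Base b)"
| "lr (Fun \<alpha> \<beta>) = (\<lambda>s t. has_ty S [] s (Fun \<alpha> \<beta>) \<and> has_ty S [] t (Fun \<alpha> \<beta>) \<and> syms s \<subseteq> K \<and> syms t \<subseteq> K \<and>
     (\<forall>u v. lr \<alpha> u v \<longrightarrow> lr \<beta> (App s u) (App t v)))"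

lemma lr_ok:
  assumes "lr \<tau> s t"
  shows "has_ty S [] s \<tau>" "has_ty S [] t \<tau>" "syms s \<subseteq> K" "syms t \<subseteq> K"
proof -
  have "has_ty S [] s \<tau> \<and> has_ty S [] t \<tau> \<and> syms s \<subseteq> K \<and> syms t \<subseteq> K"
    using assms Q_ok by (cases \<tau>) auto
  then show "has_ty S [] s \<tau>" "has_ty S [] t \<tau>" "syms s \<subseteq> K" "syms t \<subseteq> K" by auto
qed

lemma lr_lc: "lr \<tau> s t \<Longrightarrow> lc s" "lr \<tau> s t \<Longrightarrow> lc t"
  using lr_ok has_ty_Nil_lc by blast+

lemma lr_App: "lr (Fun \<alpha> \<beta>) s t \<Longrightarrow> lr \<alpha> u v \<Longrightarrow> lr \<beta> (App s u) (App t v)"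
  by simp

text \<open>A weak head step of \<open>s\<close> is also one of \<open>App s u\<close>, so expansion
  lifts from basic types to all types.\<close>

lemma lr_expl: "lr \<tau> s' t \<Longrightarrow> whr s s' \<Longrightarrow> has_ty S [] s \<tau> \<Longrightarrow> syms s \<subseteq> K \<Longrightarrow> lr \<tau> s t"
proof (induction \<tau> arbitrary: s s' t)
  case (Base b)
  then show ?case using Q_expl by auto
next
  case (Fun \<alpha> \<beta>)
  have "lr \<beta> (App s u) (App t v)" if uv: "lr \<alpha> u v" for u v
    by (rule Fun.IH(2)[OF lr_App[OF Fun.prems(1) uv]])
      (use Fun.prems lr_ok[OF uv] in \<open>auto intro: whr.intros has_ty.intros\<close>)
  then show ?case using Fun.prems by auto
qed

lemma lr_expr: "lr \<tau> s t' \<Longrightarrow> whr t t' \<Longrightarrow> has_ty S [] t \<tau> \<Longrightarrow> syms t \<subseteq> K \<Longrightarrow> lr \<tau> s t"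
proof (induction \<tau> arbitrary: s t t')
  case (Base b)
  then show ?case using Q_expr by auto
next
  case (Fun \<alpha> \<beta>)
  have "lr \<beta> (App s u) (App t v)" if uv: "lr \<alpha> u v" for u v
    by (rule Fun.IH(2)[OF lr_App[OF Fun.prems(1) uv]])
      (use Fun.prems lr_ok[OF uv] in \<open>auto intro: whr.intros has_ty.intros\<close>)
  then show ?case using Fun.prems by auto
qed

text \<open>The two halves need each other. Going from \<open>lr\<close> to \<open>Q\<close> at a
  function type applies both sides to a fresh variable, which is related to itself by the second
  half at the argument type; extending an applied atom by related arguments uses the first half to
  turn them into \<open>Q\<close>-related ones.\<close>

lemma reify_reflect:
  "(\<forall>s t. lr \<tau> s t \<longrightarrow> Q \<tau> s t) \<and>
   (\<forall>a \<sigma>s ss ts. atom a \<longrightarrow> syms a \<subseteq> K \<longrightarrow> has_ty S [] a (foldr Fun \<sigma>s \<tau>) \<longrightarrow>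
      length ss = length \<sigma>s \<longrightarrow> length ts = length \<sigma>s \<longrightarrow>
      (\<forall>i<length \<sigma>s. Q (\<sigma>s ! i) (ss ! i) (ts ! i)) \<longrightarrow> lr \<tau> (apps a ss) (apps a ts))"
proof (induction \<tau>)
  case (Base b)
  then show ?case using Q_neu by auto
next
  case (Fun \<alpha> \<beta>)
  have reflect: "lr (Fun \<alpha> \<beta>) (apps a ss) (apps a ts)"
    if a: "atom a" "syms a \<subseteq> K" "has_ty S [] a (foldr Fun \<sigma>s (Fun \<alpha> \<beta>))"
      and len: "length ss = length \<sigma>s" "length ts = length \<sigma>s"
      and Q: "\<forall>i<length \<sigma>s. Q (\<sigma>s ! i) (ss ! i) (ts ! i)" for a \<sigma>s ss ts
  proof -
    have ty: "has_ty S [] (apps a ss) (Fun \<alpha> \<beta>)" "has_ty S [] (apps a ts) (Fun \<alpha> \<beta>)"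
      using a len Q Q_ok by (auto simp: has_ty_apps list_all2_conv_all_nth intro!: exI[of _ \<sigma>s])
    have syms: "syms (apps a ss) \<subseteq> K" "syms (apps a ts) \<subseteq> K"
      using a len Q Q_ok by (fastforce simp: in_set_conv_nth)+
    have "lr \<beta> (App (apps a ss) u) (App (apps a ts) v)" if uv: "lr \<alpha> u v" for u v
    proof -
      have "Q \<alpha> u v" using Fun.IH(1) uv by blast
      then have "\<forall>i<length (\<sigma>s @ [\<alpha>]). Q ((\<sigma>s @ [\<alpha>]) ! i) ((ss @ [u]) ! i) ((ts @ [v]) ! i)"
        using Q len by (auto simp: nth_append less_Suc_eq)
      then have "lr \<beta> (apps a (ss @ [u])) (apps a (ts @ [v]))"
        using a len by (intro Fun.IH(2)[THEN conjunct2, rule_format, of a "\<sigma>s @ [\<alpha>]"]) auto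
      then show ?thesis by simp
    qed
    then show ?thesis using ty syms by simp
  qed
  have reify: "Q (Fun \<alpha> \<beta>) s t" if st: "lr (Fun \<alpha> \<beta>) s t" for s t
  proof -
    obtain x where x: "x \<notin> FV s \<union> FV t" "snd x = \<alpha>"
      using ex_fresh[of "FV s \<union> FV t" \<alpha>] by auto
    have "lr \<alpha> (apps (Fr x) []) (apps (Fr x) [])"
      by (intro Fun.IH(1)[THEN conjunct2, rule_format, of _ "[]"]) (use x in auto)
    then have "Q \<beta> (App s (Fr x)) (App t (Fr x))" using st Fun.IH(2) by auto
    then show ?thesis using Q_ext[of x s t \<beta>] x by auto
  qed
  show ?case using reify reflect by blast
qed

lemma reify: "lr \<tau> s t \<Longrightarrow> Q \<tau> s t"
  using reify_reflect by blast

lemma lr_atom: "atom a \<Longrightarrow> syms a \<subseteq> K \<Longrightarrow> has_ty S [] a \<tau> \<Longrightarrow> lr \<tau> a a"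
  using reify_reflect[THEN conjunct2, rule_format, of a "[]" \<tau> "[]" "[]"] by auto

lemma lr_Fr: "lr (snd x) (Fr x) (Fr x)"
  by (rule lr_atom) auto

text \<open>Indices beyond \<open>\<Gamma>\<close> are not related, but their values must still be
  locally closed and within \<open>K\<close>, since \<open>esub\<close> treats \<open>e\<close> as
  total.\<close>

definition env :: "'b ty list \<Rightarrow> (nat \<Rightarrow> ('b, 'f, 'v) tm) \<Rightarrow> (('b, 'v) var \<Rightarrow> ('b, 'f, 'v) tm) \<Rightarrow>
    (nat \<Rightarrow> ('b, 'f, 'v) tm) \<Rightarrow> (('b, 'v) var \<Rightarrow> ('b, 'f, 'v) tm) \<Rightarrow> bool" where
  "env \<Gamma> e \<theta> e' \<theta>' \<longleftrightarrow> (\<forall>i. lc (e i) \<and> lc (e' i) \<and> syms (e i) \<subseteq> K \<and> syms (e' i) \<subseteq> K) \<and>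
     (\<forall>i<length \<Gamma>. lr (\<Gamma> ! i) (e i) (e' i)) \<and> (\<forall>x. lr (snd x) (\<theta> x) (\<theta>' x))"

lemma env_case:
  "env \<Gamma> e \<theta> e' \<theta>' \<Longrightarrow> lr \<sigma> u v \<Longrightarrow> env (\<sigma> # \<Gamma>) (case_nat u e) \<theta> (case_nat v e') \<theta>'"
  unfolding env_def using lr_ok lr_lc by (auto simp: nth_Cons split: nat.splits)

lemma env_upd:
  "env \<Gamma> e \<theta> e' \<theta>' \<Longrightarrow> lr (snd x) u v \<Longrightarrow> env \<Gamma> e (\<theta>(x := u)) e' (\<theta>'(x := v))"
  unfolding env_def by auto

lemma esub_ok:
  assumes "has_ty S \<Gamma> t \<tau>" "syms t \<subseteq> K" "env \<Gamma> e \<theta> e' \<theta>'"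
  shows "has_ty S [] (esub 0 e \<theta> t) \<tau>" "has_ty S [] (esub 0 e' \<theta>' t) \<tau>"
    "syms (esub 0 e \<theta> t) \<subseteq> K" "syms (esub 0 e' \<theta>' t) \<subseteq> K"
proof -
  note e = assms(3)[unfolded env_def]
  show "has_ty S [] (esub 0 e \<theta> t) \<tau>" "has_ty S [] (esub 0 e' \<theta>' t) \<tau>"
    by (rule has_ty_esub0[OF assms(1)]; use e lr_ok in blast)+
  have K: "syms (\<theta> x) \<subseteq> K" "syms (\<theta>' x) \<subseteq> K" "syms (e i) \<subseteq> K" "syms (e' i) \<subseteq> K" for x i
    using e lr_ok(3,4) by blast+
  show "syms (esub 0 e \<theta> t) \<subseteq> K" "syms (esub 0 e' \<theta>' t) \<subseteq> K"
    by (intro order_trans[OF syms_esub] Un_least UN_least; rule K assms(2))+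
qed

text \<open>Applied to related arguments, both abstractions head-reduce to their bodies in the
  extended environments, and \<open>lr\<close> is closed under expansion on both sides. The bodies
  may differ, because contexts with different fillings are to be compared as well.\<close>

lemma lr_Abs:
  assumes ty: "has_ty S (\<sigma> # \<Gamma>) t \<tau>" "has_ty S (\<sigma> # \<Gamma>) t' \<tau>" "syms t \<subseteq> K" "syms t' \<subseteq> K"
    and env: "env \<Gamma> e \<theta> e' \<theta>'"
    and body: "\<And>u v. lr \<sigma> u v \<Longrightarrow> lr \<tau> (esub 0 (case_nat u e) \<theta> t) (esub 0 (case_nat v e') \<theta>' t')"
  shows "lr (Fun \<sigma> \<tau>) (esub 0 e \<theta> (Abs \<sigma> t)) (esub 0 e' \<theta>' (Abs \<sigma> t'))"
proof -
  have lce: "lc (e i)" "lc (e' i)" "lc (\<theta> x)" "lc (\<theta>' x)" for i x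
    using env lr_lc unfolding env_def by blast+
  have Abs: "has_ty S [] (esub 0 e \<theta> (Abs \<sigma> t)) (Fun \<sigma> \<tau>)" "syms (esub 0 e \<theta> (Abs \<sigma> t)) \<subseteq> K"
    "has_ty S [] (esub 0 e' \<theta>' (Abs \<sigma> t')) (Fun \<sigma> \<tau>)" "syms (esub 0 e' \<theta>' (Abs \<sigma> t')) \<subseteq> K"
    by (intro esub_ok(1)[OF _ _ env] esub_ok(2)[OF _ _ env] esub_ok(3)[OF _ _ env]
        esub_ok(4)[OF _ _ env]; use ty in \<open>force simp: has_ty_Abs\<close>)+
  have "lr \<tau> (App (esub 0 e \<theta> (Abs \<sigma> t)) u) (App (esub 0 e' \<theta>' (Abs \<sigma> t')) v)"
    if uv: "lr \<sigma> u v" for u v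
  proof (rule lr_expl[OF lr_expr[OF body[OF uv]]])
    show "whr (App (esub 0 e \<theta> (Abs \<sigma> t)) u) (esub 0 (case_nat u e) \<theta> t)"
      using whr.beta[of \<sigma> "esub (Suc 0) e \<theta> t" u] by (simp add: opn_esub lce)
    show "whr (App (esub 0 e' \<theta>' (Abs \<sigma> t')) v) (esub 0 (case_nat v e') \<theta>' t')"
      using whr.beta[of \<sigma> "esub (Suc 0) e' \<theta>' t'" v] by (simp add: opn_esub lce)
  qed (use Abs lr_ok[OF uv] in \<open>auto intro: has_ty.intros\<close>)
  then show ?thesis using Abs by simp
qed

theorem fundamental:
  "has_ty S \<Gamma> t \<tau> \<Longrightarrow> syms t \<subseteq> K \<Longrightarrow> env \<Gamma> e \<theta> e' \<theta>' \<Longrightarrow> lr \<tau> (esub 0 e \<theta> t) (esub 0 e' \<theta>' t)"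
proof (induction arbitrary: e \<theta> e' \<theta>' rule: has_ty.induct)
  case (1 i \<Gamma>)
  then show ?case by (simp add: env_def)
next
  case (2 \<Gamma> x)
  then show ?case by (simp add: env_def)
next
  case (3 \<Gamma> c)
  then show ?case using lr_atom[of "Con c"] by simp
next
  case (4 \<Gamma> s \<sigma> \<tau> t)
  then show ?case by simp
next
  case (5 \<sigma> \<Gamma> t \<tau>)
  show ?case
    by (rule lr_Abs[OF 5(1) 5(1) _ _ 5(4)]) (use 5(2,3) env_case[OF 5(4)] in auto)
qed

corollary fundamental_refl:
  assumes "has_ty S [] t \<tau>" "syms t \<subseteq> K" shows "lr \<tau> t t"
proof -
  have "env [] (\<lambda>_. Fr undefined) Fr (\<lambda>_. Fr undefined) Fr"
    unfolding env_def using lr_Fr by auto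
  from fundamental[OF assms this] show ?thesis using assms by (simp add: esub_lc has_ty_Nil_lc)
qed

text \<open>The fundamental theorem with a pair of terms plugged into one hole. A
  \<open>CLam\<close> above the hole captures variables of \<open>u\<close> and \<open>v\<close>, so
  these have to be related under every pair of related substitutions, not just as they
  stand.\<close>

lemma context_lemma:
  assumes uv: "has_ty S [] u \<rho>" "has_ty S [] v \<rho>"
    "\<And>e \<theta> e' \<theta>'. env [] e \<theta> e' \<theta>' \<Longrightarrow> lr \<rho> (subst \<theta> u) (subst \<theta>' v)"
  shows "has_ty S \<Gamma> (fill C u) \<tau> \<Longrightarrow> has_ty S \<Gamma> (fill C v) \<tau> \<Longrightarrow>
    syms (fill C u) \<subseteq> K \<Longrightarrow> syms (fill C v) \<subseteq> K \<Longrightarrow> env \<Gamma> e \<theta> e' \<theta>' \<Longrightarrow>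
    lr \<tau> (esub 0 e \<theta> (fill C u)) (esub 0 e' \<theta>' (fill C v))"
proof (induction C arbitrary: \<Gamma> \<tau> e \<theta> e' \<theta>')
  case Hole
  have "\<tau> = \<rho>" using Hole(1) uv(1) has_ty_unique has_ty_weaken by (metis fill.simps(1))
  moreover have "env [] e \<theta> e' \<theta>'" using Hole(5) by (simp add: env_def)
  ultimately show ?case using uv by (simp add: esub_lc has_ty_Nil_lc)
next
  case (CAppL C t)
  from CAppL.prems obtain \<sigma> where \<sigma>: "has_ty S \<Gamma> (fill C u) (Fun \<sigma> \<tau>)" "has_ty S \<Gamma> (fill C v) (Fun \<sigma> \<tau>)"
    "has_ty S \<Gamma> t \<sigma>" by (auto simp: has_ty_App dest: has_ty_unique)
  then show ?case using CAppL.IH[OF \<sigma>(1,2)] fundamental[OF \<sigma>(3)] CAppL.prems by simp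
next
  case (CAppR t C)
  from CAppR.prems obtain \<sigma> where \<sigma>: "has_ty S \<Gamma> (fill C u) \<sigma>" "has_ty S \<Gamma> (fill C v) \<sigma>"
    "has_ty S \<Gamma> t (Fun \<sigma> \<tau>)" by (auto simp: has_ty_App dest: has_ty_unique)
  then show ?case using CAppR.IH[OF \<sigma>(1,2)] fundamental[OF \<sigma>(3)] CAppR.prems by simp
next
  case (CLam x C)
  from CLam.prems(1,2) obtain \<tau>' where \<tau>': "\<tau> = Fun (snd x) \<tau>'"
    "has_ty S (snd x # \<Gamma>) (fill C u) \<tau>'" "has_ty S (snd x # \<Gamma>) (fill C v) \<tau>'"
    by (auto simp: has_ty_lam)
  have "lr (Fun (snd x) \<tau>') (esub 0 e \<theta> (Abs (snd x) (bind_at 0 x (fill C u))))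
     (esub 0 e' \<theta>' (Abs (snd x) (bind_at 0 x (fill C v))))"
  proof (rule lr_Abs[OF _ _ _ _ CLam.prems(5)])
    fix a b assume ab: "lr (snd x) a b"
    show "lr \<tau>' (esub 0 (case_nat a e) \<theta> (bind_at 0 x (fill C u)))
        (esub 0 (case_nat b e') \<theta>' (bind_at 0 x (fill C v)))"
      \<comment> \<open>The binder captures the name \<open>x\<close> and index 0, so the same
        related values enter the environment at both places.\<close>
      using CLam.IH[OF \<tau>'(2,3) _ _ env_upd[OF env_case[OF CLam.prems(5) ab] ab]] CLam.prems(3,4)
      by (simp add: esub_bind fun_upd_def)
  qed (use \<tau>' CLam.prems(3,4) in \<open>simp_all add: has_ty_bind\<close>)
  then show ?case by (simp add: lam_def \<tau>'(1))
qed

end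

section \<open>Long normal forms\<close>

lemma contract_ty: "contract S u v \<Longrightarrow> \<exists>\<sigma>. has_ty S [] u \<sigma> \<and> has_ty S [] v \<sigma>"
proof (induction rule: contract.induct)
  case (beta s \<tau> t x)
  then have "has_ty S [] (subst (Fr(x := t)) s) \<tau>" by (intro has_ty_subst) auto
  then show ?case using beta by (auto simp: has_ty_App has_ty_lam intro: has_ty_weaken)
next
  case (eta s x \<tau>)
  then show ?case using has_ty_weaken[OF eta(1)] by (auto simp: has_ty_App has_ty_lam)
qed

lemma fill_ty:
  assumes "has_ty S [] s \<sigma>" "has_ty S [] t \<sigma>"
  shows "has_ty S \<Gamma> (fill C s) \<tau> \<Longrightarrow> has_ty S \<Gamma> (fill C t) \<tau>"
proof (induction C arbitrary: \<Gamma> \<tau>)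
  case Hole
  have "\<tau> = \<sigma>" using Hole has_ty_unique has_ty_weaken[OF assms(1)] by (metis fill.simps(1))
  then show ?case using has_ty_weaken[OF assms(2)] by simp
next
  case (CAppL C u)
  then show ?case unfolding fill.simps has_ty_App by blast
next
  case (CAppR u C)
  then show ?case unfolding fill.simps has_ty_App by blast
next
  case (CLam x C)
  then show ?case unfolding fill.simps has_ty_lam by blast
qed

primrec ctx_comp :: "('b, 'f, 'v) ctx \<Rightarrow> ('b, 'f, 'v) ctx \<Rightarrow> ('b, 'f, 'v) ctx" where
  "ctx_comp Hole D = D"
| "ctx_comp (CAppL C t) D = CAppL (ctx_comp C D) t"
| "ctx_comp (CAppR t C) D = CAppR t (ctx_comp C D)"
| "ctx_comp (CLam x C) D = CLam x (ctx_comp C D)"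

lemma fill_ctx_comp [simp]: "fill (ctx_comp C D) u = fill C (fill D u)"
  by (induction C) auto

lemma step_ty: "beta_eta_step S s t \<Longrightarrow> has_ty S [] s \<tau> \<Longrightarrow> has_ty S [] t \<tau>"
  unfolding beta_eta_step_def using contract_ty fill_ty by metis

lemma conv_ty: "conv S s t \<Longrightarrow> has_ty S [] s \<tau> \<Longrightarrow> has_ty S [] t \<tau>"
  unfolding conv_def
proof (induction rule: equivclp_induct)
  case (step y z)
  then have y: "has_ty S [] y \<tau>" by blast
  from step(2) show ?case
  proof
    assume "beta_eta_step S z y"
    \<comment> \<open>The source of a step is typable by definition, and types are unique; hence a
      step read backwards preserves the type as well.\<close>
    moreover from this obtain \<tau>' where "has_ty S [] z \<tau>'" by (auto simp: beta_eta_step_def)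
    ultimately show ?thesis using step_ty y has_ty_unique by metis
  qed (use y step_ty in blast)
qed

lemma conv_refl [simp]: "conv S t t"
  by (simp add: conv_def)

lemma conv_sym: "conv S s t \<Longrightarrow> conv S t s"
  by (simp add: conv_def equivclp_sym)

lemma conv_trans [trans]: "conv S s t \<Longrightarrow> conv S t u \<Longrightarrow> conv S s u"
  unfolding conv_def by (rule equivclp_trans)

lemma step_conv: "beta_eta_step S s t \<Longrightarrow> conv S s t"
  unfolding conv_def by (simp add: r_into_equivclp)

lemma contract_conv: "contract S u v \<Longrightarrow> conv S u v"
proof (rule step_conv)
  assume *: "contract S u v"
  then show "beta_eta_step S u v"
    unfolding beta_eta_step_def using contract_ty[OF *] by (metis fill.simps(1))
qed

lemma step_fill:
  "beta_eta_step S s t \<Longrightarrow> has_ty S [] (fill C s) \<tau> \<Longrightarrow> beta_eta_step S (fill C s) (fill C t)"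
  unfolding beta_eta_step_def using fill_ctx_comp by metis

lemma conv_fill:
  assumes "conv S s t" "has_ty S [] s \<sigma>" "has_ty S [] (fill C s) \<tau>"
  shows "conv S (fill C s) (fill C t)"
proof -
  have "equivclp (beta_eta_step S) s t" using assms(1) by (simp add: conv_def)
  then show ?thesis
  proof (induction rule: equivclp_induct)
    case (step y z)
    have conv: "conv S s y" "conv S s z"
      using step(1,2) by (auto simp: conv_def intro: equivclp_into_equivclp)
    have ty: "has_ty S [] (fill C y) \<tau>" "has_ty S [] (fill C z) \<tau>"
      using conv conv_ty assms(2) fill_ty[OF assms(2) _ assms(3)] by blast+
    have "conv S (fill C y) (fill C z)"
      using step(2) step_fill ty step_conv conv_sym by metis
    then show ?case using step(3) conv_trans by blast
  qed simp
qed

lemma conv_App: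
  assumes "has_ty S [] (App s t) \<tau>" "conv S s s'" "conv S t t'"
  shows "conv S (App s t) (App s' t')"
proof -
  obtain \<sigma> where \<sigma>: "has_ty S [] s (Fun \<sigma> \<tau>)" "has_ty S [] t \<sigma>" using assms(1) by (auto simp: has_ty_App)
  have "conv S (App s t) (App s' t)"
    using conv_fill[OF assms(2) \<sigma>(1), of "CAppL Hole t"] assms(1) by simp
  also have "conv S (App s' t) (App s' t')"
    using conv_fill[OF assms(3) \<sigma>(2), of "CAppR s' Hole" \<tau>] conv_ty[OF assms(2) \<sigma>(1)] \<sigma>(2)
    by (auto simp: has_ty_App)
  finally show ?thesis by simp
qed

lemma conv_lam: "has_ty S [] s \<tau> \<Longrightarrow> conv S s t \<Longrightarrow> conv S (lam x s) (lam x t)"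
  using conv_fill[of S s t \<tau> "CLam x Hole" "Fun (snd x) \<tau>"]
  by (auto simp: has_ty_lam intro: has_ty_weaken)

lemma conv_apps:
  assumes "list_all2 (conv S) ss ts" "has_ty S [] (apps a ss) \<tau>"
  shows "conv S (apps a ss) (apps a ts)"
  using assms
proof (induction ss arbitrary: ts \<tau> rule: rev_induct)
  case (snoc s ss)
  from snoc.prems(1) obtain t ts' where t: "ts = ts' @ [t]" "list_all2 (conv S) ss ts'" "conv S s t"
    by (auto simp: list_all2_append1 list_all2_Cons1)
  from snoc.prems(2) obtain \<sigma> where "has_ty S [] (apps a ss) (Fun \<sigma> \<tau>)" by (auto simp: has_ty_App)
  from snoc.IH[OF t(2) this] show ?case using snoc.prems(2) t by (auto intro: conv_App)
qed simp

lemma subst_esub: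
  assumes "\<And>x. lc (\<theta> x)"
  shows "subst \<theta> (esub k (\<lambda>_. u) Fr b) = esub k (\<lambda>_. subst \<theta> u) Fr (subst \<theta> b)"
  by (induction b arbitrary: k) (auto simp: esub_lc assms)

lemma subst_opn: "(\<And>x. lc (\<theta> x)) \<Longrightarrow> subst \<theta> (opn u b) = opn (subst \<theta> u) (subst \<theta> b)"
  unfolding opn_def by (rule subst_esub)

lemma whr_subst: "whr s t \<Longrightarrow> (\<And>x. lc (\<theta> x)) \<Longrightarrow> whr (subst \<theta> s) (subst \<theta> t)"
  by (induction rule: whr.induct) (auto simp: subst_opn intro: whr.intros)

text \<open>Matches the named abstraction with the raw redex: beta on an instance of
  \<open>lam x s\<close> is an update of the substitution at \<open>x\<close>, without any
  renaming.\<close>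

lemma whr_beta_lam:
  assumes "lc s" "\<And>x. lc (\<theta> x)"
  shows "whr (App (subst \<theta> (lam x s)) u) (subst (\<theta>(x := u)) s)"
proof -
  let ?b = "bind_at 0 x s"
  have b: "lc_at (Suc 0) ?b" using assms(1) by (simp add: lc_bind lc_imp_lc_at)
  have "opn u (subst \<theta> ?b) = opn u (esub (Suc 0) (\<lambda>_. Fr x) \<theta> ?b)"
    by (simp add: esub_subst b)
  also have "\<dots> = subst (\<theta>(x := u)) s"
    using assms by (simp add: opn_esub esub_bind esub_lc)
  finally show ?thesis using whr.beta[of "snd x" "subst \<theta> ?b" u] by (simp add: lam_def)
qed

lemma whr_conv:
  fixes s :: "('b, 'f, 'v :: infinite) tm"
  shows "whr s t \<Longrightarrow> has_ty S [] s \<tau> \<Longrightarrow> conv S s t"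
proof (induction arbitrary: \<tau> rule: whr.induct)
  case (beta \<sigma> b t)
  obtain x where x: "x \<notin> FV b" "snd x = \<sigma>" using ex_fresh[OF finite_FV] by blast
  have ty: "has_ty S [\<sigma>] b \<tau>" "has_ty S [] t \<sigma>" using beta by (auto simp: has_ty_App has_ty_Abs)
  then have b: "lc_at (Suc 0) b" using has_ty_lc by fastforce
  have ty': "has_ty S [] (opn (Fr x) b) \<tau>" using has_ty_opn[OF ty(1)] x by simp
  have "subst (Fr(x := t)) (opn (Fr x) b) = opn t (bind_at 0 x (opn (Fr x) b))"
    using opn_bind has_ty_Nil_lc[OF ty'] by metis
  also have "\<dots> = opn t b" using bind_opn[OF b x(1)] by (simp add: opn_def)
  finally show ?case
    using contract_conv[OF contract.beta[OF ty', of t x]] ty(2) x Abs_eq_lam[OF b x(1)] by simp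
next
  case (app s s' t)
  then obtain \<sigma> where "has_ty S [] s (Fun \<sigma> \<tau>)" by (auto simp: has_ty_App)
  then show ?case using app by (auto intro: conv_App)
qed

text \<open>
  Uniqueness of long normal forms is reduced to determinism of this type-directed evaluation,
  so that confluence of beta-eta is not needed.
\<close>

inductive nrm :: "('f \<Rightarrow> 'b ty) \<Rightarrow> ('b, 'f, 'v) tm \<Rightarrow> ('b, 'f, 'v) tm \<Rightarrow> 'b ty \<Rightarrow> bool" for S where
  neu: "atom a \<Longrightarrow> has_ty S [] a (foldr Fun \<tau>s (Base b)) \<Longrightarrow>
    length ss = length \<tau>s \<Longrightarrow> length us = length \<tau>s \<Longrightarrow>
    (\<And>i. i < length \<tau>s \<Longrightarrow> nrm S (ss ! i) (us ! i) (\<tau>s ! i)) \<Longrightarrow>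
    nrm S (apps a ss) (apps a us) (Base b)"
| whr: "whr s s' \<Longrightarrow> nrm S s' u (Base b) \<Longrightarrow> nrm S s u (Base b)"
| ext: "x \<notin> FV s \<Longrightarrow> nrm S (App s (Fr x)) u \<tau> \<Longrightarrow> nrm S s (lam x u) (Fun (snd x) \<tau>)"

lemma nrm_BaseE:
  assumes "nrm S s u (Base b)"
  obtains (neu) a \<tau>s ss us where "s = apps a ss" "u = apps a us" "atom a"
      "has_ty S [] a (foldr Fun \<tau>s (Base b))" "length ss = length \<tau>s" "length us = length \<tau>s"
      "\<And>i. i < length \<tau>s \<Longrightarrow> nrm S (ss ! i) (us ! i) (\<tau>s ! i)"
  | (whr) s' where "whr s s'" "nrm S s' u (Base b)"
  using assms by (cases rule: nrm.cases) (blast, blast)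

inductive_cases nrm_FunE: "nrm S s u (Fun \<alpha> \<beta>)"

lemma UN_nth_mono:
  assumes "length us = length ss" "\<And>i. i < length ss \<Longrightarrow> F (us ! i) \<subseteq> G (ss ! i)"
  shows "(\<Union>u\<in>set us. F u) \<subseteq> (\<Union>s\<in>set ss. G s)"
  using assms by (fastforce simp: in_set_conv_nth)

lemma nrm_FV: "nrm S s u \<tau> \<Longrightarrow> FV u \<subseteq> FV s"
proof (induction rule: nrm.induct)
  case (neu a \<tau>s b ss us)
  then show ?case using UN_nth_mono[of us ss FV FV] by auto
next
  case (whr s s' u b)
  then show ?case using whr_FV by blast
qed auto

lemma nrm_syms: "nrm S s u \<tau> \<Longrightarrow> syms u \<subseteq> syms s"
proof (induction rule: nrm.induct)
  case (neu a \<tau>s b ss us)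
  then show ?case using UN_nth_mono[of us ss syms syms] by auto
next
  case (whr s s' u b)
  then show ?case using whr_syms by blast
qed auto

lemma nrm_lnf: "nrm S s u \<tau> \<Longrightarrow> lnf S u \<tau>"
  by (induction rule: nrm.induct) (auto simp: list_all2_conv_all_nth intro!: lnf.intros)

lemma lnf_ty: "lnf S t \<tau> \<Longrightarrow> has_ty S [] t \<tau>"
proof (induction rule: lnf.induct)
  case (1 a \<tau>s b ts)
  then show ?case by (auto simp: has_ty_apps intro!: exI[of _ \<tau>s] elim: list_all2_mono)
next
  case (2 t \<tau> x)
  then show ?case by (auto simp: has_ty_lam intro: has_ty_weaken)
qed

lemma lnf_lc: "lnf S t \<tau> \<Longrightarrow> lc t"
  using lnf_ty has_ty_Nil_lc by blast

text \<open>Rule \<open>ext\<close> tests a function at one fresh variable of unspecified name;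
  closure under renaming makes the choice immaterial. Injectivity is not asked for, because weak
  head steps are closed under substitution and atoms are sent to atoms.\<close>

lemma nrm_ren:
  fixes s u :: "('b, 'f, 'v :: infinite) tm" and \<rho> :: "('b, 'v) var \<Rightarrow> ('b, 'v) var"
  shows "nrm S s u \<tau> \<Longrightarrow> (\<And>x. snd (\<rho> x) = snd x) \<Longrightarrow>
    nrm S (subst (\<lambda>x. Fr (\<rho> x)) s) (subst (\<lambda>x. Fr (\<rho> x)) u) \<tau>"
proof (induction arbitrary: \<rho> rule: nrm.induct)
  case (neu a \<tau>s b ss us)
  let ?\<theta> = "\<lambda>x. Fr (\<rho> x)"
  have "atom (subst ?\<theta> a)" "has_ty S [] (subst ?\<theta> a) (foldr Fun \<tau>s (Base b))"
    using neu(1,2) neu.prems[symmetric] by (auto elim!: atom_cases)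
  then show ?case unfolding subst_apps by (rule nrm.neu) (use neu in auto)
next
  case (whr s s' u b)
  have "Defs.lc (Fr (\<rho> x))" for x by simp
  then show ?case using whr whr_subst nrm.whr by metis
next
  case (ext x s u \<tau>)
  let ?\<theta> = "\<lambda>x. Fr (\<rho> x)"
  obtain z where z: "z \<notin> FV (subst ?\<theta> s)" "snd z = snd x" using ex_fresh[OF finite_FV] by blast
  let ?\<rho> = "\<rho>(x := z)"
  have eq: "(\<lambda>y. Fr (?\<rho> y)) = ?\<theta>(x := Fr z)" by auto
  have "snd (?\<rho> y) = snd y" for y using ext.prems z by simp
  from ext.IH[OF this]
  have "nrm S (App (subst (?\<theta>(x := Fr z)) s) (Fr z)) (subst (?\<theta>(x := Fr z)) u) \<tau>"
    unfolding eq by simp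
  moreover have "subst (?\<theta>(x := Fr z)) s = subst ?\<theta> s" using ext(1) by (auto intro!: subst_cong)
  ultimately have *: "nrm S (App (subst ?\<theta> s) (Fr z)) (subst (?\<theta>(x := Fr z)) u) \<tau>" by simp
  have "lc u" using ext(2) nrm_lnf lnf_lc by blast
  moreover have "FV (subst ?\<theta> (lam x u)) \<subseteq> FV (subst ?\<theta> s)"
    using nrm_FV[OF ext(2)] by (auto simp: FV_subst)
  ultimately have "subst ?\<theta> (lam x u) = lam z (subst (?\<theta>(x := Fr z)) u)"
    using z by (intro subst_lam) auto
  then show ?case using nrm.ext[OF z(1) *] z(2) by simp
qed

lemma nrm_FunD:
  fixes s w :: "('b, 'f, 'v :: infinite) tm"
  assumes "nrm S s w (Fun \<alpha> \<beta>)" "z \<notin> FV s" "snd z = \<alpha>"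
  obtains u where "w = lam z u" "nrm S (App s (Fr z)) u \<beta>"
proof -
  from assms(1) obtain x u where x: "w = lam x u" "x \<notin> FV s" "snd x = \<alpha>" "nrm S (App s (Fr x)) u \<beta>"
    by (auto elim: nrm_FunE)
  let ?\<rho> = "id(x := z)"
  have eq: "(\<lambda>y. Fr (?\<rho> y)) = Fr(x := Fr z)" by auto
  have "snd (?\<rho> y) = snd y" for y using x assms(3) by simp
  from nrm_ren[OF x(4) this]
  have "nrm S (App (subst (Fr(x := Fr z)) s) (Fr z)) (subst (Fr(x := Fr z)) u) \<beta>"
    unfolding eq by simp
  moreover have "subst (Fr(x := Fr z)) s = subst Fr s" using x(2) by (intro subst_cong) auto
  moreover have "lam x u = lam z (subst (Fr(x := Fr z)) u)"
    using x assms nrm_FV[OF x(4)] nrm_lnf[OF x(4)] by (intro lam_rename) (auto intro: lnf_lc)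
  ultimately show thesis using that x(1) by simp
qed

text \<open>The type decides between \<open>ext\<close> and the other two rules, and an applied atom
  has no weak head step, so at most one rule fits. For \<open>ext\<close> the two fresh names are
  first made equal.\<close>

lemma nrm_det:
  fixes s :: "('b, 'f, 'v :: infinite) tm"
  shows "nrm S s u \<tau> \<Longrightarrow> nrm S s v \<tau> \<Longrightarrow> u = v"
proof (induction arbitrary: v rule: nrm.induct)
  case (neu a \<tau>s b ss us)
  from neu.prems show ?case
  proof (cases rule: nrm_BaseE)
    case *: (neu a' \<tau>s' ss' us')
    then have eq: "a' = a" "ss' = ss" using neu(1) by (auto simp: apps_inject)
    then have "\<tau>s' = \<tau>s" using neu(2) * has_ty_unique foldr_Fun_inject by metis
    then have "us = us'" using * neu eq by (intro nth_equalityI) auto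
    then show ?thesis using * eq by simp
  next
    case whr
    then show ?thesis using neu(1) not_whr_apps by blast
  qed
next
  case (whr s s' u b)
  from whr.prems show ?case
  proof (cases rule: nrm_BaseE)
    case neu
    then show ?thesis using whr(1) not_whr_apps by blast
  next
    case (whr s'')
    then show ?thesis using whr.IH whr_det[OF \<open>whr s s'\<close>] by blast
  qed
next
  case (ext x s u \<tau>)
  then show ?case using nrm_FunD[OF ext.prems ext(1) refl] by metis
qed

lemma nrm_expand:
  fixes s :: "('b, 'f, 'v :: infinite) tm"
  shows "nrm S s' u \<tau> \<Longrightarrow> whr s s' \<Longrightarrow> nrm S s u \<tau>"
proof (induction \<tau> arbitrary: s s' u)
  case (Base b)
  then show ?case using nrm.whr by metis
next
  case (Fun \<alpha> \<beta>)
  obtain z where z: "z \<notin> FV s" "snd z = \<alpha>" using ex_fresh[OF finite_FV] by blast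
  then have "z \<notin> FV s'" using whr_FV[OF Fun.prems(2)] by blast
  from nrm_FunD[OF Fun.prems(1) this z(2)] obtain w where
    "u = lam z w" "nrm S (App s' (Fr z)) w \<beta>" .
  then show ?case using Fun.IH(2) whr.app[OF Fun.prems(2)] nrm.ext[OF z(1)] z(2) by blast
qed

text \<open>An abstraction applied to its own bound name head-reduces to its body, so
  \<open>ext\<close> rebuilds exactly the given abstraction.\<close>

lemma lnf_nrm:
  fixes u :: "('b, 'f, 'v :: infinite) tm"
  shows "lnf S u \<tau> \<Longrightarrow> nrm S u u \<tau>"
proof (induction rule: lnf.induct)
  case (1 a \<tau>s b ts)
  then show ?case by (intro nrm.neu) (auto simp: list_all2_conv_all_nth)
next
  case (2 t \<tau> x)
  have "whr (App (lam x t) (Fr x)) t"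
    using whr_beta_lam[OF lnf_lc[OF 2(1)], of Fr x "Fr x"] by simp
  then show ?case using nrm_expand[OF 2(2)] by (intro nrm.ext) auto
qed

lemma nrm_conv:
  fixes s :: "('b, 'f, 'v :: infinite) tm"
  shows "nrm S s u \<tau> \<Longrightarrow> has_ty S [] s \<tau> \<Longrightarrow> conv S s u"
proof (induction rule: nrm.induct)
  case (neu a \<tau>s b ss us)
  from neu.prems obtain \<sigma>s where \<sigma>s: "has_ty S [] a (foldr Fun \<sigma>s (Base b))"
    "list_all2 (has_ty S []) ss \<sigma>s" by (auto simp: has_ty_apps)
  then have "\<sigma>s = \<tau>s" using neu(2) has_ty_unique foldr_Fun_inject by metis
  then have "list_all2 (conv S) ss us" using \<sigma>s(2) neu by (auto simp: list_all2_conv_all_nth)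
  then show ?case using conv_apps neu.prems by blast
next
  case (whr s s' u b)
  then show ?case using whr_conv whr_ty conv_trans by blast
next
  case (ext x s u \<tau>)
  have ty: "has_ty S [] (App s (Fr x)) \<tau>" using ext.prems by (auto simp: has_ty_App)
  have "conv S s (lam x (App s (Fr x)))"
    by (rule conv_sym[OF contract_conv[OF contract.eta]]) (use ext in auto)
  also have "conv S (lam x (App s (Fr x))) (lam x u)" using conv_lam[OF ty] ext.IH ty by blast
  finally show ?case .
qed

section \<open>Existence and uniqueness of long normal forms\<close>

definition conrm :: "('f \<Rightarrow> 'b ty) \<Rightarrow> 'b ty \<Rightarrow> ('b, 'f, 'v) tm \<Rightarrow> ('b, 'f, 'v) tm \<Rightarrow> bool" where
  "conrm S \<tau> s t \<longleftrightarrow> has_ty S [] s \<tau> \<and> has_ty S [] t \<tau> \<and> (\<exists>u. nrm S s u \<tau> \<and> nrm S t u \<tau>)"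

interpretation N: log_rel S UNIV "conrm S" for S :: "'f \<Rightarrow> 'b ty"
proof
  fix s t :: "('b, 'f, 'v :: infinite) tm" and x \<tau>
  assume x: "x \<notin> FV s" "x \<notin> FV t" and "conrm S \<tau> (App s (Fr x)) (App t (Fr x))"
  then show "conrm S (Fun (snd x) \<tau>) s t"
    unfolding conrm_def by (auto simp: has_ty_App intro: nrm.ext)
next
  fix a :: "('b, 'f, 'v :: infinite) tm" and \<tau>s b and ss ts :: "('b, 'f, 'v) tm list"
  assume a: "atom a" "has_ty S [] a (foldr Fun \<tau>s (Base b))"
    and len: "length ss = length \<tau>s" "length ts = length \<tau>s"
    and nrm: "\<And>i. i < length \<tau>s \<Longrightarrow> conrm S (\<tau>s ! i) (ss ! i) (ts ! i)"
  have "\<forall>i. \<exists>u. i < length \<tau>s \<longrightarrow> nrm S (ss ! i) u (\<tau>s ! i) \<and> nrm S (ts ! i) u (\<tau>s ! i)"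
    using nrm unfolding conrm_def by blast
  then obtain f where f: "\<And>i. i < length \<tau>s \<Longrightarrow> nrm S (ss ! i) (f i) (\<tau>s ! i) \<and> nrm S (ts ! i) (f i) (\<tau>s ! i)"
    by metis
  let ?us = "map f [0..<length \<tau>s]"
  have "nrm S (apps a ss) (apps a ?us) (Base b)" "nrm S (apps a ts) (apps a ?us) (Base b)"
    using a len f by (auto intro!: nrm.neu)
  moreover have "has_ty S [] (apps a ss) (Base b)" "has_ty S [] (apps a ts) (Base b)"
    using a len nrm by (auto simp: has_ty_apps list_all2_conv_all_nth conrm_def intro!: exI[of _ \<tau>s])
  ultimately show "conrm S (Base b) (apps a ss) (apps a ts)" unfolding conrm_def by blast
qed (auto simp: conrm_def intro: nrm.whr)

text \<open>For beta, each side interprets the body with \<open>x\<close> sent to the instantiated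
  argument, and the left side gets there by one weak head step. For eta, both sides are applied to
  related arguments, and the application on the left head-reduces to that of the contracted
  term.\<close>

lemma contract_lr:
  fixes u v :: "('b, 'f, 'v :: infinite) tm"
  assumes "contract S u v" "has_ty S [] u \<rho>" "N.env S [] e \<theta> e' \<theta>'"
  shows "N.lr S \<rho> (subst \<theta> u) (subst \<theta>' v)"
proof -
  have lc\<theta>: "lc (\<theta> x)" "lc (\<theta>' x)" for x
    using assms(3) N.lr_lc unfolding N.env_def by blast+
  have fund: "N.lr S \<tau> (subst \<eta> t) (subst \<eta>' t)"
    if "has_ty S [] t \<tau>" "N.env S [] e \<eta> e' \<eta>'" for t \<tau> \<eta> \<eta>'
    using N.fundamental[OF that(1) _ that(2)] that(1) by (simp add: esub_lc has_ty_Nil_lc)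
  have ty\<theta>: "has_ty S [] (subst \<theta> t) \<tau>" if "has_ty S [] t \<tau>" for t \<tau>
    using N.lr_ok(1)[OF fund[OF that assms(3)]] .
  from assms(1) show ?thesis
  proof cases
    case (beta s \<tau> t x)
    have "has_ty S [] u \<tau>" using beta by (auto simp: has_ty_App has_ty_lam intro: has_ty_weaken)
    then have \<rho>: "\<rho> = \<tau>" using assms(2) has_ty_unique by blast
    have "N.lr S (snd x) (subst \<theta> t) (subst \<theta>' t)" using fund[OF beta(4) assms(3)] .
    from fund[OF beta(3) N.env_upd[OF assms(3) this]]
    have "N.lr S \<tau> (subst (\<theta>(x := subst \<theta> t)) s) (subst (\<theta>'(x := subst \<theta>' t)) s)" .
    moreover have "subst \<theta>' v = subst (\<theta>'(x := subst \<theta>' t)) s"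
      unfolding beta(2) subst_subst by (intro subst_cong) auto
    moreover have "whr (subst \<theta> u) (subst (\<theta>(x := subst \<theta> t)) s)"
      unfolding beta(1) using whr_beta_lam[OF has_ty_Nil_lc[OF beta(3)] lc\<theta>(1)] by simp
    ultimately show ?thesis using N.lr_expl ty\<theta>[OF assms(2)] \<rho> by (metis subset_UNIV)
  next
    case (eta x \<tau>)
    have "has_ty S [] u (Fun (snd x) \<tau>)"
      using eta has_ty_weaken[OF eta(2)] by (auto simp: has_ty_App has_ty_lam)
    then have \<rho>: "\<rho> = Fun (snd x) \<tau>" using assms(2) has_ty_unique by blast
    have lrv: "N.lr S (Fun (snd x) \<tau>) (subst \<theta> v) (subst \<theta>' v)" using fund[OF eta(2) assms(3)] .
    have "N.lr S \<tau> (App (subst \<theta> u) p) (App (subst \<theta>' v) q)" if pq: "N.lr S (snd x) p q" for p q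
    proof (rule N.lr_expl[OF N.lr_App[OF lrv pq]])
      have "subst (\<theta>(x := p)) v = subst \<theta> v" using eta(3) by (intro subst_cong) auto
      then show "whr (App (subst \<theta> u) p) (App (subst \<theta> v) p)"
        unfolding eta(1) using whr_beta_lam[of "App v (Fr x)" \<theta> x p] lc\<theta>(1) has_ty_Nil_lc[OF eta(2)]
        by simp
      show "has_ty S [] (App (subst \<theta> u) p) \<tau>"
        using ty\<theta>[OF assms(2)] N.lr_ok(1)[OF pq] unfolding \<rho> by (auto simp: has_ty_App)
    qed simp
    then show ?thesis using N.lr_ok[OF lrv] ty\<theta>[OF assms(2)] unfolding \<rho> by simp
  qed
qed

lemma step_lr:
  fixes s t :: "('b, 'f, 'v :: infinite) tm"
  assumes "beta_eta_step S s t" "has_ty S [] s \<tau>" "N.env S [] e \<theta> e' \<theta>'"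
  shows "N.lr S \<tau> (subst \<theta> s) (subst \<theta>' t)"
proof -
  from assms(1) obtain C u v where C: "contract S u v" "s = fill C u" "t = fill C v"
    unfolding beta_eta_step_def by blast
  from contract_ty[OF C(1)] obtain \<rho> where \<rho>: "has_ty S [] u \<rho>" "has_ty S [] v \<rho>" by blast
  have t: "has_ty S [] t \<tau>" using step_ty assms by blast
  have "N.lr S \<tau> (esub 0 e \<theta> (fill C u)) (esub 0 e' \<theta>' (fill C v))"
    by (rule N.context_lemma[OF \<rho> contract_lr[OF C(1) \<rho>(1)]])
      (use assms t in \<open>auto simp: C(2,3)\<close>)
  then show ?thesis using C(2,3) t assms(2) by (simp add: esub_lc has_ty_Nil_lc)
qed

text \<open>Neighbours on a conversion path are related in one order or the other and hence share a
  value; determinism of evaluation makes all these values the same. Carrying a substitution along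
  gives closure of conversion under substitution at no extra cost.\<close>

lemma conv_nrm:
  fixes s t :: "('b, 'f, 'v :: infinite) tm"
  assumes "conv S s t" "has_ty S [] s \<tau>" "\<And>x. has_ty S [] (\<theta> x) (snd x)"
  shows "\<exists>u. nrm S (subst \<theta> s) u \<tau> \<and> nrm S (subst \<theta> t) u \<tau>"
proof -
  have env: "N.env S [] (\<lambda>_. Fr undefined) \<theta> (\<lambda>_. Fr undefined) \<theta>"
    unfolding N.env_def using N.fundamental_refl[OF assms(3)] by simp
  have "equivclp (beta_eta_step S) s t" using assms(1) by (simp add: conv_def)
  then show ?thesis
  proof (induction rule: equivclp_induct)
    case base
    have "N.lr S \<tau> (subst \<theta> s) (subst \<theta> s)"
      using assms by (intro N.fundamental_refl has_ty_subst) auto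
    from N.reify[OF this] show ?case by (auto simp: conrm_def)
  next
    case (step y z)
    have "conv S s y" "conv S s z"
      using step(1,2) by (auto simp: conv_def intro: equivclp_into_equivclp)
    then have "has_ty S [] y \<tau>" "has_ty S [] z \<tau>" using conv_ty assms(2) by blast+
    then have "N.lr S \<tau> (subst \<theta> y) (subst \<theta> z) \<or> N.lr S \<tau> (subst \<theta> z) (subst \<theta> y)"
      using step(2) step_lr[OF _ _ env] by blast
    then obtain u where "nrm S (subst \<theta> y) u \<tau>" "nrm S (subst \<theta> z) u \<tau>"
      using N.reify unfolding conrm_def by blast
    then show ?case using step(3) nrm_det by blast
  qed
qed

lemma ex_nrm:
  fixes s :: "('b, 'f, 'v :: infinite) tm"
  shows "has_ty S [] s \<tau> \<Longrightarrow> \<exists>u. nrm S s u \<tau>"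
  using conv_nrm[of S s s \<tau> Fr] by auto

lemma lnf_conv_unique:
  fixes u v :: "('b, 'f, 'v :: infinite) tm"
  assumes "lnf S u \<tau>" "lnf S v \<tau>'" "conv S u v" shows "u = v"
proof -
  have "\<tau> = \<tau>'" using assms lnf_ty conv_ty has_ty_unique by metis
  moreover obtain w where "nrm S u w \<tau>" "nrm S v w \<tau>"
    using conv_nrm[OF assms(3) lnf_ty[OF assms(1)], of Fr] by auto
  ultimately show ?thesis using lnf_nrm assms(1,2) nrm_det by metis
qed

text \<open>Uniqueness makes the definite description usable: exhibiting one convertible long normal
  form identifies \<open>nf\<close>.\<close>

lemma nf_eqI:
  fixes s :: "('b, 'f, 'v :: infinite) tm"
  assumes "conv S s u" "lnf S u \<tau>" shows "nf S s = u"
  unfolding nf_def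
proof (rule the_equality)
  show "conv S s u \<and> (\<exists>\<tau>. lnf S u \<tau>)" using assms by blast
  fix v assume "conv S s v \<and> (\<exists>\<tau>. lnf S v \<tau>)"
  then show "v = u" using assms lnf_conv_unique conv_sym conv_trans by metis
qed

lemma nf_nrm:
  fixes s :: "('b, 'f, 'v :: infinite) tm"
  shows "has_ty S [] s \<tau> \<Longrightarrow> nrm S s (nf S s) \<tau>"
  using ex_nrm nf_eqI nrm_conv nrm_lnf by metis

section \<open>Laws of the normal form operator\<close>

lemma lnf_nf:
  fixes s :: "('b, 'f, 'v :: infinite) tm"
  shows "has_ty S [] s \<tau> \<Longrightarrow> lnf S (nf S s) \<tau>"
  using nf_nrm nrm_lnf by blast

lemma nf_conv:
  fixes s :: "('b, 'f, 'v :: infinite) tm"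
  shows "has_ty S [] s \<tau> \<Longrightarrow> conv S s (nf S s)"
  using nf_nrm nrm_conv by blast

lemma nf_ty:
  fixes s :: "('b, 'f, 'v :: infinite) tm"
  shows "has_ty S [] s \<tau> \<Longrightarrow> has_ty S [] (nf S s) \<tau>"
  using lnf_nf lnf_ty by blast

lemma nf_syms:
  fixes s :: "('b, 'f, 'v :: infinite) tm"
  shows "has_ty S [] s \<tau> \<Longrightarrow> syms (nf S s) \<subseteq> syms s"
  using nf_nrm nrm_syms by blast

lemma nf_lnf:
  fixes s :: "('b, 'f, 'v :: infinite) tm"
  shows "lnf S s \<tau> \<Longrightarrow> nf S s = s"
  by (rule nf_eqI) auto

lemma conv_nf_eq:
  fixes s t :: "('b, 'f, 'v :: infinite) tm"
  assumes "conv S s t" "has_ty S [] s \<tau>" shows "nf S s = nf S t"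
  using assms nf_eqI[of S s "nf S t" \<tau>] nf_conv lnf_nf conv_ty conv_trans by metis

lemma whr_nf_eq:
  fixes s t :: "('b, 'f, 'v :: infinite) tm"
  shows "whr s t \<Longrightarrow> has_ty S [] s \<tau> \<Longrightarrow> nf S s = nf S t"
  using whr_conv conv_nf_eq by blast

lemma conv_subst:
  fixes s t :: "('b, 'f, 'v :: infinite) tm"
  assumes "conv S s t" "has_ty S [] s \<tau>" "\<And>x. has_ty S [] (\<theta> x) (snd x)"
  shows "conv S (subst \<theta> s) (subst \<theta> t)"
  using conv_nrm[OF assms] nrm_conv has_ty_subst assms conv_ty conv_sym conv_trans
  by (metis (no_types, opaque_lifting))

lemma nf_subst_nf:
  fixes t :: "('b, 'f, 'v :: infinite) tm"
  assumes "has_ty S [] t \<tau>" "\<And>x. has_ty S [] (\<theta> x) (snd x)"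
  shows "nf S (subst \<theta> (nf S t)) = nf S (subst \<theta> t)"
  using conv_nf_eq[OF conv_subst[OF nf_conv[OF assms(1)] assms] has_ty_subst[OF assms]] by simp

lemma tm_size_opn: "tm_size (esub k (\<lambda>_. Fr x) Fr b) = tm_size b"
  by (induction b arbitrary: k) auto

text \<open>Here the substitution is converted rather than the term. The induction is on size
  because below a binder the opened body, which is not a subterm, takes the place of the raw
  one.\<close>

lemma conv_subst_pointwise:
  fixes t :: "('b, 'f, 'v :: infinite) tm"
  shows "has_ty S [] t \<tau> \<Longrightarrow> (\<And>x. has_ty S [] (\<theta> x) (snd x)) \<Longrightarrow> (\<And>x. conv S (\<theta> x) (\<theta>' x)) \<Longrightarrow>
    conv S (subst \<theta> t) (subst \<theta>' t)"
proof (induction "tm_size t" arbitrary: t \<tau> \<theta> \<theta>' rule: less_induct)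
  case less
  note \<theta> = less.prems(2,3)
  have \<theta>': "has_ty S [] (\<theta>' x) (snd x)" for x using \<theta> conv_ty by blast
  have lc: "lc (\<theta> x)" "lc (\<theta>' x)" for x using \<theta> \<theta>' has_ty_Nil_lc by blast+
  show ?case
  proof (cases t)
    case (App u v)
    with less.prems(1) obtain \<sigma> where "has_ty S [] u (Fun \<sigma> \<tau>)" "has_ty S [] v \<sigma>"
      by (auto simp: has_ty_App)
    then have "conv S (subst \<theta> u) (subst \<theta>' u)" "conv S (subst \<theta> v) (subst \<theta>' v)"
      using App \<theta> by (auto intro!: less.hyps)
    then show ?thesis
      using App has_ty_subst[OF less.prems(1) \<theta>(1)] by (auto intro: conv_App)
  next
    case (Abs \<sigma> b)
    with less.prems(1) obtain \<tau>' where b: "\<tau> = Fun \<sigma> \<tau>'" "has_ty S [\<sigma>] b \<tau>'"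
      by (auto simp: has_ty_Abs)
    obtain y where y: "y \<notin> FV b \<union> FV (subst \<theta> t) \<union> FV (subst \<theta>' t)" "snd y = \<sigma>"
      using ex_fresh[of "FV b \<union> FV (subst \<theta> t) \<union> FV (subst \<theta>' t)"] by (metis finite_FV finite_Un)
    let ?b = "opn (Fr y) b"
    have ty: "has_ty S [] ?b \<tau>'" using has_ty_opn[OF b(2)] y by simp
    have t: "t = lam y ?b" using Abs_eq_lam[of b y] has_ty_lc[OF b(2)] y Abs by simp
    have "conv S (subst (\<theta>(y := Fr y)) ?b) (subst (\<theta>'(y := Fr y)) ?b)"
      by (rule less.hyps[OF _ ty]) (use \<theta> y Abs in \<open>auto simp: opn_def tm_size_opn\<close>)
    then have "conv S (lam y (subst (\<theta>(y := Fr y)) ?b)) (lam y (subst (\<theta>'(y := Fr y)) ?b))"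
      by (rule conv_lam[rotated]) (rule has_ty_subst[OF ty], use \<theta> in auto)
    then show ?thesis
      using subst_lam[of \<theta> ?b y y] subst_lam[of \<theta>' ?b y y] lc has_ty_Nil_lc[OF ty] y t by simp
  qed (use less.prems in auto)
qed

lemma nf_App_nf:
  fixes s t :: "('b, 'f, 'v :: infinite) tm"
  assumes "has_ty S [] (App s t) \<tau>" shows "nf S (App (nf S s) (nf S t)) = nf S (App s t)"
proof -
  obtain \<sigma> where \<sigma>: "has_ty S [] s (Fun \<sigma> \<tau>)" "has_ty S [] t \<sigma>" using assms by (auto simp: has_ty_App)
  show ?thesis
    using conv_nf_eq[OF conv_App[OF assms nf_conv[OF \<sigma>(1)] nf_conv[OF \<sigma>(2)]] assms] by simp
qed

lemma nf_lam:
  fixes s :: "('b, 'f, 'v :: infinite) tm"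
  assumes "has_ty S [] s \<tau>" shows "nf S (lam x s) = lam x (nf S s)"
  by (rule nf_eqI[OF conv_lam[OF assms nf_conv[OF assms]] lnf.intros(2)[OF lnf_nf[OF assms]]])

lemma nf_apps:
  fixes ts :: "('b, 'f, 'v :: infinite) tm list"
  assumes "atom a" "has_ty S [] (apps a ts) (Base b)"
  shows "nf S (apps a ts) = apps a (map (nf S) ts)"
proof -
  obtain \<sigma>s where \<sigma>s: "has_ty S [] a (foldr Fun \<sigma>s (Base b))" "list_all2 (has_ty S []) ts \<sigma>s"
    using assms(2) by (auto simp: has_ty_apps)
  have "list_all2 (lnf S) (map (nf S) ts) \<sigma>s"
    using \<sigma>s(2) by (auto simp: list_all2_conv_all_nth intro: lnf_nf)
  then have lnf: "lnf S (apps a (map (nf S) ts)) (Base b)" using assms(1) \<sigma>s(1) by (intro lnf.intros)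
  have "list_all2 (conv S) ts (map (nf S) ts)"
    using \<sigma>s(2) by (auto simp: list_all2_conv_all_nth intro: nf_conv)
  from nf_eqI[OF conv_apps[OF this assms(2)] lnf] show ?thesis .
qed

lemma nf_ext:
  fixes s :: "('b, 'f, 'v :: infinite) tm"
  assumes "has_ty S [] s (Fun (snd x) \<tau>)" "x \<notin> FV s"
  shows "nf S s = lam x (nf S (App s (Fr x)))"
proof -
  have ty: "has_ty S [] (App s (Fr x)) \<tau>" using assms by (auto simp: has_ty_App)
  have "conv S s (lam x (App s (Fr x)))"
    by (rule conv_sym[OF contract_conv[OF contract.eta[OF assms]]])
  from conv_nf_eq[OF this assms(1)] show ?thesis using nf_lam[OF ty] by simp
qed

section \<open>Rewriting\<close>

lemma fill_syms: "syms (fill C u) \<subseteq> K \<Longrightarrow> syms v \<subseteq> K \<Longrightarrow> syms (fill C v) \<subseteq> K"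
  by (induction C) auto

lemma arg_ctx: "i < length ts \<Longrightarrow> \<exists>C. \<forall>u. fill C u = apps a (ts[i := u])"
proof (induction ts rule: rev_induct)
  case (snoc t ts)
  show ?case
  proof (cases "i = length ts")
    case True
    then have "fill (CAppR (apps a ts) Hole) u = apps a ((ts @ [t])[i := u])" for u by simp
    then show ?thesis by blast
  next
    case False
    then have "i < length ts" using snoc.prems by simp
    with snoc.IH obtain C where "\<And>u. fill C u = apps a (ts[i := u])" by blast
    then have "fill (CAppL C t) u = apps a ((ts @ [t])[i := u])" for u
      using \<open>i < length ts\<close> by (simp add: list_update_append)
    then show ?thesis by blast
  qed
qed simp

text \<open>A proper prefix of the spine has a function type whereas the hole has a basic one, so a
  nontrivial context can only reach the hole through an argument.\<close>

lemma fill_apps: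
  assumes u: "has_ty S [] u (Base c)"
  shows "fill C u = apps a ts \<Longrightarrow> atom a \<Longrightarrow> has_ty S [] (apps a ts) \<tau> \<Longrightarrow> C \<noteq> Hole \<Longrightarrow>
    \<exists>i C'. i < length ts \<and> ts ! i = fill C' u \<and> (\<forall>v. fill C v = apps a (ts[i := fill C' v]))"
proof (induction ts arbitrary: C \<tau> rule: rev_induct)
  case Nil
  then show ?case by (cases C) (auto elim: atom_cases)
next
  case (snoc t ts)
  from snoc.prems(3) obtain \<sigma> where ty: "has_ty S [] (apps a ts) (Fun \<sigma> \<tau>)" by (auto simp: has_ty_App)
  show ?case
  proof (cases C)
    case Hole
    then show ?thesis using snoc.prems by simp
  next
    case (CAppL D t')
    then have D: "t' = t" "fill D u = apps a ts" using snoc.prems(1) by auto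
    have "D \<noteq> Hole" using D ty u has_ty_unique by (metis fill.simps(1) ty.distinct(1))
    with snoc.IH[OF D(2) snoc.prems(2) ty] obtain i C' where
      i: "i < length ts" "ts ! i = fill C' u" "\<And>v. fill D v = apps a (ts[i := fill C' v])" by blast
    have "\<forall>v. fill C v = apps a ((ts @ [t])[i := fill C' v])"
      using i CAppL D(1) by (simp add: list_update_append)
    moreover have "i < length (ts @ [t])" "(ts @ [t]) ! i = fill C' u" using i by (auto simp: nth_append)
    ultimately show ?thesis by blast
  next
    case (CAppR t' D)
    then have "t' = apps a ts" "fill D u = t" using snoc.prems(1) by auto
    then show ?thesis using CAppR by (intro exI[of _ "length ts"] exI[of _ D]) auto
  next
    case (CLam x D)
    then show ?thesis using snoc.prems(1) by simp
  qed
qed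

section \<open>Renaming and inversion of long normal forms\<close>

lemma lnf_ren:
  fixes t :: "('b, 'f, 'v :: infinite) tm"
  assumes "lnf S t \<tau>" "\<And>x. snd (\<rho> x) = snd x"
  shows "lnf S (subst (\<lambda>x. Fr (\<rho> x)) t) \<tau>"
  using nrm_lnf[OF nrm_ren[OF lnf_nrm[OF assms(1)] assms(2)]] .

lemma Fr_upd: "Fr(x := Fr z) = (\<lambda>y. Fr ((id(x := z)) y))"
  by auto

lemma lnf_rename:
  fixes t :: "('b, 'f, 'v :: infinite) tm"
  assumes "lnf S t \<tau>" "snd z = snd x"
  shows "lnf S (subst (Fr(x := Fr z)) t) \<tau>"
  unfolding Fr_upd by (rule lnf_ren[OF assms(1)]) (use assms(2) in auto)

lemma lnf_lamD:
  fixes t :: "('b, 'f, 'v :: infinite) tm"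
  assumes "lnf S (lam x t) \<tau>" "lc t"
  obtains \<tau>' where "\<tau> = Fun (snd x) \<tau>'" "lnf S t \<tau>'"
  using assms(1)
proof (cases rule: lnf.cases)
  case 1
  then show thesis by simp
next
  case (2 s \<tau>' y)
  have "lc s" using 2(3) lnf_lc by blast
  from lam_eqD[OF 2(1)[symmetric] this assms(2)] show thesis
    using that 2 lnf_rename[OF 2(3), of x y] by simp
qed

lemma lnf_appsD:
  assumes "lnf S (apps a ts) \<tau>" "atom a"
  obtains b \<tau>s where "\<tau> = Base b" "has_ty S [] a (foldr Fun \<tau>s (Base b))" "list_all2 (lnf S) ts \<tau>s"
  using assms(1)
proof (cases rule: lnf.cases)
  case (1 a' \<tau>s b ts')
  then show thesis using that assms(2) by (auto simp: apps_inject)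
next
  case 2
  then show thesis using assms(2) by simp
qed

lemma lnf_cases_fresh:
  fixes t :: "('b, 'f, 'v :: infinite) tm"
  assumes "lnf S t \<tau>" "finite A"
  obtains (apps) a ts \<tau>s b where "t = apps a ts" "\<tau> = Base b" "atom a"
      "has_ty S [] a (foldr Fun \<tau>s (Base b))" "list_all2 (lnf S) ts \<tau>s"
  | (lam) x s \<tau>' where "t = lam x s" "\<tau> = Fun (snd x) \<tau>'" "lnf S s \<tau>'" "x \<notin> A"
  using assms(1)
proof (cases rule: lnf.cases)
  case 1
  then show thesis using apps by blast
next
  case (2 s \<tau>' y)
  obtain x where x: "x \<notin> A \<union> FV s" "snd x = snd y"
    using ex_fresh[of "A \<union> FV s" "snd y"] assms(2) by auto
  have "lam y s = lam x (subst (Fr(y := Fr x)) s)"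
    using x 2(3) lnf_lc by (intro lam_rename) auto
  then show thesis using lam 2 x lnf_rename[OF 2(3) x(2)] by auto
qed

lemma is_subst_ty: "is_subst S \<theta> \<Longrightarrow> has_ty S [] (\<theta> x) (snd x)"
  and is_subst_lnf: "is_subst S \<theta> \<Longrightarrow> lnf S (\<theta> x) (snd x)"
  and is_subst_syms: "is_subst S \<theta> \<Longrightarrow> syms (\<theta> x) \<subseteq> range Sym"
  and is_subst_lc: "is_subst S \<theta> \<Longrightarrow> lc (\<theta> x)"
  unfolding is_subst_def terms_of_def unmarked_syms using lnf_ty lnf_lc by blast+

lemma terms_of_iff: "t \<in> terms_of S \<tau> \<longleftrightarrow> lnf S t \<tau> \<and> syms t \<subseteq> range Sym"
  by (simp add: terms_of_def unmarked_syms)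

lemma nf_terms_of:
  fixes t :: "('b, 'f, 'v :: infinite) tm"
  shows "has_ty S [] t \<tau> \<Longrightarrow> syms t \<subseteq> range Sym \<Longrightarrow> nf S t \<in> terms_of S \<tau>"
  unfolding terms_of_iff using lnf_nf nf_syms by blast

text \<open>Shows that an instance of an instance is again an instance, with the composed
  substitution normalised pointwise; root steps are therefore closed under substitution.\<close>

lemma nf_subst_comp:
  fixes t :: "('b, 'f, 'v :: infinite) tm"
  assumes t: "has_ty S [] t \<tau>" and \<theta>: "\<And>x. has_ty S [] (\<theta> x) (snd x)"
    and \<sigma>: "\<And>x. has_ty S [] (\<sigma> x) (snd x)"
  shows "nf S (subst \<sigma> (nf S (subst \<theta> t))) = nf S (subst (\<lambda>x. nf S (subst \<sigma> (\<theta> x))) t)"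
proof -
  have ty: "has_ty S [] (subst \<sigma> (\<theta> x)) (snd x)" for x using has_ty_subst \<theta> \<sigma> by blast
  have "nf S (subst \<sigma> (nf S (subst \<theta> t))) = nf S (subst (\<lambda>x. subst \<sigma> (\<theta> x)) t)"
    using nf_subst_nf[OF has_ty_subst[OF t \<theta>] \<sigma>] by (simp add: subst_subst)
  also have "\<dots> = nf S (subst (\<lambda>x. nf S (subst \<sigma> (\<theta> x))) t)"
    by (rule conv_nf_eq[OF conv_subst_pointwise[OF t ty nf_conv[OF ty]] has_ty_subst[OF t ty]])
  finally show ?thesis .
qed

section \<open>Root steps, contexts and inversion of rewrite steps\<close>

locale hrs =
  fixes S :: "'f \<Rightarrow> 'b ty" and R :: "('b, 'f, 'v :: infinite) rules"
  assumes hrs: "HRS S R"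
begin

lemma ruleD:
  assumes "(l, r) \<in> R"
  obtains f ls b \<tau>s where "l = apps (Con (Sym f)) ls" "f \<in> defined_syms R"
    "lnf S l (Base b)" "lnf S r (Base b)" "syms l \<subseteq> range Sym" "syms r \<subseteq> range Sym" "FV r \<subseteq> FV l"
proof -
  obtain f b where *: "top_of l = Con (Sym f)" "lnf S l (Base b)" "lnf S r (Base b)"
    "syms l \<subseteq> range Sym" "syms r \<subseteq> range Sym" "FV r \<subseteq> FV l"
    using assms hrs unfolding HRS_def terms_of_iff by fast
  from *(2) obtain a ls where "atom a" "l = apps a ls"
    by (cases rule: lnf.cases) auto
  then have "l = apps (Con (Sym f)) ls" using *(1) by simp
  moreover have "f \<in> defined_syms R" using * assms by (auto simp: defined_syms_def)
  ultimately show thesis using that *(2-) by metis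
qed

text \<open>Root steps are separated from their contexts because under a substitution a root step
  remains a single root step, while a step inside a context may be copied or erased.\<close>

definition inst :: "('b, 'f, 'v) tm \<Rightarrow> ('b, 'f, 'v) tm \<Rightarrow> bool" where
  "inst u v \<longleftrightarrow> (\<exists>l r \<theta>. (l, r) \<in> R \<and> is_subst S \<theta> \<and> u = nf S (subst \<theta> l) \<and> v = nf S (subst \<theta> r))"

lemma rstep_inst: "rstep S R s t \<longleftrightarrow>
  (\<exists>\<tau>. lnf S s \<tau>) \<and> (\<exists>C u v. inst u v \<and> s = fill C u \<and> t = fill C v)"
  unfolding rstep_def inst_def by fast

lemma inst_terms:
  assumes "inst u v"
  obtains b where "u \<in> terms_of S (Base b)" "v \<in> terms_of S (Base b)"
proof -
  obtain l r \<theta> where *: "(l, r) \<in> R" "is_subst S \<theta>" "u = nf S (subst \<theta> l)" "v = nf S (subst \<theta> r)"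
    using assms unfolding inst_def by blast
  obtain b where b: "lnf S l (Base b)" "lnf S r (Base b)" "syms l \<subseteq> range Sym" "syms r \<subseteq> range Sym"
    using ruleD[OF *(1)] by metis
  have "syms (subst \<theta> l) \<subseteq> range Sym" "syms (subst \<theta> r) \<subseteq> range Sym"
    using b is_subst_syms[OF *(2)] unfolding syms_subst by blast+
  moreover have "has_ty S [] (subst \<theta> l) (Base b)" "has_ty S [] (subst \<theta> r) (Base b)"
    using b lnf_ty has_ty_subst is_subst_ty[OF *(2)] by blast+
  ultimately show thesis using that[of b] *(3,4) nf_terms_of by blast
qed

lemma inst_lnf: "inst u v \<Longrightarrow> \<exists>b. lnf S u (Base b) \<and> lnf S v (Base b)"
  by (erule inst_terms) (auto simp: terms_of_iff)

lemma inst_syms: "inst u v \<Longrightarrow> syms u \<subseteq> range Sym" "inst u v \<Longrightarrow> syms v \<subseteq> range Sym"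
  by (erule inst_terms, simp add: terms_of_iff)+

lemma inst_subst:
  assumes "inst u v" and \<sigma>: "\<And>x. has_ty S [] (\<sigma> x) (snd x)" "\<And>x. syms (\<sigma> x) \<subseteq> range Sym"
  shows "inst (nf S (subst \<sigma> u)) (nf S (subst \<sigma> v))"
proof -
  obtain l r \<theta> where *: "(l, r) \<in> R" "is_subst S \<theta>" "u = nf S (subst \<theta> l)" "v = nf S (subst \<theta> r)"
    using assms(1) unfolding inst_def by blast
  obtain b where b: "lnf S l (Base b)" "lnf S r (Base b)" using ruleD[OF *(1)] by metis
  have "syms (subst \<sigma> (\<theta> x)) \<subseteq> range Sym" for x
    using is_subst_syms[OF *(2)] \<sigma>(2) unfolding syms_subst by blast
  then have "is_subst S (\<lambda>x. nf S (subst \<sigma> (\<theta> x)))"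
    using \<sigma>(1) is_subst_ty[OF *(2)] by (auto simp: is_subst_def intro!: nf_terms_of has_ty_subst)
  then show ?thesis
    unfolding inst_def *(3,4) using *(1) nf_subst_comp[OF lnf_ty is_subst_ty[OF *(2)] \<sigma>(1)] b
    by blast
qed

lemma inst_ren:
  assumes "inst u v" "\<And>x. snd (\<rho> x) = snd x"
  shows "inst (subst (\<lambda>x. Fr (\<rho> x)) u) (subst (\<lambda>x. Fr (\<rho> x)) v)"
proof -
  have "inst (nf S (subst (\<lambda>x. Fr (\<rho> x)) u)) (nf S (subst (\<lambda>x. Fr (\<rho> x)) v))"
    by (rule inst_subst[OF assms(1)]) (use assms(2) in simp_all)
  then show ?thesis using inst_lnf[OF assms(1)] lnf_ren[OF _ assms(2)] nf_lnf by metis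
qed

text \<open>Binders of the context may capture variables of the root step, so a renaming changes the
  root step along with the context. Dangling indices are turned into variables by \<open>f\<close>,
  which is needed as soon as a \<open>CLam\<close> is opened.\<close>

lemma ctx_ren:
  "inst u v \<Longrightarrow> (\<And>x. snd (\<rho> x) = snd x) \<Longrightarrow> \<exists>C' u' v'. inst u' v' \<and>
     esub 0 (\<lambda>i. Fr (f i)) (\<lambda>x. Fr (\<rho> x)) (fill C u) = fill C' u' \<and>
     esub 0 (\<lambda>i. Fr (f i)) (\<lambda>x. Fr (\<rho> x)) (fill C v) = fill C' v'"
proof (induction C arbitrary: f \<rho>)
  case Hole
  have "lc u" "lc v" using inst_lnf[OF Hole(1)] lnf_lc by blast+
  then have "esub 0 (\<lambda>i. Fr (f i)) (\<lambda>x. Fr (\<rho> x)) (fill Hole u) = fill Hole (subst (\<lambda>x. Fr (\<rho> x)) u)"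
    "esub 0 (\<lambda>i. Fr (f i)) (\<lambda>x. Fr (\<rho> x)) (fill Hole v) = fill Hole (subst (\<lambda>x. Fr (\<rho> x)) v)"
    by (simp_all add: esub_lc)
  then show ?case using inst_ren[OF Hole(1), of \<rho>] Hole(2) by blast
next
  case (CAppL C t)
  from CAppL.IH[OF CAppL.prems(1), of \<rho> f] CAppL.prems(2) obtain C' u' v' where C': "inst u' v'"
    "esub 0 (\<lambda>i. Fr (f i)) (\<lambda>x. Fr (\<rho> x)) (fill C u) = fill C' u'"
    "esub 0 (\<lambda>i. Fr (f i)) (\<lambda>x. Fr (\<rho> x)) (fill C v) = fill C' v'" by blast
  have "fill (CAppL C' (esub 0 (\<lambda>i. Fr (f i)) (\<lambda>x. Fr (\<rho> x)) t)) w =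
    App (fill C' w) (esub 0 (\<lambda>i. Fr (f i)) (\<lambda>x. Fr (\<rho> x)) t)" for w by simp
  with C' show ?case by (metis esub.simps(4) fill.simps(2))
next
  case (CAppR t C)
  from CAppR.IH[OF CAppR.prems(1), of \<rho> f] CAppR.prems(2) obtain C' u' v' where C': "inst u' v'"
    "esub 0 (\<lambda>i. Fr (f i)) (\<lambda>x. Fr (\<rho> x)) (fill C u) = fill C' u'"
    "esub 0 (\<lambda>i. Fr (f i)) (\<lambda>x. Fr (\<rho> x)) (fill C v) = fill C' v'" by blast
  have "fill (CAppR (esub 0 (\<lambda>i. Fr (f i)) (\<lambda>x. Fr (\<rho> x)) t) C') w =
    App (esub 0 (\<lambda>i. Fr (f i)) (\<lambda>x. Fr (\<rho> x)) t) (fill C' w)" for w by simp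
  with C' show ?case by (metis esub.simps(4) fill.simps(3))
next
  case (CLam x C)
  let ?e = "\<lambda>i. Fr (f i)" and ?\<theta> = "\<lambda>x. Fr (\<rho> x)"
  let ?A = "FV (esub 0 ?e ?\<theta> (lam x (fill C u))) \<union> FV (esub 0 ?e ?\<theta> (lam x (fill C v)))"
  obtain z where z: "z \<notin> ?A" "snd z = snd x" using ex_fresh[of ?A] by auto
  have eq: "case_nat (Fr z) ?e = (\<lambda>i. Fr (case_nat z f i))" "?\<theta>(x := Fr z) = (\<lambda>y. Fr ((\<rho>(x := z)) y))"
    by (auto split: nat.splits)
  have "snd ((\<rho>(x := z)) y) = snd y" for y using z CLam.prems(2) by simp
  from CLam.IH[OF CLam.prems(1) this, of "case_nat z f"] obtain C' u' v' where C': "inst u' v'"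
    "esub 0 (case_nat (Fr z) ?e) (?\<theta>(x := Fr z)) (fill C u) = fill C' u'"
    "esub 0 (case_nat (Fr z) ?e) (?\<theta>(x := Fr z)) (fill C v) = fill C' v'" unfolding eq by blast
  have "esub 0 ?e ?\<theta> (fill (CLam x C) u) = fill (CLam z C') u'"
    "esub 0 ?e ?\<theta> (fill (CLam x C) v) = fill (CLam z C') v'"
    unfolding fill.simps C'(2,3)[symmetric] by (rule esub_lam; use z in simp)+
  then show ?case using C'(1) by blast
qed

lemma rstep_ty: "rstep S R s t \<Longrightarrow> has_ty S [] s \<tau> \<Longrightarrow> has_ty S [] t \<tau>"
  unfolding rstep_inst using inst_lnf lnf_ty fill_ty by metis

text \<open>The context witnessing the step has its own name for the outer binder and captures index
  0 besides; \<open>ctx_ren\<close> sends both to \<open>z\<close>. Freshness for the reduct is a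
  separate assumption, because a step can create free variables.\<close>

lemma rstep_lamD:
  assumes "rstep S R (lam x s) t'" "lc s" "z \<notin> FV (lam x s)" "z \<notin> FV t'" "snd z = snd x"
  obtains t where "t' = lam z t" "rstep S R (subst (Fr(x := Fr z)) s) t"
proof -
  from assms(1) obtain \<tau> C u v where C: "lnf S (lam x s) \<tau>" "inst u v" "lam x s = fill C u" "t' = fill C v"
    unfolding rstep_inst by blast
  obtain b where b: "lnf S u (Base b)" using inst_lnf[OF C(2)] by blast
  have ty: "has_ty S [] (lam x s) \<tau>" "has_ty S [] t' \<tau>" using C(1) lnf_ty rstep_ty[OF assms(1)] by blast+
  \<comment> \<open>Root steps take place at basic types, but an abstraction has a function
    type.\<close>
  have "C \<noteq> Hole" using C(3) lnf_ty[OF b] by (auto simp: has_ty_lam)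
  then obtain y D where D: "C = CLam y D" using C(3) by (cases C) auto
  let ?W = "esub 0 (\<lambda>_. Fr z) (Fr(y := Fr z)) :: ('b, 'f, 'v) tm \<Rightarrow> _"
  have y: "snd z = snd y" using C(3) D assms(5) by (simp add: lam_def)
  have W: "lam y w = lam z (?W w)" if "lc (lam y w)" "z \<notin> FV (lam y w)" for w
  proof -
    have eq: "case_nat (Fr z) (\<lambda>_. Fr z) = (\<lambda>_. Fr z)" by (auto split: nat.splits)
    have "lam y w = esub 0 (\<lambda>_. Fr z) Fr (lam y w)" using that(1) by (simp add: esub_lc)
    also have "\<dots> = lam z (?W w)"
      by (subst esub_lam[where z = z]) (use that y in \<open>simp_all add: esub_lc eq\<close>)
    finally show ?thesis .
  qed
  have lc: "lc (lam x s)" "lc t'" using ty has_ty_Nil_lc by blast+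
  have t': "t' = lam z (?W (fill D v))" using W lc(2) C(4) D assms(4) by (metis fill.simps(4))
  have "lam x s = lam z (?W (fill D u))" using W lc(1) C(3) D assms(3) by (metis fill.simps(4))
  moreover have "lam x s = lam z (subst (Fr(x := Fr z)) s)" using assms by (intro lam_rename) auto
  ultimately have "lam z (subst (Fr(x := Fr z)) s) = lam z (?W (fill D u))" by simp
  then have s: "subst (Fr(x := Fr z)) s = ?W (fill D u)"
    by (subst (asm) lam_inject) (use assms(2) in \<open>auto intro!: lc_subst lc_esub\<close>)
  have "snd ((id(y := z)) w) = snd w" for w using y by simp
  from ctx_ren[OF C(2) this, of "\<lambda>_. z" D] obtain C' u' v' where "inst u' v'"
    "?W (fill D u) = fill C' u'" "?W (fill D v) = fill C' v'" unfolding Fr_upd by blast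
  moreover obtain \<tau>' where "lnf S (subst (Fr(x := Fr z)) s) \<tau>'"
    using lnf_lamD[OF C(1) assms(2)] lnf_rename[OF _ assms(5)] by metis
  ultimately have "rstep S R (subst (Fr(x := Fr z)) s) (?W (fill D v))"
    unfolding rstep_inst using s by metis
  then show thesis using that t' by blast
qed

lemma rstep_appsD:
  assumes "rstep S R (apps a ts) t'" "atom a"
  obtains (root) "inst (apps a ts) t'"
  | (arg) i u where "i < length ts" "rstep S R (ts ! i) u" "t' = apps a (ts[i := u])"
proof -
  from assms(1) obtain \<tau> C u v where C: "lnf S (apps a ts) \<tau>" "inst u v" "apps a ts = fill C u" "t' = fill C v"
    unfolding rstep_inst by blast
  obtain b where b: "lnf S u (Base b)" using inst_lnf[OF C(2)] by blast
  show thesis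
  proof (cases "C = Hole")
    case True
    then show thesis using C root by simp
  next
    case False
    from fill_apps[OF lnf_ty[OF b] C(3)[symmetric] assms(2) lnf_ty[OF C(1)] False] obtain i D where
      D: "i < length ts" "ts ! i = fill D u" "\<And>v. fill C v = apps a (ts[i := fill D v])" by blast
    obtain \<tau>s where "list_all2 (lnf S) ts \<tau>s" using lnf_appsD[OF C(1) assms(2)] by metis
    then have "\<exists>\<tau>. lnf S (ts ! i) \<tau>" using D(1) by (auto simp: list_all2_conv_all_nth)
    then have "rstep S R (ts ! i) (fill D v)" unfolding rstep_inst using C(2) D(2) by metis
    then show thesis using arg D C(4) by metis
  qed
qed

lemma rstep_lnf: "rstep S R s t \<Longrightarrow> lnf S s \<tau> \<Longrightarrow> lnf S t \<tau>"
proof (induction "tm_size s" arbitrary: s t \<tau> rule: less_induct)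
  case less
  \<comment> \<open>The name of the binder is chosen off the variables of the reduct, which may
    contain variables absent from \<open>s\<close>.\<close>
  from less.prems(2) finite_FV[of t] show ?case
  proof (cases rule: lnf_cases_fresh)
    case (apps a ts \<tau>s b)
    from less.prems(1)[unfolded apps(1)] apps(3) show ?thesis
    proof (cases rule: rstep_appsD)
      case root
      from inst_lnf[OF this] obtain c where c: "lnf S s (Base c)" "lnf S t (Base c)" using apps by blast
      then have "\<tau> = Base c" using less.prems(2) lnf_ty has_ty_unique by metis
      then show ?thesis using c by simp
    next
      case (arg i u)
      have "lnf S u (\<tau>s ! i)"
        using less.hyps[OF _ arg(2)] apps arg(1) tm_size_apps[of "ts ! i" ts a]
        by (auto simp: list_all2_conv_all_nth)
      then have "list_all2 (lnf S) (ts[i := u]) \<tau>s"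
        using apps(5) arg(1) by (auto simp: list_all2_conv_all_nth nth_list_update)
      then show ?thesis using apps arg(3) by (auto intro: lnf.intros)
    qed
  next
    case (lam x s' \<tau>')
    have "lc s'" using lam lnf_lc by blast
    from rstep_lamD[OF less.prems(1)[unfolded lam(1)] this _ lam(4) refl] obtain t'' where
      t'': "t = lam x t''" "rstep S R s' t''" by auto
    then show ?thesis using less.hyps[OF _ t''(2) lam(3)] lam by (auto intro: lnf.intros)
  qed
qed

lemma rstep_syms: "rstep S R s t \<Longrightarrow> syms s \<subseteq> range Sym \<Longrightarrow> syms t \<subseteq> range Sym"
  unfolding rstep_inst using fill_syms inst_syms by metis

lemma rstep_terms_of: "rstep S R s t \<Longrightarrow> s \<in> terms_of S \<tau> \<Longrightarrow> t \<in> terms_of S \<tau>"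
  unfolding terms_of_iff using rstep_syms rstep_lnf by blast

lemma rsteps_lnf: "(rstep S R)\<^sup>*\<^sup>* s t \<Longrightarrow> lnf S s \<tau> \<Longrightarrow> lnf S t \<tau>"
  by (induction rule: rtranclp_induct) (auto intro: rstep_lnf)

lemma rstep_fill:
  assumes "rstep S R s t" "lnf S (fill C s) \<tau>" shows "rstep S R (fill C s) (fill C t)"
  using assms unfolding rstep_inst by (metis fill_ctx_comp)

lemma rstep_lam: "rstep S R s t \<Longrightarrow> rstep S R (lam x s) (lam x t)"
proof -
  assume st: "rstep S R s t"
  then obtain \<tau> where "lnf S s \<tau>" unfolding rstep_inst by blast
  then have "lnf S (fill (CLam x Hole) s) (Fun (snd x) \<tau>)" by (auto intro: lnf.intros)
  from rstep_fill[OF st this] show ?thesis by simp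
qed

lemma rsteps_lam: "(rstep S R)\<^sup>*\<^sup>* s t \<Longrightarrow> (rstep S R)\<^sup>*\<^sup>* (lam x s) (lam x t)"
  by (induction rule: rtranclp_induct) (auto intro: rtranclp.rtrancl_into_rtrancl rstep_lam)

lemma rstep_arg:
  assumes "rstep S R (ts ! i) u" "i < length ts" "lnf S (apps a ts) \<tau>"
  shows "rstep S R (apps a ts) (apps a (ts[i := u]))"
proof -
  obtain C where "\<And>u. fill C u = apps a (ts[i := u])" using arg_ctx[OF assms(2)] by metis
  then show ?thesis using rstep_fill[of "ts ! i" u C \<tau>] assms by simp
qed

lemma rsteps_arg:
  assumes "(rstep S R)\<^sup>*\<^sup>* (ts ! i) u" "i < length ts" "lnf S (apps a ts) \<tau>"
  shows "(rstep S R)\<^sup>*\<^sup>* (apps a ts) (apps a (ts[i := u]))"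
  using assms(1)
proof (induction rule: rtranclp_induct)
  case base
  then show ?case by simp
next
  case (step v w)
  have "rstep S R (apps a (ts[i := v])) (apps a ((ts[i := v])[i := w]))"
    by (rule rstep_arg) (use step assms rsteps_lnf[OF step(3) assms(3)] in auto)
  then show ?case using step(3) by simp
qed

lemma rsteps_args:
  assumes "list_all2 (rstep S R)\<^sup>*\<^sup>* ss ts" "lnf S (apps a ss) \<tau>"
  shows "(rstep S R)\<^sup>*\<^sup>* (apps a ss) (apps a ts)"
proof -
  have len: "length ss = length ts" using assms(1) by (simp add: list_all2_lengthD)
  \<comment> \<open>Hybrid lists interpolate between \<open>ss\<close> and \<open>ts\<close>: the
    first \<open>k\<close> arguments are already rewritten.\<close>
  have "k \<le> length ts \<Longrightarrow> (rstep S R)\<^sup>*\<^sup>* (apps a ss) (apps a (take k ts @ drop k ss))" for k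
  proof (induction k)
    case (Suc k)
    let ?us = "take k ts @ drop k ss"
    have IH: "(rstep S R)\<^sup>*\<^sup>* (apps a ss) (apps a ?us)" using Suc by simp
    have k: "k < length ?us" "?us ! k = ss ! k" using Suc.prems len by (auto simp: nth_append)
    have "(rstep S R)\<^sup>*\<^sup>* (apps a ?us) (apps a (?us[k := ts ! k]))"
      by (rule rsteps_arg[OF _ k(1) rsteps_lnf[OF IH assms(2)]])
        (use assms(1) k Suc.prems in \<open>auto simp: list_all2_conv_all_nth\<close>)
    moreover have "?us[k := ts ! k] = take (Suc k) ts @ drop (Suc k) ss"
      using Suc.prems len by (simp add: list_update_append take_Suc_conv_app_nth
          Cons_nth_drop_Suc[symmetric])
    ultimately show ?case using IH by simp
  qed simp
  from this[of "length ts"] show ?thesis using len by simp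
qed

lemma rstep_ren:
  assumes "rstep S R s t" "\<And>x. snd (\<rho> x) = snd x"
  shows "rstep S R (subst (\<lambda>x. Fr (\<rho> x)) s) (subst (\<lambda>x. Fr (\<rho> x)) t)"
proof -
  from assms(1) obtain \<tau> C u v where C: "lnf S s \<tau>" "inst u v" "s = fill C u" "t = fill C v"
    unfolding rstep_inst by blast
  have lc: "lc s" "lc t" using C(1) rstep_lnf[OF assms(1)] lnf_lc by blast+
  obtain C' u' v' where "inst u' v'"
    "esub 0 (\<lambda>i. Fr undefined) (\<lambda>x. Fr (\<rho> x)) (fill C u) = fill C' u'"
    "esub 0 (\<lambda>i. Fr undefined) (\<lambda>x. Fr (\<rho> x)) (fill C v) = fill C' v'"
    using ctx_ren[OF C(2) assms(2), where f = "\<lambda>_. undefined" and C = C] by auto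
  then show ?thesis
    unfolding rstep_inst using lnf_ren[OF C(1) assms(2)] lc C(3,4) by (metis esub_lc)
qed

section \<open>Strong normalisation\<close>

text \<open>Accessibility provides the induction over reducts that the sequence formulation lacks;
  an inaccessible term yields an infinite sequence by dependent choice.\<close>

lemma SN_accp: "SN S R t \<longleftrightarrow> Wellfounded.accp (\<lambda>y x. rstep S R x y) t"
proof
  assume t: "SN S R t"
  show "Wellfounded.accp (\<lambda>y x. rstep S R x y) t"
  proof (rule ccontr)
    let ?bad = "\<lambda>x. \<not> Wellfounded.accp (\<lambda>y x. rstep S R x y) x"
    assume "?bad t"
    have "\<exists>f. \<forall>n. ?bad (f n) \<and> (n = 0 \<longrightarrow> f n = t) \<and> rstep S R (f n) (f (Suc n))"
    proof -
      have "\<exists>f. \<forall>n. (?bad (f n) \<and> (n = 0 \<longrightarrow> f n = t)) \<and> rstep S R (f n) (f (Suc n))"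
      proof (rule dependent_nat_choice)
        show "\<exists>x. ?bad x \<and> (0 = (0::nat) \<longrightarrow> x = t)" using \<open>?bad t\<close> by blast
        show "\<exists>y. (?bad y \<and> (Suc n = 0 \<longrightarrow> y = t)) \<and> rstep S R x y"
          if "?bad x \<and> (n = 0 \<longrightarrow> x = t)" for x n
          using that by (metis Zero_not_Suc not_accp_down)
      qed
      then show ?thesis by blast
    qed
    then show False using t unfolding SN_def by blast
  qed
next
  assume "Wellfounded.accp (\<lambda>y x. rstep S R x y) t"
  then show "SN S R t"
  proof (induction rule: accp_induct_rule)
    case (1 t)
    show ?case
      unfolding SN_def
    proof
      assume "\<exists>s. s 0 = t \<and> (\<forall>i. rstep S R (s i) (s (Suc i)))"
      then obtain s where s: "s 0 = t" "\<And>i. rstep S R (s i) (s (Suc i))" by blast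
      then have "\<exists>s'. s' 0 = s (Suc 0) \<and> (\<forall>i. rstep S R (s' i) (s' (Suc i)))"
        by (intro exI[of _ "\<lambda>i. s (Suc i)"]) auto
      moreover have "SN S R (s (Suc 0))" using 1 s by metis
      ultimately show False unfolding SN_def by blast
    qed
  qed
qed

lemma SN_I: "(\<And>t'. rstep S R t t' \<Longrightarrow> SN S R t') \<Longrightarrow> SN S R t"
  unfolding SN_accp by (rule accp.accI) blast

lemma SN_step: "SN S R t \<Longrightarrow> rstep S R t t' \<Longrightarrow> SN S R t'"
  unfolding SN_accp by (rule accp_downward)

lemma SN_steps: "(rstep S R)\<^sup>*\<^sup>* t t' \<Longrightarrow> SN S R t \<Longrightarrow> SN S R t'"
  by (induction rule: rtranclp_induct) (auto intro: SN_step)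

lemma SN_induct [consumes 1, case_names step]:
  assumes "SN S R t" "\<And>t. (\<And>t'. rstep S R t t' \<Longrightarrow> P t') \<Longrightarrow> P t"
  shows "P t"
  using assms(1) unfolding SN_accp by (induction rule: accp_induct_rule) (use assms(2) in blast)

lemma SN_fill:
  assumes "SN S R (fill C s)" "lnf S (fill C s) \<tau>" shows "SN S R s"
proof -
  have "\<And>s. fill C s = u \<Longrightarrow> lnf S u \<tau> \<Longrightarrow> SN S R s" if "SN S R u" for u
    using that
  proof (induction rule: SN_induct)
    case (step u)
    show ?case
    proof (rule SN_I)
      fix s' assume s': "rstep S R s s'"
      then have "rstep S R u (fill C s')" using rstep_fill step by blast
      then show "SN S R s'" using step rstep_lnf by blast
    qed
  qed
  then show ?thesis using assms by blast
qed

text \<open>As the renaming is an involution, every step of the renamed term is pulled back to a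
  step of the original one.\<close>

lemma SN_ren:
  assumes "SN S R s" "\<And>x. snd (\<rho> x) = snd x" "\<And>x. \<rho> (\<rho> x) = x"
  shows "SN S R (subst (\<lambda>x. Fr (\<rho> x)) s)"
  using assms(1)
proof (induction rule: SN_induct)
  case (step s)
  let ?\<rho> = "subst (\<lambda>x. Fr (\<rho> x)) :: ('b, 'f, 'v) tm \<Rightarrow> _"
  have inv: "?\<rho> (?\<rho> t) = t" for t by (simp add: subst_subst assms(3))
  show ?case
  proof (rule SN_I)
    fix t assume "rstep S R (?\<rho> s) t"
    from rstep_ren[OF this assms(2)] have "rstep S R s (?\<rho> t)" unfolding inv .
    from step[OF this] show "SN S R t" unfolding inv .
  qed
qed

text \<open>
  A step can introduce new free variables, as left-hand sides are not required to be patterns.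
  So the name of the binder may have to be changed, here by a transposition.
\<close>

lemma SN_lam: "SN S R s \<Longrightarrow> lnf S s \<tau> \<Longrightarrow> SN S R (lam x s)"
proof (induction arbitrary: \<tau> rule: SN_induct)
  case (step s)
  show ?case
  proof (rule SN_I)
    fix t' assume t': "rstep S R (lam x s) t'"
    obtain z where z: "z \<notin> insert x (FV s \<union> FV t')" "snd z = snd x"
      using ex_fresh[of "insert x (FV s \<union> FV t')"] by (metis finite_FV finite_Un finite_insert)
    define \<rho> where "\<rho> = (id(x := z, z := x) :: ('b, 'v) var \<Rightarrow> _)"
    let ?\<rho> = "subst (\<lambda>x. Fr (\<rho> x)) :: ('b, 'f, 'v) tm \<Rightarrow> _"
    have \<rho>: "snd (\<rho> y) = snd y" "\<rho> (\<rho> y) = y" for y using z by (auto simp: \<rho>_def)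
    have inv: "?\<rho> (?\<rho> t) = t" for t by (simp add: subst_subst \<rho>)
    have "lc s" using step lnf_lc by blast
    moreover have "z \<notin> FV (lam x s)" "z \<notin> FV t'" using z by auto
    ultimately obtain t where t: "t' = lam z t" "rstep S R (subst (Fr(x := Fr z)) s) t"
      using rstep_lamD[OF t' _ _ _ z(2)] by metis
    have "subst (Fr(x := Fr z)) s = ?\<rho> s" using z by (intro subst_cong) (auto simp: \<rho>_def)
    then have st: "rstep S R s (?\<rho> t)" using rstep_ren[OF t(2) \<rho>(1)] inv by metis
    have lnf: "lnf S (?\<rho> t) \<tau>" using rstep_lnf[OF st step(2)] .
    then have lnft: "lnf S t \<tau>" using lnf_ren[OF lnf \<rho>(1)] inv by simp
    \<comment> \<open>The transposition exchanges \<open>x\<close> and \<open>z\<close>, and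
      \<open>z\<close> does not occur in the reduct.\<close>
    have "x \<notin> FV (?\<rho> t')"
      using z \<rho>(2) by (auto simp: FV_subst) (metis \<rho>_def fun_upd_apply)
    then have "?\<rho> (lam z t) = lam x (subst ((\<lambda>x. Fr (\<rho> x))(z := Fr x)) t)"
      by (intro subst_lam) (use z t lnf_lc[OF lnft] in auto)
    moreover have "(\<lambda>x. Fr (\<rho> x))(z := Fr x) = (\<lambda>x. Fr (\<rho> x) :: ('b, 'f, 'v) tm)"
      by (auto simp: \<rho>_def)
    ultimately have "?\<rho> t' = lam x (?\<rho> t)" by (simp only: t(1))
    then have "SN S R (?\<rho> t')" using step(1)[OF st lnf] by simp
    from SN_ren[OF this \<rho>] show "SN S R t'" unfolding inv .
  qed
qed

lemma SN_args: "SN S R (apps a ts) \<Longrightarrow> lnf S (apps a ts) \<tau> \<Longrightarrow> t \<in> set ts \<Longrightarrow> SN S R t"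
proof -
  assume *: "SN S R (apps a ts)" "lnf S (apps a ts) \<tau>" "t \<in> set ts"
  then obtain i where i: "i < length ts" "ts ! i = t" by (auto simp: in_set_conv_nth)
  then obtain C where "\<And>u. fill C u = apps a (ts[i := u])" using arg_ctx by metis
  then have "fill C t = apps a ts" using i by (metis list_update_id)
  then show ?thesis using SN_fill * by metis
qed

text \<open>Terminating arguments make steps inside the argument list well-founded
  (\<open>lists_accD\<close>). Following nonterminating reducts therefore leads after finitely many
  argument steps to a root step.\<close>

lemma not_SN_root:
  assumes "atom a" "\<And>t. t \<in> set ts \<Longrightarrow> SN S R t" "lnf S (apps a ts) \<tau>" "\<not> SN S R (apps a ts)"
  obtains ts' v where "list_all2 (rstep S R)\<^sup>*\<^sup>* ts ts'" "inst (apps a ts') v" "\<not> SN S R v"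
proof -
  let ?r = "{(y, x). rstep S R x y}"
  have acc: "ts \<in> Wellfounded.acc (listrel1 ?r)"
    by (rule lists_accD) (use assms(2) in \<open>auto simp: SN_accp acc_def\<close>)
  have "lnf S (apps a ts) \<tau> \<Longrightarrow> \<not> SN S R (apps a ts) \<Longrightarrow>
    \<exists>ts' v. list_all2 (rstep S R)\<^sup>*\<^sup>* ts ts' \<and> inst (apps a ts') v \<and> \<not> SN S R v"
    using acc
  proof (induction rule: acc_induct_rule)
    case (1 ts)
    obtain t' where t': "rstep S R (apps a ts) t'" "\<not> SN S R t'"
      using 1(4) SN_I[of "apps a ts"] by blast
    from t'(1) assms(1) show ?case
    proof (cases rule: rstep_appsD)
      case root
      have "list_all2 (rstep S R)\<^sup>*\<^sup>* ts ts" by (simp add: list_all2_refl)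
      then show ?thesis using root t' by blast
    next
      case (arg i u)
      have "(ts[i := u], ts) \<in> listrel1 ?r"
        using arg by (auto simp: listrel1_iff_update intro!: exI[of _ "ts ! i"] exI[of _ i])
      from 1(2)[OF this] obtain ts' v where
        *: "list_all2 (rstep S R)\<^sup>*\<^sup>* (ts[i := u]) ts'" "inst (apps a ts') v" "\<not> SN S R v"
        using arg(3) t' rstep_lnf[OF t'(1) 1(3)] by blast
      have "(rstep S R)\<^sup>*\<^sup>* (ts ! j) (ts[i := u] ! j)" if "j < length ts" for j
        using arg that by (cases "i = j") auto
      then have "list_all2 (rstep S R)\<^sup>*\<^sup>* ts ts'"
        using *(1) by (auto simp: list_all2_conv_all_nth) (metis rtranclp_trans)
      then show ?thesis using * by blast
    qed
  qed
  then show thesis using that assms by blast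
qed

section \<open>Rewriting of normal forms as a logical relation\<close>

definition rel :: "'b ty \<Rightarrow> ('b, 'f, 'v) tm \<Rightarrow> ('b, 'f, 'v) tm \<Rightarrow> bool" where
  "rel \<tau> s t \<longleftrightarrow> has_ty S [] s \<tau> \<and> has_ty S [] t \<tau> \<and> syms s \<subseteq> range Sym \<and> syms t \<subseteq> range Sym \<and>
    (rstep S R)\<^sup>*\<^sup>* (nf S s) (nf S t)"

text \<open>Weak head steps do not change the normal form, so expansion is immediate; the other
  conditions rewrite below a binder or in several arguments. Symbols are restricted to unmarked ones
  because substitutions in rule instances must be unmarked.\<close>

sublocale W: log_rel S "range Sym" rel
proof
  fix s t :: "('b, 'f, 'v) tm" and x \<tau>
  assume x: "x \<notin> FV s" "x \<notin> FV t" and *: "rel \<tau> (App s (Fr x)) (App t (Fr x))"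
  have ty: "has_ty S [] s (Fun (snd x) \<tau>)" "has_ty S [] t (Fun (snd x) \<tau>)"
    using * by (auto simp: rel_def has_ty_App)
  have "(rstep S R)\<^sup>*\<^sup>* (nf S s) (nf S t)"
    unfolding nf_ext[OF ty(1) x(1)] nf_ext[OF ty(2) x(2)] using * by (auto simp: rel_def intro: rsteps_lam)
  then show "rel (Fun (snd x) \<tau>) s t" using ty * by (auto simp: rel_def)
next
  fix a :: "('b, 'f, 'v) tm" and \<tau>s b and ss ts :: "('b, 'f, 'v) tm list"
  assume a: "atom a" "syms a \<subseteq> range Sym" "has_ty S [] a (foldr Fun \<tau>s (Base b))"
    and len: "length ss = length \<tau>s" "length ts = length \<tau>s"
    and rel: "\<And>i. i < length \<tau>s \<Longrightarrow> rel (\<tau>s ! i) (ss ! i) (ts ! i)"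
  have ty: "has_ty S [] (apps a ss) (Base b)" "has_ty S [] (apps a ts) (Base b)"
    using a len rel by (auto simp: has_ty_apps list_all2_conv_all_nth rel_def intro!: exI[of _ \<tau>s])
  have "syms (apps a ss) \<subseteq> range Sym" "syms (apps a ts) \<subseteq> range Sym"
    using a len rel by (fastforce simp: rel_def in_set_conv_nth)+
  moreover have "(rstep S R)\<^sup>*\<^sup>* (nf S (apps a ss)) (nf S (apps a ts))"
    unfolding nf_apps[OF a(1) ty(1)] nf_apps[OF a(1) ty(2)]
  proof (rule rsteps_args)
    show "list_all2 (rstep S R)\<^sup>*\<^sup>* (map (nf S) ss) (map (nf S) ts)"
      using len rel by (auto simp: list_all2_conv_all_nth rel_def)
    show "lnf S (apps a (map (nf S) ss)) (Base b)" using lnf_nf[OF ty(1)] nf_apps[OF a(1) ty(1)] by simp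
  qed
  ultimately show "rel (Base b) (apps a ss) (apps a ts)" using ty by (simp add: rel_def)
qed (auto simp: rel_def whr_nf_eq)

text \<open>The normal form of \<open>subst \<theta> u\<close> reaches that of
  \<open>subst \<theta>' u\<close> by the fundamental theorem, and one root step leads on to the
  normal form of \<open>subst \<theta>' v\<close>.\<close>

lemma inst_lr:
  assumes "inst u v" "lnf S u \<rho>" "W.env [] e \<theta> e' \<theta>'"
  shows "W.lr \<rho> (subst \<theta> u) (subst \<theta>' v)"
proof -
  obtain b where b: "lnf S u (Base b)" "lnf S v (Base b)" using inst_lnf[OF assms(1)] by blast
  then have \<rho>: "\<rho> = Base b" using assms(2) lnf_ty has_ty_unique by metis
  have \<theta>: "has_ty S [] (\<theta>' x) (snd x)" "syms (\<theta>' x) \<subseteq> range Sym" for x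
    using assms(3) W.lr_ok unfolding W.env_def by blast+
  have lc: "lc u" "lc v" using b lnf_lc by blast+
  have u: "W.lr (Base b) (subst \<theta> u) (subst \<theta>' u)" and v: "W.lr (Base b) (subst \<theta> v) (subst \<theta>' v)"
    using W.fundamental[OF lnf_ty[OF b(1)] inst_syms(1)[OF assms(1)] assms(3)]
      W.fundamental[OF lnf_ty[OF b(2)] inst_syms(2)[OF assms(1)] assms(3)] lc
    by (simp_all add: esub_lc del: W.lr.simps)
  have "lnf S (nf S (subst \<theta>' u)) (Base b)" using W.lr_ok[OF u] lnf_nf by blast
  then have "rstep S R (nf S (subst \<theta>' u)) (nf S (subst \<theta>' v))"
    unfolding rstep_inst using inst_subst[OF assms(1) \<theta>] by (metis fill.simps(1))
  then show ?thesis
    unfolding \<rho> using W.reify[OF u] W.reify[OF v] by (auto simp: rel_def)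
qed

text \<open>The context lemma at the identity environment. It makes a step compatible with
  application: applied to the same argument, the normal forms are again linked by rewriting,
  whatever normalisation does to the redex.\<close>

lemma rstep_lr:
  assumes "rstep S R s t" "s \<in> terms_of S \<tau>"
  shows "W.lr \<tau> s t"
proof -
  from assms(1) obtain C u v where C: "inst u v" "s = fill C u" "t = fill C v"
    unfolding rstep_inst by blast
  obtain b where b: "lnf S u (Base b)" "lnf S v (Base b)" using inst_lnf[OF C(1)] by blast
  have st: "s \<in> terms_of S \<tau>" "t \<in> terms_of S \<tau>" using assms rstep_terms_of by blast+
  have env: "W.env [] (\<lambda>_. Fr undefined) Fr (\<lambda>_. Fr undefined) Fr"
    unfolding W.env_def using W.lr_Fr by auto
  have "W.lr \<tau> (esub 0 (\<lambda>_. Fr undefined) Fr (fill C u)) (esub 0 (\<lambda>_. Fr undefined) Fr (fill C v))"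
    by (rule W.context_lemma[OF lnf_ty[OF b(1)] lnf_ty[OF b(2)] inst_lr[OF C(1) b(1)] _ _ _ _ env])
      (use st C in \<open>auto simp: terms_of_iff lnf_ty\<close>)
  moreover have "lc s" "lc t" using st lnf_lc by (auto simp: terms_of_iff)
  ultimately show ?thesis unfolding C(2,3)[symmetric] by (simp only: esub_lc subst_Fr)
qed

end

section \<open>Strong computability\<close>

lemma lams_Nil [simp]: "lams [] t = t"
  and lams_Cons [simp]: "lams (x # xs) t = lam x (lams xs t)"
  and lams_snoc [simp]: "lams (xs @ [x]) t = lams xs (lam x t)"
  by (simp_all add: lams_def)

lemma args_apps:
  assumes "atom a" "\<forall>t\<in>set ts. lc t" shows "args (apps a ts) = set ts"
proof -
  have "set us = set ts" if "apps a ts = lams xs (apps b us)" "atom b" for xs b us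
    using that assms(1) by (cases xs) (auto simp: apps_inject)
  moreover have "apps a ts = lams [] (apps a ts)" by simp
  ultimately show ?thesis using assms unfolding args_def by fast
qed

lemma nf_apps_nf:
  fixes s :: "('b, 'f, 'v :: infinite) tm"
  shows "has_ty S [] (apps s ts) \<tau> \<Longrightarrow> nf S (apps (nf S s) ts) = nf S (apps s ts)"
proof (induction ts arbitrary: \<tau> rule: rev_induct)
  case Nil
  then show ?case using lnf_nf nf_lnf by (metis apps_Nil)
next
  case (snoc t ts)
  then obtain \<sigma> where ty: "has_ty S [] (apps s ts) (Fun \<sigma> \<tau>)" "has_ty S [] t \<sigma>"
    by (auto simp: has_ty_App)
  then obtain \<sigma>s where "has_ty S [] s (foldr Fun \<sigma>s (Fun \<sigma> \<tau>))" "list_all2 (has_ty S []) ts \<sigma>s"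
    by (auto simp: has_ty_apps)
  then have ty': "has_ty S [] (apps (nf S s) ts) (Fun \<sigma> \<tau>)" using nf_ty by (auto simp: has_ty_apps)
  have "nf S (App (apps (nf S s) ts) t) = nf S (App (nf S (apps s ts)) (nf S t))"
    using nf_App_nf[of S "apps (nf S s) ts" t \<tau>] ty' ty(2) unfolding has_ty_App snoc.IH[OF ty(1)] by metis
  also have "\<dots> = nf S (App (apps s ts) t)" using snoc.prems by (intro nf_App_nf) simp
  finally show ?case by simp
qed

context hrs
begin

lemma inst_head: "inst (apps a ts) v \<Longrightarrow> atom a \<Longrightarrow> \<exists>f\<in>defined_syms R. a = Con (Sym f)"
proof -
  assume "inst (apps a ts) v" and a: "atom a"
  then obtain l r \<theta> where *: "(l, r) \<in> R" "is_subst S \<theta>" "apps a ts = nf S (subst \<theta> l)"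
    unfolding inst_def by blast
  from ruleD[OF *(1)] obtain f ls b where l: "l = apps (Con (Sym f)) ls" "f \<in> defined_syms R"
    "lnf S l (Base b)" by metis
  have "has_ty S [] (subst \<theta> l) (Base b)" using l(3) lnf_ty has_ty_subst is_subst_ty[OF *(2)] by blast
  then have "nf S (subst \<theta> l) = apps (Con (Sym f)) (map (nf S) (map (subst \<theta>) ls))"
    unfolding l(1) subst_apps subst.simps by (intro nf_apps) auto
  then show ?thesis using *(3) a l(2) by (metis apps_inject atom_simps(2))
qed

text \<open>Without a defined head there is no root step to which nontermination could be
  traced.\<close>

lemma SN_apps:
  assumes "atom a" "a \<notin> Con ` Sym ` defined_syms R" "\<And>t. t \<in> set ts \<Longrightarrow> SN S R t"
    "lnf S (apps a ts) \<tau>"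
  shows "SN S R (apps a ts)"
  using not_SN_root[OF assms(1,3,4)] inst_head[OF _ assms(1)] assms(2) by (metis image_eqI)

lemma nf_Fr_terms_of: "(nf S (Fr x) :: ('b, 'f, 'v) tm) \<in> terms_of S (snd x)"
  by (rule nf_terms_of) auto

lemma terms_of_ty: "(t :: ('b, 'f, 'v) tm) \<in> terms_of S \<tau> \<Longrightarrow> has_ty S [] t \<tau>"
  using lnf_ty by (auto simp: terms_of_iff)

lemma terms_of_nf: "(t :: ('b, 'f, 'v) tm) \<in> terms_of S \<tau> \<Longrightarrow> nf S t = t"
  using nf_lnf by (auto simp: terms_of_iff)

lemma terms_of_unique: "(t :: ('b, 'f, 'v) tm) \<in> terms_of S \<sigma> \<Longrightarrow> t \<in> terms_of S \<tau> \<Longrightarrow> \<sigma> = \<tau>"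
  using terms_of_ty has_ty_unique by blast

text \<open>A simultaneous induction in the manner of Tait: a computable function terminates because
  it can be applied to a fresh variable, and a variable applied to terminating arguments is
  computable because further computable arguments terminate. The outer \<open>nf\<close> supplies
  eta-long forms at function types.\<close>

lemma sc_reify_reflect:
  "(\<forall>t\<in>terms_of S \<tau>. sc_at S R \<tau> t \<longrightarrow> SN S R t) \<and>
   (\<forall>x \<sigma>s ss. snd x = foldr Fun \<sigma>s \<tau> \<longrightarrow> list_all2 (\<lambda>s \<sigma>. s \<in> terms_of S \<sigma> \<and> SN S R s) ss \<sigma>s \<longrightarrow>
      sc_at S R \<tau> (nf S (apps (Fr x) ss)))"
proof (induction \<tau>)
  case (Base b)
  have "SN S R (nf S (apps (Fr x) ss))"
    if x: "snd x = foldr Fun \<sigma>s (Base b)"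
      and ss: "list_all2 (\<lambda>s \<sigma>. s \<in> terms_of S \<sigma> \<and> SN S R s) ss \<sigma>s" for x \<sigma>s ss
  proof -
    have "list_all2 (lnf S) ss \<sigma>s" using ss by (auto simp: terms_of_iff elim: list_all2_mono)
    then have lnf: "lnf S (apps (Fr x) ss) (Base b)" using x by (intro lnf.intros) auto
    have "SN S R t" if "t \<in> set ss" for t
      using ss that by (auto simp: list_all2_conv_all_nth in_set_conv_nth)
    then show ?thesis unfolding nf_lnf[OF lnf] by (intro SN_apps[OF _ _ _ lnf]) auto
  qed
  then show ?case by auto
next
  case (Fun \<alpha> \<beta>)
  have reflect: "sc_at S R (Fun \<alpha> \<beta>) (nf S (apps (Fr x) ss))"
    if x: "snd x = foldr Fun \<sigma>s (Fun \<alpha> \<beta>)"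
      and ss: "list_all2 (\<lambda>s \<sigma>. s \<in> terms_of S \<sigma> \<and> SN S R s) ss \<sigma>s" for x \<sigma>s ss
  proof -
    have "list_all2 (has_ty S []) ss \<sigma>s"
      using ss terms_of_ty by (auto simp: list_all2_conv_all_nth)
    then have ty: "has_ty S [] (apps (Fr x) ss) (Fun \<alpha> \<beta>)" using x by (auto simp: has_ty_apps)
    have "sc_at S R \<beta> (nf S (App (nf S (apps (Fr x) ss)) u))"
      if u: "u \<in> terms_of S \<alpha>" "sc_at S R \<alpha> u" for u
    proof -
      have "SN S R u" using Fun.IH(1) u by blast
      then have "list_all2 (\<lambda>s \<sigma>. s \<in> terms_of S \<sigma> \<and> SN S R s) (ss @ [u]) (\<sigma>s @ [\<alpha>])"
        using ss u by (auto intro: list_all2_appendI)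
      then have "sc_at S R \<beta> (nf S (apps (Fr x) (ss @ [u])))"
        by (intro Fun.IH(2)[THEN conjunct2, rule_format, where \<sigma>s = "\<sigma>s @ [\<alpha>]"]) (use x in auto)
      moreover have "has_ty S [] (App (apps (Fr x) ss) u) \<beta>"
        using ty terms_of_ty[OF u(1)] by (auto simp: has_ty_App)
      ultimately show ?thesis using nf_App_nf terms_of_nf[OF u(1)] by (metis apps_snoc)
    qed
    then show ?thesis by simp
  qed
  have reify: "SN S R t" if t: "t \<in> terms_of S (Fun \<alpha> \<beta>)" "sc_at S R (Fun \<alpha> \<beta>) t" for t
  proof -
    obtain x where x: "x \<notin> FV t" "snd x = \<alpha>" using ex_fresh[OF finite_FV] by blast
    have "sc_at S R \<alpha> (nf S (apps (Fr x) []))"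
      by (rule Fun.IH(1)[THEN conjunct2, rule_format, where \<sigma>s = "[]"]) (use x in simp_all)
    then have sc: "sc_at S R \<beta> (nf S (App t (nf S (Fr x))))"
      using t(2) nf_Fr_terms_of[of x] x(2) by simp
    have ty: "has_ty S [] (App t (Fr x)) \<beta>" using terms_of_ty[OF t(1)] x(2) by (auto simp: has_ty_App)
    have eq: "nf S (App t (nf S (Fr x))) = nf S (App t (Fr x))"
      using nf_App_nf[OF ty] terms_of_nf[OF t(1)] by simp
    have "nf S (App t (Fr x)) \<in> terms_of S \<beta>" using t(1) by (intro nf_terms_of[OF ty]) (simp add: terms_of_iff)
    then have "SN S R (nf S (App t (Fr x)))" using sc eq Fun.IH(2) by simp
    then have "SN S R (lam x (nf S (App t (Fr x))))" using SN_lam lnf_nf[OF ty] by blast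
    then show ?thesis using nf_ext[of S t x \<beta>] terms_of_ty[OF t(1)] terms_of_nf[OF t(1)] x by simp
  qed
  show ?case using reify reflect by blast
qed

lemma SC_iff: "t \<in> terms_of S \<tau> \<Longrightarrow> SC S R t \<longleftrightarrow> sc_at S R \<tau> t"
  unfolding SC_def using terms_of_unique by blast

lemma SC_SN: "SC S R t \<Longrightarrow> SN S R t"
  unfolding SC_def using sc_reify_reflect by blast

lemma SC_terms_of: "SC S R t \<Longrightarrow> has_ty S [] t \<tau> \<Longrightarrow> t \<in> terms_of S \<tau>"
  unfolding SC_def using terms_of_ty has_ty_unique by metis

lemma SC_Base: "t \<in> terms_of S (Base b) \<Longrightarrow> SC S R t \<longleftrightarrow> SN S R t"
  by (simp add: SC_iff)

lemma SC_Fr: "SC S R (nf S (Fr x))"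
proof -
  have "sc_at S R (snd x) (nf S (apps (Fr x) []))"
    by (rule sc_reify_reflect[THEN conjunct2, rule_format, where \<sigma>s = "[]"]) simp_all
  then show ?thesis using SC_iff[OF nf_Fr_terms_of] by simp
qed

lemma SC_App:
  assumes "SC S R (nf S s)" "SC S R (nf S t)" "has_ty S [] (App s t) \<tau>"
  shows "SC S R (nf S (App s t))"
proof -
  obtain \<sigma> where ty: "has_ty S [] s (Fun \<sigma> \<tau>)" "has_ty S [] t \<sigma>" using assms(3) by (auto simp: has_ty_App)
  have *: "nf S s \<in> terms_of S (Fun \<sigma> \<tau>)" "nf S t \<in> terms_of S \<sigma>"
    using SC_terms_of assms(1,2) ty nf_ty by blast+
  then have "sc_at S R \<tau> (nf S (App (nf S s) (nf S t)))"
    using assms(1,2) by (simp add: SC_iff)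
  moreover have "nf S (App (nf S s) (nf S t)) \<in> terms_of S \<tau>"
    using * by (intro nf_terms_of) (auto simp: terms_of_iff has_ty_App intro: lnf_ty)
  ultimately have "SC S R (nf S (App (nf S s) (nf S t)))" by (simp add: SC_iff)
  then show ?thesis by (simp only: nf_App_nf[OF assms(3)])
qed

lemma SC_apps:
  "SC S R (nf S s) \<Longrightarrow> \<forall>t\<in>set ts. SC S R (nf S t) \<Longrightarrow> has_ty S [] (apps s ts) \<tau> \<Longrightarrow>
   SC S R (nf S (apps s ts))"
proof (induction ts arbitrary: \<tau> rule: rev_induct)
  case (snoc t ts)
  then obtain \<sigma> where "has_ty S [] (apps s ts) (Fun \<sigma> \<tau>)" by (auto simp: has_ty_App)
  then have "SC S R (nf S (apps s ts))" using snoc by auto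
  then show ?case using snoc.prems SC_App by auto
qed simp

lemma is_subst_upd: "is_subst S \<theta> \<Longrightarrow> u \<in> terms_of S (snd x) \<Longrightarrow> is_subst S (\<theta>(x := u))"
  by (simp add: is_subst_def)

lemma subst_terms_of:
  fixes t :: "('b, 'f, 'v) tm"
  assumes "is_subst S \<theta>" "t \<in> terms_of S \<tau>"
  shows "has_ty S [] (subst \<theta> t) \<tau>" "syms (subst \<theta> t) \<subseteq> range Sym" "nf S (subst \<theta> t) \<in> terms_of S \<tau>"
proof -
  show *: "has_ty S [] (subst \<theta> t) \<tau>"
    using terms_of_ty[OF assms(2)] has_ty_subst is_subst_ty[OF assms(1)] by blast
  show "syms (subst \<theta> t) \<subseteq> range Sym"
    using is_subst_syms[OF assms(1)] assms(2) unfolding syms_subst terms_of_iff by blast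
  then show "nf S (subst \<theta> t) \<in> terms_of S \<tau>" by (rule nf_terms_of[OF *])
qed

lemma SC_lam:
  assumes \<theta>: "is_subst S \<theta>" and t: "t \<in> terms_of S \<tau>"
    and SC: "\<And>u. u \<in> terms_of S (snd x) \<Longrightarrow> SC S R u \<Longrightarrow> SC S R (nf S (subst (\<theta>(x := u)) t))"
  shows "SC S R (nf S (subst \<theta> (lam x t)))"
proof -
  let ?s = "subst \<theta> (lam x t)"
  have lam: "lam x t \<in> terms_of S (Fun (snd x) \<tau>)" using t by (auto simp: terms_of_iff intro: lnf.intros)
  note s = subst_terms_of[OF \<theta> lam]
  have "sc_at S R \<tau> (nf S (App (nf S ?s) u))" if u: "u \<in> terms_of S (snd x)" "sc_at S R (snd x) u" for u
  proof -
    have ty: "has_ty S [] (App ?s u) \<tau>" using s(1) terms_of_ty[OF u(1)] by (auto simp: has_ty_App)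
    have "lc t" using t lnf_lc by (auto simp: terms_of_iff)
    then have "nf S (App ?s u) = nf S (subst (\<theta>(x := u)) t)"
      using whr_nf_eq[OF whr_beta_lam ty] is_subst_lc[OF \<theta>] by blast
    moreover have "nf S (App (nf S ?s) u) = nf S (App ?s u)"
      using nf_App_nf[OF ty] terms_of_nf[OF u(1)] by simp
    moreover have "SC S R (nf S (subst (\<theta>(x := u)) t))" using SC u SC_iff by blast
    ultimately show ?thesis
      using SC_iff[OF subst_terms_of(3)[OF is_subst_upd[OF \<theta> u(1)] t]] by simp
  qed
  then show ?thesis using SC_iff[OF s(3)] by simp
qed

text \<open>At function types both sides receive the same argument, which
  \<open>fundamental_refl\<close> relates to itself; at basic types the claim is preservation of
  termination.\<close>

lemma lr_sc: "W.lr \<tau> s t \<Longrightarrow> sc_at S R \<tau> (nf S s) \<Longrightarrow> sc_at S R \<tau> (nf S t)"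
proof (induction \<tau> arbitrary: s t)
  case (Base b)
  have "(rstep S R)\<^sup>*\<^sup>* (nf S s) (nf S t)" using W.reify[OF Base(1)] by (simp add: rel_def)
  from SN_steps[OF this] show ?case using Base(2) by simp
next
  case (Fun \<alpha> \<beta>)
  have "sc_at S R \<beta> (nf S (App (nf S t) u))" if u: "u \<in> terms_of S \<alpha>" "sc_at S R \<alpha> u" for u
  proof -
    have "W.lr \<alpha> u u" using u(1) terms_of_ty by (intro W.fundamental_refl) (auto simp: terms_of_iff)
    from W.lr_App[OF Fun.prems(1) this] have lr: "W.lr \<beta> (App s u) (App t u)" .
    have "nf S (App (nf S s) u) = nf S (App s u)" "nf S (App (nf S t) u) = nf S (App t u)"
      using nf_App_nf[OF W.lr_ok(1)[OF lr]] nf_App_nf[OF W.lr_ok(2)[OF lr]] terms_of_nf[OF u(1)] by simp_all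
    moreover have "sc_at S R \<beta> (nf S (App (nf S s) u))" using Fun.prems(2) u by simp
    ultimately show ?thesis using Fun.IH(2)[OF lr] by metis
  qed
  then show ?case by simp
qed

lemma SC_rstep: "SC S R s \<Longrightarrow> rstep S R s t \<Longrightarrow> SC S R t"
proof -
  assume s: "SC S R s" and st: "rstep S R s t"
  then obtain \<tau> where \<tau>: "s \<in> terms_of S \<tau>" "sc_at S R \<tau> s" by (auto simp: SC_def)
  have t: "t \<in> terms_of S \<tau>" using rstep_terms_of st \<tau> by blast
  then show ?thesis using lr_sc[OF rstep_lr[OF st \<tau>(1)]] \<tau> terms_of_nf SC_iff by metis
qed

lemma SC_rsteps: "(rstep S R)\<^sup>*\<^sup>* s t \<Longrightarrow> SC S R s \<Longrightarrow> SC S R t"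
  by (induction rule: rtranclp_induct) (auto intro: SC_rstep)

text \<open>Termination of the instance passes to subterms as long as normalisation keeps them. A
  head outside \<open>X\<close> is a constant or is sent to a variable, so its arguments survive; a
  head in \<open>X\<close> could be instantiated by a term that drops them, and there the descent
  stops. Each binder is sent to a new variable, so the final substitution agrees with the given one
  on \<open>X\<close> only. The subterm found has a basic type, where termination amounts to
  computability.\<close>

lemma in_safe_B_SN:
  "in_safe_B X t u \<Longrightarrow> t \<in> terms_of S \<tau> \<Longrightarrow> is_subst S \<theta> \<Longrightarrow>
   (\<And>x. x \<notin> X \<Longrightarrow> \<exists>y. snd y = snd x \<and> \<theta> x = nf S (Fr y)) \<Longrightarrow> SN S R (nf S (subst \<theta> t)) \<Longrightarrow>
   (\<exists>b. u \<in> terms_of S (Base b)) \<and>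
   (\<exists>\<theta>'. is_subst S \<theta>' \<and> (\<forall>x\<in>X. \<theta>' x = \<theta> x) \<and> SN S R (nf S (subst \<theta>' u)))"
proof (induction arbitrary: \<tau> \<theta> rule: in_safe_B.induct)
  case (1 a ts)
  then show ?case using lnf_appsD[of S a ts \<tau>] unfolding terms_of_iff by metis
next
  case (2 a t ts u)
  have "lnf S (apps a ts) \<tau>" using 2(6) by (simp add: terms_of_iff)
  from lnf_appsD[OF this 2(1)] obtain b \<tau>s where \<tau>: "\<tau> = Base b"
    "has_ty S [] a (foldr Fun \<tau>s (Base b))" "list_all2 (lnf S) ts \<tau>s" .
  note ty = subst_terms_of(1)[OF 2(7,6)]
  \<comment> \<open>The atom \<open>a'\<close> is the head after instantiation; for a variable,
    \<open>\<theta>\<close> gives an eta-expanded variable, and applying it undoes the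
    expansion.\<close>
  have "\<exists>a'. atom a' \<and> has_ty S [] a' (foldr Fun \<tau>s (Base b)) \<and> nf S (subst \<theta> a) = nf S a'"
    using 2(1)
  proof (cases rule: atom_cases)
    case (1 x)
    then obtain y where "snd y = snd x" "\<theta> x = nf S (Fr y)" using 2(2,8) by blast
    moreover have "nf S (nf S (Fr y)) = nf S (Fr y)" using terms_of_nf[OF nf_Fr_terms_of] .
    ultimately show ?thesis using \<tau>(2) 1 by (intro exI[of _ "Fr y"]) auto
  next
    case (2 c)
    then show ?thesis using \<tau>(2) by (intro exI[of _ "Con c"]) auto
  qed
  then obtain a' where a': "atom a'" "has_ty S [] a' (foldr Fun \<tau>s (Base b))" "nf S (subst \<theta> a) = nf S a'"
    by blast
  let ?ts = "map (subst \<theta>) ts"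
  have "list_all2 (has_ty S []) ?ts \<tau>s"
    using \<tau>(3) is_subst_ty[OF 2(7)] by (auto simp: list_all2_conv_all_nth intro!: has_ty_subst[OF lnf_ty])
  then have ty': "has_ty S [] (apps a' ?ts) (Base b)" using a'(2) by (auto simp: has_ty_apps)
  have "nf S (subst \<theta> (apps a ts)) = nf S (apps (nf S (subst \<theta> a)) ?ts)"
    using nf_apps_nf ty by (metis subst_apps)
  also have "\<dots> = apps a' (map (nf S) ?ts)"
    using a'(3) nf_apps_nf[OF ty'] nf_apps[OF a'(1) ty'] by simp
  finally have eq: "nf S (subst \<theta> (apps a ts)) = apps a' (map (nf S) ?ts)" .
  have "SN S R (nf S (subst \<theta> t))"
    using SN_args[of a' "map (nf S) ?ts"] 2(9,3) lnf_nf[OF ty] unfolding eq by auto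
  moreover obtain \<sigma> where "t \<in> terms_of S \<sigma>"
  proof -
    from 2(3) obtain i where "i < length ts" "t = ts ! i" by (auto simp: in_set_conv_nth)
    then have "lnf S t (\<tau>s ! i)" using \<tau>(3) by (simp add: list_all2_conv_all_nth)
    moreover have "syms t \<subseteq> range Sym" using 2(3,6) by (auto simp: terms_of_iff)
    ultimately show thesis using that by (simp add: terms_of_iff)
  qed
  ultimately show ?case using 2(5)[OF _ 2(7,8)] by blast
next
  case (3 x t u)
  have "lnf S (lam x t) \<tau>" using 3(5) by (simp add: terms_of_iff)
  from lnf_lamD[OF this 3(2)] 3(5) obtain \<tau>' where t: "t \<in> terms_of S \<tau>'"
    unfolding terms_of_iff syms_lam by metis
  \<comment> \<open>With the bound variable sent to the eta-long form of \<open>y\<close>, the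
    normal form of the instance is \<open>lam y\<close> over that of the body, so a context exposes
    the body.\<close>
  obtain y where y: "y \<notin> FV (subst \<theta> (lam x t))" "snd y = snd x" using ex_fresh[OF finite_FV] by blast
  let ?\<theta> = "\<theta>(x := nf S (Fr y))"
  have \<theta>': "is_subst S ?\<theta>" using 3(6) nf_Fr_terms_of[of y] y(2) by (auto intro: is_subst_upd)
  have ty: "has_ty S [] ((\<theta>(x := Fr y)) z) (snd z)" for z using is_subst_ty[OF 3(6)] y(2) by auto
  have "conv S ((\<theta>(x := Fr y)) z) (?\<theta> z)" for z using nf_conv[of S "Fr y"] by auto
  note conv = conv_nf_eq[OF conv_subst_pointwise[OF terms_of_ty[OF t] ty this]
      has_ty_subst[OF terms_of_ty[OF t] ty]]
  have "nf S (subst \<theta> (lam x t)) = nf S (lam y (subst (\<theta>(x := Fr y)) t))"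
    using subst_lam[OF is_subst_lc[OF 3(6)] 3(2) y] by simp
  also have "\<dots> = lam y (nf S (subst ?\<theta> t))"
    by (simp only: nf_lam[OF has_ty_subst[OF terms_of_ty[OF t] ty]] conv)
  finally have "SN S R (fill (CLam y Hole) (nf S (subst ?\<theta> t)))" using 3(8) by simp
  moreover have "lnf S (fill (CLam y Hole) (nf S (subst ?\<theta> t))) (Fun (snd y) \<tau>')"
    using subst_terms_of(3)[OF \<theta>' t] by (auto simp: terms_of_iff intro: lnf.intros)
  ultimately have SN: "SN S R (nf S (subst ?\<theta> t))" using SN_fill by blast
  have "\<exists>w. snd w = snd z \<and> ?\<theta> z = nf S (Fr w)" if "z \<notin> X" for z
    using 3(7)[OF that] y(2) by auto
  from "3.IH"[OF t \<theta>' this SN] show ?case using 3(1) by (metis fun_upd_other)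
qed

text \<open>Arguments of \<open>l\<close> are computable by assumption. A deeper safe subterm has a
  basic type and only variables of \<open>l\<close>, so the termination supplied by
  \<open>in_safe_B_SN\<close> is what is needed.\<close>

lemma safe_SC:
  assumes l: "l = apps (Con (Sym f)) ls" "l \<in> terms_of S (Base b)" and \<theta>: "is_subst S \<theta>"
    and SC: "\<And>t. t \<in> set ls \<Longrightarrow> SC S R (nf S (subst \<theta> t))" and u: "u \<in> safe l"
  shows "SC S R (nf S (subst \<theta> u))"
proof -
  have lnf: "\<exists>\<sigma>. t \<in> terms_of S \<sigma>" if t: "t \<in> set ls" for t
  proof -
    obtain \<tau>s where "list_all2 (lnf S) ls \<tau>s" using l lnf_appsD unfolding terms_of_iff by (metis atom_simps(2))
    then show ?thesis
      using t l unfolding terms_of_iff by (fastforce simp: list_all2_conv_all_nth in_set_conv_nth)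
  qed
  then have "\<forall>t\<in>set ls. lc t" using lnf_lc unfolding terms_of_iff by blast
  then have args: "args l = set ls" unfolding l(1) by (intro args_apps) auto
  show ?thesis
  proof (cases "u \<in> set ls")
    case True
    then show ?thesis by (rule SC)
  next
    case False
    then obtain l' where l': "l' \<in> set ls" "in_safe_B (FV l) l' u" "FV u \<subseteq> FV l"
      using u args unfolding safe_def by blast
    obtain \<sigma> where \<sigma>: "l' \<in> terms_of S \<sigma>" using lnf l'(1) by blast
    \<comment> \<open>Off the variables of \<open>l\<close> the substitution is reset to variables,
      as the descent requires; the instances of \<open>l'\<close> and \<open>u\<close> are
      unaffected.\<close>
    define \<theta>' where "\<theta>' = (\<lambda>x. if x \<in> FV l then \<theta> x else nf S (Fr x))"
    have "is_subst S \<theta>'" using \<theta> nf_Fr_terms_of by (auto simp: is_subst_def \<theta>'_def)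
    moreover have "\<exists>y. snd y = snd x \<and> \<theta>' x = nf S (Fr y)" if "x \<notin> FV l" for x
      using that by (auto simp: \<theta>'_def)
    moreover have "subst \<theta>' l' = subst \<theta> l'"
      using l'(1) l(1) by (intro subst_cong) (auto simp: \<theta>'_def)
    then have "SN S R (nf S (subst \<theta>' l'))" using SC[OF l'(1)] SC_SN by simp
    ultimately obtain b \<theta>'' where *: "u \<in> terms_of S (Base b)" "is_subst S \<theta>''"
      "\<And>x. x \<in> FV l \<Longrightarrow> \<theta>'' x = \<theta>' x" "SN S R (nf S (subst \<theta>'' u))"
      using in_safe_B_SN[OF l'(2) \<sigma>] by blast
    have "subst \<theta>'' u = subst \<theta> u" using *(3) l'(3) by (intro subst_cong) (auto simp: \<theta>'_def)
    then show ?thesis using * SC_Base subst_terms_of(3)[OF \<theta> *(1)] by simp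
  qed
qed

end

section \<open>Static dependency chains\<close>

lemma in_Cand_trans: "in_Cand s t \<Longrightarrow> in_Cand t u \<Longrightarrow> in_Cand s u"
  by (induction rule: in_Cand.induct) (auto intro: in_Cand.intros)

lemma in_Sub_trans: "in_Sub X s t \<Longrightarrow> in_Sub X t u \<Longrightarrow> in_Sub X s u"
  by (induction rule: in_Sub.induct) (auto intro: in_Sub.intros)

lemma sharp_apps:
  "sharp R (apps (Con (Sym f)) ts) = apps (Con (if f \<in> defined_syms R then Mark f else Sym f)) ts"
  by (induction ts rule: rev_induct) auto

context hrs
begin

lemma terms_of_apps_args:
  assumes "apps a ts \<in> terms_of S \<tau>" "atom a" "(t :: ('b, 'f, 'v) tm) \<in> set ts"
  obtains \<sigma> where "t \<in> terms_of S \<sigma>"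
proof -
  have "lnf S (apps a ts) \<tau>" using assms(1) by (simp add: terms_of_iff)
  from lnf_appsD[OF this assms(2)] obtain \<tau>s where \<tau>s: "list_all2 (lnf S) ts \<tau>s" by metis
  obtain i where "i < length ts" "t = ts ! i" using assms(3) by (auto simp: in_set_conv_nth)
  then have "lnf S t (\<tau>s ! i)" using \<tau>s by (simp add: list_all2_conv_all_nth)
  moreover have "syms t \<subseteq> range Sym" using assms(1,3) by (auto simp: terms_of_iff)
  ultimately show thesis using that by (simp add: terms_of_iff)
qed

lemma terms_of_apps_lc: "apps a ts \<in> terms_of S \<tau> \<Longrightarrow> \<forall>t\<in>set ts. lc t"
  using lnf_lc lc_apps unfolding terms_of_iff by blast

lemma nf_subst_apps_Con:
  fixes ts :: "('b, 'f, 'v) tm list"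
  assumes "apps (Con c) ts \<in> terms_of S (Base b)" "is_subst S \<theta>"
  shows "nf S (subst \<theta> (apps (Con c) ts)) = apps (Con c) (map (\<lambda>t. nf S (subst \<theta> t)) ts)"
  using nf_apps[of "Con c" S "map (subst \<theta>) ts" b] subst_terms_of(1)[OF assms(2,1)]
  by (simp add: comp_def)

text \<open>
  Both the start of the chain and each of its steps search for a minimal failure of strong
  computability; \<open>Inv\<close> carries what is known of the subterm, \<open>xs\<close> the binders passed on the way.
\<close>

lemma SC_or_failure:
  assumes A: "finite A"
    and lam: "\<And>xs x s \<theta> u. Inv xs (lam x s) \<theta> \<Longrightarrow> lc s \<Longrightarrow> x \<notin> A \<Longrightarrow> x \<notin> set xs \<Longrightarrow> u \<in> terms_of S (snd x) \<Longrightarrow>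
      SC S R u \<Longrightarrow> Inv (xs @ [x]) s (\<theta>(x := u))"
    and arg: "\<And>xs a ts t \<theta>. atom a \<Longrightarrow> \<forall>t\<in>set ts. lc t \<Longrightarrow> t \<in> set ts \<Longrightarrow> Inv xs (apps a ts) \<theta> \<Longrightarrow> Inv xs t \<theta>"
    and Fr: "\<And>xs x ts b \<theta>. Inv xs (apps (Fr x) ts) \<theta> \<Longrightarrow> is_subst S \<theta> \<Longrightarrow>
      apps (Fr x) ts \<in> terms_of S (Base b) \<Longrightarrow> \<forall>t\<in>set ts. SC S R (nf S (subst \<theta> t)) \<Longrightarrow>
      SC S R (nf S (subst \<theta> (apps (Fr x) ts)))"
    and defd: "\<And>xs f ts b \<theta>. Inv xs (apps (Con (Sym f)) ts) \<theta> \<Longrightarrow> is_subst S \<theta> \<Longrightarrow>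
      apps (Con (Sym f)) ts \<in> terms_of S (Base b) \<Longrightarrow> \<forall>t\<in>set ts. SC S R (nf S (subst \<theta> t)) \<Longrightarrow>
      f \<in> defined_syms R \<Longrightarrow> SC S R (nf S (subst \<theta> (apps (Con (Sym f)) ts))) \<or> B"
  shows "Inv xs t \<theta> \<Longrightarrow> t \<in> terms_of S \<tau> \<Longrightarrow> is_subst S \<theta> \<Longrightarrow> SC S R (nf S (subst \<theta> t)) \<or> B"
proof (induction "tm_size t" arbitrary: xs t \<theta> \<tau> rule: less_induct)
  case less
  show ?case
  \<comment> \<open>If \<open>B\<close> fails, the induction hypothesis gives plain computability of
    all smaller instances.\<close>
  proof (cases B)
    case False
    have lnf: "lnf S t \<tau>" and syms: "syms t \<subseteq> range Sym" using less.prems(2) by (auto simp: terms_of_iff)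
    have "finite (A \<union> set xs)" using A by simp
    with lnf show ?thesis
    proof (cases rule: lnf_cases_fresh)
      case (apps a ts \<tau>s b)
      have t: "apps a ts \<in> terms_of S (Base b)" using less.prems(2) apps by simp
      have args: "\<exists>\<sigma>. s \<in> terms_of S \<sigma>" if "s \<in> set ts" for s
        using terms_of_apps_args[OF t apps(3) that] by blast
      then have lc: "\<forall>s\<in>set ts. lc s" using lnf_lc unfolding terms_of_iff by blast
      have SC: "SC S R (nf S (subst \<theta> s))" if s: "s \<in> set ts" for s
      proof -
        obtain \<sigma> where \<sigma>: "s \<in> terms_of S \<sigma>" using args s by blast
        have "tm_size s < tm_size t" using tm_size_apps[OF s] apps(1) by simp
        then show ?thesis
          using less.hyps[OF _ arg[OF apps(3) lc s] \<sigma> less.prems(3)] less.prems(1) apps(1) False by blast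
      qed
      from apps(3) show ?thesis
      proof (cases rule: atom_cases)
        case (1 x)
        then show ?thesis using Fr less.prems t SC apps(1) by blast
      next
        case (2 c)
        then obtain f where f: "c = Sym f" using syms apps(1) by auto
        show ?thesis
        proof (cases "f \<in> defined_syms R")
          case True
          then show ?thesis using defd less.prems t SC apps(1) 2 f by blast
        next
          case undefd: False
          have "nf S (subst \<theta> t) \<in> terms_of S (Base b)"
            using subst_terms_of(3)[OF less.prems(3) t] apps(1) by simp
          moreover have eq: "nf S (subst \<theta> t) = apps a (map (\<lambda>t. nf S (subst \<theta> t)) ts)"
            using nf_subst_apps_Con t less.prems(3) unfolding apps(1) 2 by blast
          moreover have "SN S R (apps a (map (\<lambda>t. nf S (subst \<theta> t)) ts))"
            by (rule SN_apps[OF apps(3)])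
              (use undefd 2 f SC SC_SN calculation in \<open>auto simp: terms_of_iff\<close>)
          ultimately show ?thesis using SC_Base by simp
        qed
      qed
    next
      case (lam x s \<tau>')
      have s: "s \<in> terms_of S \<tau>'" using lam syms by (auto simp: terms_of_iff)
      have "SC S R (nf S (subst (\<theta>(x := u)) s))" if u: "u \<in> terms_of S (snd x)" "SC S R u" for u
      proof -
        have "Inv (xs @ [x]) s (\<theta>(x := u))" using assms(2) less.prems(1) lam lnf_lc u by blast
        then show ?thesis
          using less.hyps[OF _ _ s is_subst_upd[OF less.prems(3) u(1)]] lam(1) False by auto
      qed
      then show ?thesis using SC_lam[OF less.prems(3) s] lam(1) by simp
    qed
  qed simp
qed

section \<open>Minimal failures and the construction of the chain\<close>

definition bad :: "('b, 'f, 'v) tm \<Rightarrow> bool" where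
  "bad t \<longleftrightarrow> (\<exists>f ts b. f \<in> defined_syms R \<and> t = apps (Con (Sym f)) ts \<and> t \<in> terms_of S (Base b) \<and>
     (\<forall>s\<in>set ts. SC S R s) \<and> \<not> SN S R t)"

lemma apps_T_args_SC:
  assumes "apps a ts \<in> terms_of S \<tau>" "atom a" "\<forall>t\<in>set ts. SC S R t"
  shows "apps a ts \<in> T_args_SC S R"
proof -
  have "\<forall>t\<in>set ts. lc t" using terms_of_apps_lc[OF assms(1)] .
  from args_apps[OF assms(2) this] show ?thesis
    using assms unfolding T_args_SC_def terms_def by auto
qed

lemma bad_T_args_SC: "bad t \<Longrightarrow> t \<in> T_args_SC S R"
  unfolding bad_def using apps_T_args_SC by (metis atom_simps(2))

lemma exists_bad:
  assumes "t \<in> terms_of S \<tau>" "\<not> SC S R t" shows "\<exists>t. bad t"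
proof -
  \<comment> \<open>The identity substitution has to be taken in eta-long form to count as a
    substitution.\<close>
  let ?\<theta> = "\<lambda>x. nf S (Fr x) :: ('b, 'f, 'v) tm"
  have \<theta>: "is_subst S ?\<theta>" unfolding is_subst_def using nf_Fr_terms_of by blast
  have "SC S R (nf S (subst ?\<theta> t)) \<or> (\<exists>t. bad t)"
  \<comment> \<open>With no rule involved, the information carried downwards is that free variables
    have computable values.\<close>
  proof (rule SC_or_failure[where Inv = "\<lambda>_ t \<theta>. \<forall>x\<in>FV t. SC S R (\<theta> x)" and xs = "[]" and A = "{}", OF _ _ _ _ _ _ assms(1) \<theta>])
    fix x ts b \<theta>
    assume *: "\<forall>y\<in>FV (apps (Fr x) ts). SC S R (\<theta> y)" "is_subst S \<theta>" "apps (Fr x) ts \<in> terms_of S (Base b)"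
      "\<forall>t\<in>set ts. SC S R (nf S (subst \<theta> t))"
    have "nf S (\<theta> x) = \<theta> x" using nf_lnf is_subst_lnf[OF *(2)] by blast
    then have "SC S R (nf S (subst \<theta> (Fr x)))" using *(1) by simp
    then show "SC S R (nf S (subst \<theta> (apps (Fr x) ts)))"
      using SC_apps[of "\<theta> x" "map (subst \<theta>) ts"] subst_terms_of(1)[OF *(2,3)] *(4) by simp
  next
    fix f ts b \<theta>
    assume *: "is_subst S \<theta>" "apps (Con (Sym f)) ts \<in> terms_of S (Base b)"
      "\<forall>t\<in>set ts. SC S R (nf S (subst \<theta> t))" "f \<in> defined_syms R"
    let ?t = "nf S (subst \<theta> (apps (Con (Sym f)) ts))"
    have t: "?t \<in> terms_of S (Base b)" using subst_terms_of(3)[OF *(1,2)] .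
    have "bad ?t" if "\<not> SN S R ?t"
      unfolding bad_def using nf_subst_apps_Con[OF *(2,1)] t that *(3,4) by force
    then show "SC S R ?t \<or> (\<exists>t. bad t)" using SC_Base[OF t] by blast
  qed (auto simp: SC_Fr)
  moreover have "nf S (subst ?\<theta> t) = t"
  proof -
    have ty: "has_ty S [] t \<tau>" using terms_of_ty[OF assms(1)] .
    have "nf S (subst Fr t) = nf S (subst ?\<theta> t)"
      by (rule conv_nf_eq[OF conv_subst_pointwise[OF ty] has_ty_subst[OF ty]])
        (auto intro: nf_conv)
    then show ?thesis using terms_of_nf[OF assms(1)] by simp
  qed
  ultimately show ?thesis using assms(2) by simp
qed

text \<open>A safe prefix has a computable instance, and the remaining arguments preserve this. It
  serves twice: for variable heads through plain function-passing, and for defined heads whose term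
  violates the last condition of \<open>SDP\<close>.\<close>

lemma SC_prefix_safe:
  assumes l: "l = apps (Con (Sym f)) ls" "l \<in> terms_of S (Base c)" and \<theta>: "is_subst S \<theta>"
    and ls: "\<And>t. t \<in> set ls \<Longrightarrow> SC S R (nf S (subst \<theta> t))"
    and safe: "nf S (apps a (take k ts)) \<in> safe l"
    and t: "apps a ts \<in> terms_of S (Base b)"
    and ts: "\<forall>t\<in>set ts. SC S R (nf S (subst \<theta> t))"
  shows "SC S R (nf S (subst \<theta> (apps a ts)))"
proof -
  have eq: "apps a ts = apps (apps a (take k ts)) (drop k ts)" by (simp flip: apps_append)
  obtain \<sigma>s where ty: "has_ty S [] (apps a (take k ts)) (foldr Fun \<sigma>s (Base b))"
    using terms_of_ty[OF t] unfolding eq has_ty_apps[of _ _ "apps a (take k ts)"] by blast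
  have "nf S (subst \<theta> (nf S (apps a (take k ts)))) = nf S (subst \<theta> (apps a (take k ts)))"
    using nf_subst_nf[OF ty is_subst_ty[OF \<theta>]] .
  then have "SC S R (nf S (subst \<theta> (apps a (take k ts))))"
    using safe_SC[OF l \<theta> ls safe] by simp
  moreover have "\<forall>t\<in>set (map (subst \<theta>) (drop k ts)). SC S R (nf S t)"
    using ts set_drop_subset[of k ts] by auto
  moreover have "subst \<theta> (apps a ts) = apps (subst \<theta> (apps a (take k ts))) (map (subst \<theta>) (drop k ts))"
    by (subst eq) (rule subst_apps)
  ultimately show ?thesis using SC_apps subst_terms_of(1)[OF \<theta> t] by metis
qed

lemma dependency_pair:
  assumes PFP: "PFP S R" and R: "(l, r) \<in> R" and l: "l = apps (Con (Sym f)) ls"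
    and \<theta>: "is_subst S \<theta>" and ls: "\<And>t. t \<in> set ls \<Longrightarrow> SC S R (nf S (subst \<theta> t))"
    and r: "\<not> SC S R (nf S (subst \<theta> r))"
  obtains g ts \<theta>' b where "(sharp R l, sharp R (apps (Con (Sym g)) ts)) \<in> SDP S R"
    "g \<in> defined_syms R" "apps (Con (Sym g)) ts \<in> terms_of S (Base b)" "is_subst S \<theta>'"
    "\<And>x. x \<in> FV l \<Longrightarrow> \<theta>' x = \<theta> x" "bad (nf S (subst \<theta>' (apps (Con (Sym g)) ts)))"
proof -
  obtain c where c: "l \<in> terms_of S (Base c)" "r \<in> terms_of S (Base c)" "FV r \<subseteq> FV l"
    using ruleD[OF R] unfolding terms_of_iff by metis
  let ?B = "\<exists>g ts \<theta>' b. (sharp R l, sharp R (apps (Con (Sym g)) ts)) \<in> SDP S R \<and>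
    g \<in> defined_syms R \<and> apps (Con (Sym g)) ts \<in> terms_of S (Base b) \<and> is_subst S \<theta>' \<and>
    (\<forall>x\<in>FV l. \<theta>' x = \<theta> x) \<and> bad (nf S (subst \<theta>' (apps (Con (Sym g)) ts)))"
  \<comment> \<open>\<open>in_Sub\<close> is there for plain function-passing,
    \<open>in_Cand\<close> and the conditions on names for \<open>SDP\<close>. A variable of
    \<open>t\<close> comes from the rule or from \<open>xs\<close>, and in the latter case its value
    is computable.\<close>
  define Inv where "Inv xs t \<eta> \<longleftrightarrow> (\<forall>x\<in>FV l. \<eta> x = \<theta> x) \<and> in_Sub (FV l) r t \<and>
    in_Cand r (lams xs t) \<and> distinct xs \<and> set xs \<inter> FV l = {} \<and> FV t \<subseteq> FV r \<union> set xs \<and>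
    (\<forall>x\<in>set xs. SC S R (\<eta> x))" for xs t and \<eta> :: "('b, 'v) var \<Rightarrow> ('b, 'f, 'v) tm"
  \<comment> \<open>The search changes values at the passed binders, which avoid
    \<open>FV l\<close>; so arguments of \<open>l\<close> keep their instances.\<close>
  have ls': "SC S R (nf S (subst \<eta> t))" if "\<forall>x\<in>FV l. \<eta> x = \<theta> x" "t \<in> set ls" for \<eta> t
  proof -
    have "subst \<eta> t = subst \<theta> t" using that by (intro subst_cong) (auto simp: l)
    then show ?thesis using ls that by simp
  qed
  have "SC S R (nf S (subst \<theta> r)) \<or> ?B"
  proof (rule SC_or_failure[where A = "FV l" and Inv = Inv and xs = "[]", OF _ _ _ _ _ _ c(2) \<theta>])
    have "in_Cand r (lams [] r)" "in_Sub (FV l) r r" by (auto intro: in_Cand.intros in_Sub.intros)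
    then show "Inv [] r \<theta>" unfolding Inv_def by auto
  next
    fix xs x s \<eta> u
    assume Inv: "Inv xs (lam x s) \<eta>" and s: "lc s" "x \<notin> FV l" "x \<notin> set xs" and u: "SC S R u"
    have "in_Sub (FV l) r s"
      by (rule in_Sub_trans[of _ _ "lam x s"]) (use Inv s in \<open>auto simp: Inv_def intro: in_Sub.intros\<close>)
    then show "Inv (xs @ [x]) s (\<eta>(x := u))"
      using Inv s u unfolding Inv_def by auto
  next
    fix xs a ts t \<eta>
    assume a: "atom a" "\<forall>t\<in>set ts. lc t" "t \<in> set ts" and Inv: "Inv xs (apps a ts) \<eta>"
    have "in_Sub (FV l) (apps a ts) t" using a by (auto intro: in_Sub.intros)
    moreover have "in_Cand (lams xs (apps a ts)) (lams xs t)"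
      using a by (auto intro: in_Cand.intros)
    moreover have "FV t \<subseteq> FV (apps a ts)" using a by auto
    ultimately show "Inv xs t \<eta>"
      using Inv in_Sub_trans in_Cand_trans unfolding Inv_def by (meson order_trans)
  next
    fix xs x ts b \<eta>
    assume Inv: "Inv xs (apps (Fr x) ts) \<eta>" and \<eta>: "is_subst S \<eta>"
      and t: "apps (Fr x) ts \<in> terms_of S (Base b)" and ts: "\<forall>t\<in>set ts. SC S R (nf S (subst \<eta> t))"
    from Inv have xs: "set xs \<inter> FV l = {}" "FV (apps (Fr x) ts) \<subseteq> FV r \<union> set xs"
      "\<forall>x\<in>set xs. SC S R (\<eta> x)" and sub: "in_Sub (FV l) r (apps (Fr x) ts)"
      and \<eta>l: "\<forall>x\<in>FV l. \<eta> x = \<theta> x" unfolding Inv_def by blast+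
    show "SC S R (nf S (subst \<eta> (apps (Fr x) ts)))"
    proof (cases "x \<in> set xs")
      case True
      have "nf S (\<eta> x) = \<eta> x" using nf_lnf is_subst_lnf[OF \<eta>] by blast
      then have "SC S R (nf S (subst \<eta> (Fr x)))" using xs(3) True by simp
      then show ?thesis
        using SC_apps[of "\<eta> x" "map (subst \<eta>) ts"] subst_terms_of(1)[OF \<eta> t] ts by simp
    next
      case False
      then have "x \<in> FV r" using xs(2) by auto
      then obtain k where "nf S (apps (Fr x) (take k ts)) \<in> safe l"
        using PFP R sub unfolding PFP_def by fast
      from SC_prefix_safe[OF l c(1) \<eta> ls'[OF \<eta>l] this t ts] show ?thesis .
    qed
  next
    fix xs g ts b \<eta>
    assume Inv: "Inv xs (apps (Con (Sym g)) ts) \<eta>" and \<eta>: "is_subst S \<eta>"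
      and t: "apps (Con (Sym g)) ts \<in> terms_of S (Base b)"
      and ts: "\<forall>t\<in>set ts. SC S R (nf S (subst \<eta> t))" and g: "g \<in> defined_syms R"
    from Inv have xs: "in_Cand r (lams xs (apps (Con (Sym g)) ts))" "distinct xs"
      "set xs \<inter> FV l = {}" and \<eta>l: "\<forall>x\<in>FV l. \<eta> x = \<theta> x" unfolding Inv_def by blast+
    let ?v = "apps (Con (Sym g)) ts"
    show "SC S R (nf S (subst \<eta> ?v)) \<or> ?B"
    \<comment> \<open>With a safe prefix the term is computable and nothing has failed; without one,
      the remaining condition of a static dependency pair holds.\<close>
    proof (cases "\<exists>k\<le>length ts. nf S (apps (Con (Sym g)) (take k ts)) \<in> safe l")
      case True
      then obtain k where "nf S (apps (Con (Sym g)) (take k ts)) \<in> safe l" by blast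
      from SC_prefix_safe[OF l c(1) \<eta> ls'[OF \<eta>l] this t ts] show ?thesis by simp
    next
      case False
      have "\<forall>u\<in>set ts. lc u" using terms_of_apps_lc[OF t] .
      then have SDP: "(sharp R l, sharp R ?v) \<in> SDP S R"
        unfolding SDP_def using R g xs False by blast
      note v = subst_terms_of(3)[OF \<eta> t]
      have "bad (nf S (subst \<eta> ?v))" if "\<not> SN S R (nf S (subst \<eta> ?v))"
        unfolding bad_def using nf_subst_apps_Con[OF t \<eta>] v that ts g by force
      then show ?thesis using SDP g t \<eta> \<eta>l SC_Base[OF v] by blast
    qed
  qed simp
  then show thesis using r that by blast
qed

text \<open>Combines the conditions on one link with \<open>bad\<close>, which allows the chain to
  continue. The last conjunct lets marking be exchanged with instantiation.\<close>

definition chain_pair ::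
  "('b, 'f, 'v) tm \<Rightarrow> ('b, 'f, 'v) tm \<Rightarrow> (('b, 'v) var \<Rightarrow> ('b, 'f, 'v) tm) \<Rightarrow> bool" where
  "chain_pair l v \<theta> \<longleftrightarrow> l \<in> terms S \<and> v \<in> terms S \<and> (sharp R l, sharp R v) \<in> SDP S R \<and> is_subst S \<theta> \<and>
    nf S (subst \<theta> l) \<in> T_args_SC S R \<and> bad (nf S (subst \<theta> v)) \<and>
    nf S (subst \<theta> (sharp R v)) = sharp R (nf S (subst \<theta> v))"

text \<open>Nontermination leads through argument steps to a root step. The argument steps can be
  repeated below the marked head and give the marked instance of \<open>l\<close>; the reduct at the
  root fails to be computable and so contains the next minimal failure.\<close>

lemma bad_step:
  assumes "PFP S R" "bad t"
  obtains l v \<theta> where "chain_pair l v \<theta>"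
    "(rstep S R)\<^sup>*\<^sup>* (sharp R t) (nf S (subst \<theta> (sharp R l)))"
proof -
  from assms(2) obtain f ss b where f: "f \<in> defined_syms R" "t = apps (Con (Sym f)) ss"
    "t \<in> terms_of S (Base b)" "\<forall>s\<in>set ss. SC S R s" "\<not> SN S R t" unfolding bad_def by blast
  have t: "lnf S (apps (Con (Sym f)) ss) (Base b)" using f(2,3) by (simp add: terms_of_iff)
  obtain ss' w where ss': "list_all2 (rstep S R)\<^sup>*\<^sup>* ss ss'" "inst (apps (Con (Sym f)) ss') w" "\<not> SN S R w"
    by (rule not_SN_root[OF _ _ t]) (use f SC_SN in auto)
  from ss'(2) obtain l r \<theta> where R: "(l, r) \<in> R" "is_subst S \<theta>"
    "apps (Con (Sym f)) ss' = nf S (subst \<theta> l)" "w = nf S (subst \<theta> r)" unfolding inst_def by blast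
  from ruleD[OF R(1)] obtain g ls c where l: "l = apps (Con (Sym g)) ls" "l \<in> terms_of S (Base c)"
    unfolding terms_of_iff by metis
  have eq: "nf S (subst \<theta> l) = apps (Con (Sym g)) (map (\<lambda>t. nf S (subst \<theta> t)) ls)"
    using nf_subst_apps_Con l R(2) by blast
  then have g: "g = f" "ss' = map (\<lambda>t. nf S (subst \<theta> t)) ls" using R(3) by (auto simp: apps_inject)
  have SC': "SC S R s" if "s \<in> set ss'" for s
    using that ss'(1) f(4) SC_rsteps by (metis in_set_conv_nth list_all2_conv_all_nth nth_mem)
  have "\<not> SC S R (nf S (subst \<theta> r))" using ss'(3) R(4) SC_SN by blast
  with dependency_pair[OF assms(1) R(1) l(1) R(2)] SC' g(2) obtain h ts \<theta>' d where
    dp: "(sharp R l, sharp R (apps (Con (Sym h)) ts)) \<in> SDP S R"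
      "h \<in> defined_syms R" "apps (Con (Sym h)) ts \<in> terms_of S (Base d)" "is_subst S \<theta>'"
      "\<And>x. x \<in> FV l \<Longrightarrow> \<theta>' x = \<theta> x" "bad (nf S (subst \<theta>' (apps (Con (Sym h)) ts)))"
    by (metis (no_types, lifting) image_eqI list.set_map)
  let ?v = "apps (Con (Sym h)) ts"
  \<comment> \<open>The new substitution leaves the instance of \<open>l\<close> unchanged, so it
    serves for both components of the pair.\<close>
  have sub: "subst \<theta>' l = subst \<theta> l" using dp(5) by (intro subst_cong)
  have nf_sharp: "nf S (subst \<eta> (sharp R (apps (Con (Sym k)) us))) = sharp R (nf S (subst \<eta> (apps (Con (Sym k)) us)))"
    if u: "apps (Con (Sym k)) us \<in> terms_of S (Base e)" and k: "k \<in> defined_syms R" and \<eta>: "is_subst S \<eta>"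
    for k us e \<eta>
  proof -
    have "has_ty S [] (subst \<eta> (apps (Con (Sym k)) us)) (Base e)" using subst_terms_of(1)[OF \<eta> u] .
    then have "has_ty S [] (apps (Con (Mark k)) (map (subst \<eta>) us)) (Base e)" by (simp add: has_ty_apps)
    then have "nf S (apps (Con (Mark k)) (map (subst \<eta>) us)) = apps (Con (Mark k)) (map (\<lambda>t. nf S (subst \<eta> t)) us)"
      by (subst nf_apps) (auto simp: comp_def)
    then show ?thesis using nf_subst_apps_Con[OF u \<eta>] k by (simp add: sharp_apps)
  qed
  have ss'_terms: "apps (Con (Sym f)) ss' \<in> terms_of S (Base c)"
    using R(3) subst_terms_of(3)[OF R(2) l(2)] by simp
  have "apps (Con (Sym f)) ss' \<in> T_args_SC S R" using ss'_terms SC' by (intro apps_T_args_SC) auto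
  then have "chain_pair l ?v \<theta>'"
    unfolding chain_pair_def using l(2) dp nf_sharp[OF dp(3,2,4)] R(3) sub by (auto simp: terms_def)
  moreover have "nf S (subst \<theta>' (sharp R l)) = apps (Con (Mark f)) ss'"
  proof -
    have "nf S (subst \<theta>' (sharp R l)) = sharp R (nf S (subst \<theta>' l))"
      using nf_sharp l dp(4) f(1) g(1) by blast
    also have "\<dots> = sharp R (apps (Con (Sym f)) ss')" by (simp only: sub R(3))
    finally show ?thesis using f(1) by (simp add: sharp_apps)
  qed
  \<comment> \<open>Steps need a long normal source; \<open>Mark f\<close> has the type of
    \<open>Sym f\<close>, so the head can be exchanged.\<close>
  moreover have "lnf S (apps (Con (Mark f)) ss) (Base b)"
    using t by (auto elim!: lnf_appsD intro!: lnf.intros)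
  ultimately show thesis
    using that rsteps_args[OF ss'(1)] f(1,2) by (simp add: sharp_apps)
qed

lemma bad_imp_chain:
  assumes "PFP S R" "bad t"
  shows "\<exists>u v. sd_chain S R \<infinity> u v"
proof -
  \<comment> \<open>A state keeps the substitution with the pair, because the next link starts from
    that very instance.\<close>
  let ?P = "\<lambda>(l, v, \<theta>). chain_pair l v \<theta>"
  let ?Q = "\<lambda>(l, v, \<theta>) (l', v', \<theta>').
    (rstep S R)\<^sup>*\<^sup>* (nf S (subst \<theta> (sharp R v))) (nf S (subst \<theta>' (sharp R l')))"
  have "\<exists>F. \<forall>n. ?P (F n) \<and> ?Q (F n) (F (Suc n))"
  proof (rule dependent_nat_choice)
    from bad_step[OF assms] obtain l v \<theta> where "chain_pair l v \<theta>" .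
    then have "?P (l, v, \<theta>)" by simp
    then show "\<exists>x. ?P x" ..
  next
    fix x :: "_ \<times> _ \<times> _" and n :: nat assume "?P x"
    moreover obtain l v \<theta> where x: "x = (l, v, \<theta>)" by (cases x)
    ultimately have lv: "chain_pair l v \<theta>" by simp
    then have "bad (nf S (subst \<theta> v))" by (simp add: chain_pair_def)
    from bad_step[OF assms(1) this] obtain l' v' \<theta>' where "chain_pair l' v' \<theta>'"
      "(rstep S R)\<^sup>*\<^sup>* (sharp R (nf S (subst \<theta> v))) (nf S (subst \<theta>' (sharp R l')))" .
    then have "?P (l', v', \<theta>') \<and> ?Q x (l', v', \<theta>')" using lv x by (simp add: chain_pair_def)
    then show "\<exists>y. ?P y \<and> ?Q x y" ..
  qed
  then obtain F where *: "\<forall>n. ?P (F n) \<and> ?Q (F n) (F (Suc n))" ..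
  have F: "?P (F n)" "?Q (F n) (F (Suc n))" for n
    using *[rule_format, of n] by (rule conjunct1, rule conjunct2)
  define u v \<theta> where "u = (\<lambda>n. fst (F n))" and "v = (\<lambda>n. fst (snd (F n)))"
    and "\<theta> = (\<lambda>n. snd (snd (F n)))"
  have P: "chain_pair (u n) (v n) (\<theta> n)" for n
    using F(1)[of n] by (simp add: u_def v_def \<theta>_def case_prod_beta)
  have Q: "(rstep S R)\<^sup>*\<^sup>* (nf S (subst (\<theta> n) (sharp R (v n))))
      (nf S (subst (\<theta> (Suc n)) (sharp R (u (Suc n)))))" for n
    using F(2)[of n] by (simp add: u_def v_def \<theta>_def case_prod_beta)
  have "sd_chain S R \<infinity> u v"
    unfolding sd_chain_def using P Q bad_T_args_SC
    by (intro conjI exI[of _ \<theta>] allI impI) (simp_all add: chain_pair_def)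
  then show ?thesis by blast
qed

end

theorem theorem1:
  fixes S :: "'f \<Rightarrow> 'b ty"
    and R :: "('b, 'f, 'v :: infinite) rules"
  assumes "HRS S R"
    and "PFP S R"
    and "\<not> (\<exists>u v. sd_chain S R \<infinity> u v)"
  shows "\<not> (\<exists>t :: nat \<Rightarrow> ('b, 'f, 'v) tm. (\<forall>i. t i \<in> terms S) \<and> (\<forall>i. rstep S R (t i) (t (Suc i))))"
proof
  interpret hrs S R by unfold_locales (rule assms(1))
  assume "\<exists>t :: nat \<Rightarrow> ('b, 'f, 'v) tm. (\<forall>i. t i \<in> terms S) \<and> (\<forall>i. rstep S R (t i) (t (Suc i)))"
  then obtain t :: "nat \<Rightarrow> ('b, 'f, 'v) tm" where t: "t 0 \<in> terms S" "\<And>i. rstep S R (t i) (t (Suc i))" by blast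
  then have "\<not> SN S R (t 0)" unfolding SN_def by blast
  then have "\<not> SC S R (t 0)" using SC_SN by blast
  then obtain b where "bad b" using t(1) exists_bad unfolding terms_def by blast
  then show False using bad_imp_chain[OF assms(2)] assms(3) by blast
qed

end
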